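(* Let $G$ be a finite group admitting a graded $\mathbb{C}[G]$-module $$V^G=\bigoplus_{n\in\{-1\}\cup\mathbb{N}}V^G_n$$ (each $V^G_n$ finite-dimensional) such that for every $g\in G$, the group $\Gamma_0(\mathrm{ord}(g))$ has genus zero and the McKay–Thompson series $\mathrm{Tr}(g\mid V^G):=\sum_n \mathrm{Tr}(g\mid V^G_n)q^n$ equals $T_{\mathrm{ord}(g)}$, the normalized Hauptmodul of $\Gamma_0(\mathrm{ord}(g))$. Then every prime $p$ dividing $|G|$ satisfies $(p-1)\mid 24$; moreover $\mathrm{ord}_p(|G|)\le \frac{24}{p-1}$ for every odd prime $p$, and $\mathrm{ord}_2(|G|)\le 25$.
   Context: $q=e^{2\pi i\tau}$; $\mathrm{ord}(g)$ is the order of $g$; $\mathrm{ord}_p$ is the $p$-adic valuation. $\Gamma_0(N)$ is the subgroup of $\mathrm{SL}_2(\mathbb{Z})$ of matrices with lower-left entry divisible by $N$; it has genus zero exactly for $N\in\{1,2,3,4,5,6,7,8,9,10,12,13,16,18,25\}$. For such $N$, the normalized Hauptmodul $T_N$ of $\Gamma_0(N)$ is the unique modular function on $\Gamma_0(N)$, holomorphic on the upper half-plane and at all cusps other than $\infty$, whose $q$-expansion is $q^{-1}+O(q)$ (zero constant term); it generates the function field of the compactified curve $\Gamma_0(N)\backslash\mathbb{H}$. In particular $T_1=J=q^{-1}+196884q+\cdots$. *)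

theory Defs
  imports "HOL-Complex_Analysis.Complex_Analysis" "HOL-Homology.Homology"
    "HOL-Algebra.Multiplicative_Group"
begin

section \<open>Congruence subgroups and their action on the extended upper half-plane\<close>

definition SL2Z :: "(int^2^2) set" where
  "SL2Z = {A. det A = 1}"

definition Gamma0 :: "nat \<Rightarrow> (int^2^2) set" where
  "Gamma0 N = {A \<in> SL2Z. int N dvd A $ 2 $ 1}"

definition upper_half_plane :: "complex set" where
  "upper_half_plane = {z. Im z > 0}"

definition moebius :: "int^2^2 \<Rightarrow> complex \<Rightarrow> complex" where
  "moebius A z = (of_int (A $ 1 $ 1) * z + of_int (A $ 1 $ 2)) /
                 (of_int (A $ 2 $ 1) * z + of_int (A $ 2 $ 2))"

text \<open>The Riemann sphere is modelled as \<^typ>\<open>complex option\<close>, where \<^term>\<open>None\<close> is the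
  point at infinity.\<close>

fun moebius_ext :: "int^2^2 \<Rightarrow> complex option \<Rightarrow> complex option" where
  "moebius_ext A None =
     (if A $ 2 $ 1 = 0 then None else Some (of_int (A $ 1 $ 1) / of_int (A $ 2 $ 1)))"
| "moebius_ext A (Some z) =
     (if of_int (A $ 2 $ 1) * z + of_int (A $ 2 $ 2) = 0 then None else Some (moebius A z))"

definition cusps :: "complex option set" where
  "cusps = insert None (Some ` \<rat>)"

definition extended_half_plane :: "complex option set" where
  "extended_half_plane = Some ` upper_half_plane \<union> cusps"

definition orbit_ext :: "nat \<Rightarrow> complex option \<Rightarrow> complex option set" where
  "orbit_ext N x = {moebius_ext A x | A. A \<in> Gamma0 N}"


section \<open>The compactified modular curve and its genus\<close>

text \<open>The usual topology on the extended upper half-plane: a neighbourhood of a cusp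
  \<open>\<alpha> \<infinity>\<close>, with \<open>\<alpha>\<close> in \<^const>\<open>SL2Z\<close>, contains the \<open>\<alpha>\<close>-image of some half-plane
  \<open>Im z > M\<close>.\<close>

definition extended_open :: "complex option set \<Rightarrow> bool" where
  "extended_open U \<longleftrightarrow>
     U \<subseteq> extended_half_plane \<and>
     open {z \<in> upper_half_plane. Some z \<in> U} \<and>
     (\<forall>A\<in>SL2Z. moebius_ext A None \<in> U \<longrightarrow>
        (\<exists>M>0. \<forall>z. Im z > M \<longrightarrow> moebius_ext A (Some z) \<in> U))"

lemma istopology_extended_open: "istopology extended_open"
  unfolding istopology_def
proof (intro conjI allI impI)
  fix S T assume S: "extended_open S" and T: "extended_open T"
  have eq: "{z \<in> upper_half_plane. Some z \<in> S \<inter> T} =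
        {z \<in> upper_half_plane. Some z \<in> S} \<inter> {z \<in> upper_half_plane. Some z \<in> T}"
    by auto
  show "extended_open (S \<inter> T)"
    unfolding extended_open_def
  proof (intro conjI ballI impI)
    show "S \<inter> T \<subseteq> extended_half_plane"
      using S by (auto simp: extended_open_def)
    show "open {z \<in> upper_half_plane. Some z \<in> S \<inter> T}"
      unfolding eq using S T by (auto simp: extended_open_def)
    fix A assume A: "A \<in> SL2Z" "moebius_ext A None \<in> S \<inter> T"
    obtain M where M: "M > 0" "\<And>z. Im z > M \<Longrightarrow> moebius_ext A (Some z) \<in> S"
      using S A unfolding extended_open_def by blast
    obtain M' where M': "M' > 0" "\<And>z. Im z > M' \<Longrightarrow> moebius_ext A (Some z) \<in> T"
      using T A unfolding extended_open_def by blast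
    show "\<exists>M>0. \<forall>z. Im z > M \<longrightarrow> moebius_ext A (Some z) \<in> S \<inter> T"
      by (rule exI[of _ "max M M'"]) (use M M' in auto)
  qed
next
  fix K assume K: "\<forall>S\<in>K. extended_open S"
  have eq: "{z \<in> upper_half_plane. Some z \<in> \<Union>K} =
        (\<Union>S\<in>K. {z \<in> upper_half_plane. Some z \<in> S})"
    by auto
  show "extended_open (\<Union>K)"
    unfolding extended_open_def
  proof (intro conjI ballI impI)
    show "\<Union>K \<subseteq> extended_half_plane"
      using K by (auto simp: extended_open_def)
    show "open {z \<in> upper_half_plane. Some z \<in> \<Union>K}"
      unfolding eq using K by (auto simp: extended_open_def)
    fix A assume A: "A \<in> SL2Z" "moebius_ext A None \<in> \<Union>K"
    then obtain S where S: "S \<in> K" "moebius_ext A None \<in> S"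
      by auto
    then obtain M where "M > 0" "\<And>z. Im z > M \<Longrightarrow> moebius_ext A (Some z) \<in> S"
      using K A(1) unfolding extended_open_def by blast
    then show "\<exists>M>0. \<forall>z. Im z > M \<longrightarrow> moebius_ext A (Some z) \<in> \<Union>K"
      using S(1) by blast
  qed
qed

definition extended_topology :: "complex option topology" where
  "extended_topology = topology extended_open"

text \<open>The quotient topology on the set of \<^term>\<open>Gamma0 N\<close>-orbits.\<close>

definition modular_curve :: "nat \<Rightarrow> complex option set topology" where
  "modular_curve N =
     topology (\<lambda>W. W \<subseteq> orbit_ext N ` extended_half_plane \<and>
       openin extended_topology {x \<in> extended_half_plane. orbit_ext N x \<in> W})"

lemma istopology_quotient:
  fixes f :: "'a \<Rightarrow> 'b"
  shows "istopology (\<lambda>W. W \<subseteq> f ` S \<and> openin X {x \<in> S. f x \<in> W})"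
  unfolding istopology_def
proof (intro conjI allI impI)
  fix A B :: "'b set"
  assume AB: "A \<subseteq> f ` S \<and> openin X {x \<in> S. f x \<in> A}" "B \<subseteq> f ` S \<and> openin X {x \<in> S. f x \<in> B}"
  have "{x \<in> S. f x \<in> A \<inter> B} = {x \<in> S. f x \<in> A} \<inter> {x \<in> S. f x \<in> B}"
    by auto
  then show "A \<inter> B \<subseteq> f ` S" "openin X {x \<in> S. f x \<in> A \<inter> B}"
    using AB by auto
next
  fix K :: "'b set set"
  assume K: "\<forall>W\<in>K. W \<subseteq> f ` S \<and> openin X {x \<in> S. f x \<in> W}"
  have "{x \<in> S. f x \<in> \<Union>K} = (\<Union>W\<in>K. {x \<in> S. f x \<in> W})"
    by auto
  moreover have "openin X (\<Union>W\<in>K. {x \<in> S. f x \<in> W})"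
    by (rule openin_Union) (use K in auto)
  ultimately show "openin X {x \<in> S. f x \<in> \<Union>K}"
    by simp
  show "\<Union>K \<subseteq> f ` S"
    using K by blast
qed

text \<open>The genus of a compact Riemann surface (a closed connected orientable surface) is half the
  rank of its first integral homology group.\<close>

definition has_genus :: "'a topology \<Rightarrow> nat \<Rightarrow> bool" where
  "has_genus X g \<longleftrightarrow> homology_group 1 X \<cong> free_Abelian_group {..<2 * g}"


section \<open>Modular functions and normalized Hauptmoduln\<close>

text \<open>For large \<open>Im \<tau>\<close> one has \<open>f \<tau> = (\<Sum>n\<ge>m. a n * q ^ (n / w))\<close>, where
  \<open>q ^ (n / w)\<close> means \<open>exp (2 \<pi> i n \<tau> / w)\<close>. Coefficients \<open>a n\<close> with \<open>n < m\<close> play no role.\<close>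

definition has_q_expansion ::
    "nat \<Rightarrow> int \<Rightarrow> (int \<Rightarrow> complex) \<Rightarrow> (complex \<Rightarrow> complex) \<Rightarrow> bool" where
  "has_q_expansion w m a f \<longleftrightarrow>
     (\<exists>Y>0. \<forall>\<tau>. Im \<tau> > Y \<longrightarrow>
        ((\<lambda>n. a n * exp (2 * of_real pi * \<i> * of_int n * \<tau> / of_nat w)) has_sum f \<tau>) {m..})"

text \<open>The behaviour of \<open>f\<close> at the cusp \<open>\<alpha> \<infinity>\<close> is that of \<open>f \<circ> \<alpha>\<close> at \<open>\<infinity>\<close>. Every cusp of
  \<^term>\<open>Gamma0 N\<close> has width dividing \<open>N\<close>, so expansions in \<open>q ^ (1 / N)\<close> suffice.\<close>

definition modular_function :: "nat \<Rightarrow> (complex \<Rightarrow> complex) \<Rightarrow> bool" where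
  "modular_function N f \<longleftrightarrow>
     f nicely_meromorphic_on upper_half_plane \<and>
     (\<forall>A\<in>Gamma0 N. \<forall>\<tau>\<in>upper_half_plane. f (moebius A \<tau>) = f \<tau>) \<and>
     (\<forall>A\<in>SL2Z. \<exists>m a. has_q_expansion N m a (f \<circ> moebius A))"

definition normalized_hauptmodul :: "nat \<Rightarrow> (complex \<Rightarrow> complex) \<Rightarrow> bool" where
  "normalized_hauptmodul N f \<longleftrightarrow>
     modular_function N f \<and>
     f holomorphic_on upper_half_plane \<and>
     (\<forall>A\<in>SL2Z. moebius_ext A None \<notin> orbit_ext N None \<longrightarrow>
        (\<exists>a. has_q_expansion N 0 a (f \<circ> moebius A))) \<and>
     (\<exists>a. has_q_expansion 1 (-1) a f \<and> a (-1) = 1 \<and> a 0 = 0)"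


section \<open>Traces and graded modules over the group algebra\<close>

definition finite_dim_subspace ::
    "('k::field \<Rightarrow> 'v::ab_group_add \<Rightarrow> 'v) \<Rightarrow> 'v set \<Rightarrow> bool" where
  "finite_dim_subspace smul U \<longleftrightarrow> (\<exists>B. finite B \<and> module.span smul B = U)"

text \<open>The trace of an endomorphism \<open>f\<close> of a finite-dimensional subspace \<open>U\<close>, computed in an
  arbitrary basis; the choice is irrelevant by \<open>trace_on_eq\<close> below.\<close>

definition trace_on ::
    "('k::field \<Rightarrow> 'v::ab_group_add \<Rightarrow> 'v) \<Rightarrow> 'v set \<Rightarrow> ('v \<Rightarrow> 'v) \<Rightarrow> 'k" where
  "trace_on smul U f =
     (let B = (SOME B. finite B \<and> \<not> module.dependent smul B \<and> module.span smul B = U)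
      in \<Sum>b\<in>B. module.representation smul B (f b) b)"

context vector_space
begin

lemma trace_basis_independent:
  assumes f: "Vector_Spaces.linear scale scale f" and fU: "f ` U \<subseteq> U"
    and B: "finite B" "independent B" "span B = U"
    and C: "finite C" "independent C" "span C = U"
  shows "(\<Sum>b\<in>B. representation B (f b) b) = (\<Sum>c\<in>C. representation C (f c) c)"
proof -
  interpret f: Vector_Spaces.linear scale scale f by (rule f)
  have B': "b \<in> span C" if "b \<in> B" for b using that B C span_base by blast
  have C': "f c \<in> span B" if "c \<in> C" for c using that B C fU span_base by blast
  have B'': "b \<in> span B" if "b \<in> B" for b using that span_base by blast
  have expand: "(\<Sum>x\<in>X. representation X v x *s x) = v"
    if "finite X" "independent X" "v \<in> span X" for X v
    using sum_representation_eq[of X v X] that by simp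
  have 1: "representation B (f b) b = (\<Sum>c\<in>C. representation C b c * representation B (f c) b)"
    if b: "b \<in> B" for b
  proof -
    have "f b = f (\<Sum>c\<in>C. representation C b c *s c)"
      using expand[OF C(1,2) B'[OF b]] by simp
    also have "\<dots> = (\<Sum>c\<in>C. representation C b c *s f c)"
      by (simp add: f.sum f.scale)
    finally show ?thesis
      using C' by (simp add: representation_sum[OF B(2)] representation_scale[OF B(2)] span_scale)
  qed
  have 2: "representation C (f c) c = (\<Sum>b\<in>B. representation B (f c) b * representation C b c)"
    if c: "c \<in> C" for c
  proof -
    have "representation C (f c) c = representation C (\<Sum>b\<in>B. representation B (f c) b *s b) c"
      using expand[OF B(1,2) C'[OF c]] by simp
    then show ?thesis
      using B' by (simp add: representation_sum[OF C(2)] representation_scale[OF C(2)] span_scale)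
  qed
  have "(\<Sum>b\<in>B. representation B (f b) b) =
        (\<Sum>b\<in>B. \<Sum>c\<in>C. representation C b c * representation B (f c) b)"
    by (simp add: 1)
  also have "\<dots> = (\<Sum>c\<in>C. \<Sum>b\<in>B. representation C b c * representation B (f c) b)"
    by (rule sum.swap)
  also have "\<dots> = (\<Sum>c\<in>C. representation C (f c) c)"
    by (simp add: 2 mult.commute)
  finally show ?thesis .
qed

lemma trace_on_eq:
  assumes "Vector_Spaces.linear scale scale f" "f ` U \<subseteq> U"
    and B: "finite B" "independent B" "span B = U"
  shows "trace_on scale U f = (\<Sum>b\<in>B. representation B (f b) b)"
proof -
  define C where "C = (SOME C. finite C \<and> independent C \<and> span C = U)"
  have "finite C \<and> independent C \<and> span C = U"
    unfolding C_def by (rule someI[of _ B]) (use B in simp)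
  then show ?thesis
    using trace_basis_independent[OF assms(1,2) _ _ _ B, of C]
    by (simp add: trace_on_def C_def Let_def)
qed

end

text \<open>A \<open>\<complex>[G]\<close>-module is given as a complex vector space with a linear action of \<open>G\<close>.
  The grading is indexed by \<open>{-1} \<union> \<nat> = {-1..}\<close>; the values \<open>V n\<close> for \<open>n < -1\<close> play no role.\<close>

locale graded_group_module =
  grp: group G + vector_space smul
  for G :: "('g, 'r) monoid_scheme"
    and smul :: "complex \<Rightarrow> 'v::ab_group_add \<Rightarrow> 'v"
    and act :: "'g \<Rightarrow> 'v \<Rightarrow> 'v"
    and V :: "int \<Rightarrow> 'v set" +
  assumes act_linear: "g \<in> carrier G \<Longrightarrow> Vector_Spaces.linear smul smul (act g)"
    and act_one: "act \<one>\<^bsub>G\<^esub> v = v"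
    and act_mult: "g \<in> carrier G \<Longrightarrow> h \<in> carrier G \<Longrightarrow> act (g \<otimes>\<^bsub>G\<^esub> h) v = act g (act h v)"
    and grading_subspace: "n \<ge> -1 \<Longrightarrow> subspace (V n)"
    and grading_invariant: "n \<ge> -1 \<Longrightarrow> g \<in> carrier G \<Longrightarrow> act g ` V n \<subseteq> V n"
    and grading_direct_sum:
      "\<exists>!w. (\<forall>n. n \<ge> - 1 \<longrightarrow> w n \<in> V n) \<and> (\<forall>n. n < - 1 \<longrightarrow> w n = 0) \<and>
            finite {n. w n \<noteq> 0} \<and>
            v = (\<Sum>n | w n \<noteq> 0. w n)"

end

theory Submission
  imports Defs "HOL-Number_Theory.Cong" "HOL-Algebra.Sylow"
begin

text \<open>
  For a subgroup \<open>H\<close> of \<open>G\<close> the sum of the traces of its elements on \<open>V\<^sub>n\<close> is \<open>|H|\<close> times the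
  dimension of the \<open>H\<close>-invariants of \<open>V\<^sub>n\<close>. For \<open>H\<close> of order \<open>p > 2\<close> and \<open>n = 1\<close> this gives
  \<open>p dvd 196560 = 2\<^sup>4 * 3\<^sup>3 * 5 * 7 * 13\<close>. For \<open>p\<close> in \<open>{2, 3, 5, 7, 13}\<close> there is an integral combination of
  a few coefficients that vanishes on the Hauptmoduln of all levels \<open>p\<^sup>j > 1\<close> that can occur and whose value on
  \<open>J\<close> is divisible by exactly the \<open>p\<close>-power of the claimed bound; take \<open>H\<close> to be a Sylow subgroup.

  The coefficients come from the principle that a holomorphic invariant function which is bounded at all cusps
  and vanishes at \<open>\<infinity>\<close> is zero. At prime level it yields \<open>(T\<^sub>p(\<tau>) - c) ^ (p - 1) = \<Delta>(\<tau>) / \<Delta>(p \<tau>)\<close> with \<open>c\<close> the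
  value at the cusp \<open>0\<close>, and \<open>J\<close> is \<open>24\<close> plus the sum of the translates of \<open>\<Delta>(\<tau>) / \<Delta>(2 \<tau>)\<close>. If \<open>h\<^sup>2\<close> divides
  \<open>N\<close>, then suitable averages of the translates \<open>T\<^sub>N(\<tau> + s / h)\<close> are multiples of \<open>T\<^sub>N\<close>, so many coefficients
  vanish. For \<open>4 dvd N\<close> one has \<open>T\<^sub>N(\<tau>)\<^sup>2 = T\<^sub>M(2 \<tau>) + const\<close> with \<open>M = N / 2\<close>, which settles the
  levels 4, 8, 16 and rules out 32.
\<close>

text \<open>The group is known only through element orders and the integrality of sums over
  subgroups, so every level has to be settled by explicit coefficients. The analytic input is the
  weight 12 law of \<Delta>. It is obtained by integrating the law of the logarithmic derivative E2
  under inversion, and the correction term in that law is the price of exchanging two sums in a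
  conditionally convergent lattice series. At levels 4, 8, 16 the square relation is not enough: it
  contains the coefficient of q as an unknown. The second relation comes from the trace from level N
  down to level N / 2. Together they express the value at the cusp 0 and the coefficient of q
  through the value at 0 one level below. These values are 24, 8, 4, 2 at levels 2, 4, 8,
  16.\<close>

no_notation fps_nth (infixl \<open>$\<close> 75)
no_notation exact_seq_arrow (\<open>(\<open>indent=3 notation=\<open>mixfix exact_seq\<close>\<close>_ / \<longlongrightarrow>\<index> _)\<close> [1000, 60])

section \<open>Expansions in \<open>q\<close>\<close>

definition at_ii :: "complex filter" where "at_ii = filtercomap Im at_top"

lemma eventually_at_ii: "eventually P at_ii \<longleftrightarrow> (\<exists>Y. \<forall>\<tau>. Im \<tau> > Y \<longrightarrow> P \<tau>)"
  unfolding at_ii_def eventually_filtercomap_at_top_dense by simp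

lemma at_ii_neq_bot [simp]: "at_ii \<noteq> bot"
proof -
  have "\<not> eventually (\<lambda>_. False) at_ii"
    unfolding eventually_at_ii by (metis complex.sel(2) lt_ex gt_ex)
  then show ?thesis by (auto simp: trivial_limit_def)
qed

lemma eventually_at_ii_Im_gt: "eventually (\<lambda>\<tau>. Im \<tau> > Y) at_ii"
  unfolding eventually_at_ii by blast

lemma filterlim_at_ii_iff: "filterlim f at_ii F \<longleftrightarrow> filterlim (\<lambda>x. Im (f x)) at_top F"
  unfolding at_ii_def by (simp add: filterlim_filtercomap_iff o_def)

lemma filterlim_Im_at_ii: "filterlim Im at_top at_ii"
  unfolding at_ii_def by (rule filterlim_filtercomap)

lemma filterlim_at_ii_affine:
  assumes "r > 0"
  shows "filterlim (\<lambda>\<tau>. of_real r * \<tau> + s) at_ii at_ii"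
  unfolding filterlim_at_ii_iff
  using filterlim_tendsto_add_at_top[OF tendsto_const
      filterlim_tendsto_pos_mult_at_top[OF tendsto_const assms filterlim_Im_at_ii], of "Im s"]
  by (simp add: add.commute)

definition qexp :: "complex \<Rightarrow> complex" where
  "qexp \<tau> = exp (2 * of_real pi * \<i> * \<tau>)"

lemma norm_qexp: "norm (qexp \<tau>) = exp (- 2 * pi * Im \<tau>)"
  by (simp add: qexp_def)

lemma qexp_nonzero [simp]: "qexp \<tau> \<noteq> 0"
  by (simp add: qexp_def)

lemma norm_qexp_less_1: "Im \<tau> > 0 \<Longrightarrow> norm (qexp \<tau>) < 1"
  by (simp add: norm_qexp)

lemma qexp_add: "qexp (a + b) = qexp a * qexp b"
  by (simp add: qexp_def exp_add algebra_simps)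

lemma qexp_diff: "qexp (a - b) = qexp a / qexp b"
  by (simp add: qexp_def exp_diff algebra_simps)

lemma qexp_of_int [simp]: "qexp (of_int n) = 1"
proof -
  have "qexp (of_int n) = exp ((2 * of_int n * pi) * \<i>)" by (simp add: qexp_def algebra_simps)
  then show ?thesis by (metis exp_integer_2pi Ints_of_int mult.assoc mult.commute of_real_mult of_real_of_int_eq of_real_numeral)
qed

lemma qexp_0 [simp]: "qexp 0 = 1" by (simp add: qexp_def)
lemma qexp_of_nat [simp]: "qexp (of_nat n) = 1" using qexp_of_int[of "int n"] by (simp del: qexp_of_int)

lemma qexp_mult_of_nat: "qexp (of_nat n * \<tau>) = qexp \<tau> ^ n"
  by (simp add: qexp_def exp_of_nat_mult[symmetric] algebra_simps)

lemma qexp_surj: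
  assumes "z \<noteq> 0"
  obtains \<tau> where "qexp \<tau> = z" "Im \<tau> = - ln (norm z) / (2 * pi)"
proof -
  define \<tau> where "\<tau> = Ln z / (2 * of_real pi * \<i>)"
  have "qexp \<tau> = z" unfolding qexp_def \<tau>_def using assms by simp
  moreover from this have "norm z = exp (- 2 * pi * Im \<tau>)" by (metis norm_qexp)
  then have "ln (norm z) = - 2 * pi * Im \<tau>" by simp
  then have "Im \<tau> = - ln (norm z) / (2 * pi)" by (simp add: field_simps)
  ultimately show ?thesis using that by blast
qed

lemma filterlim_qexp: "filterlim qexp (at 0) at_ii"
proof (rule filterlim_atI)
  have "((\<lambda>\<tau>. exp (- 2 * pi * Im \<tau>)) \<longlongrightarrow> 0) at_ii"
    by (rule filterlim_compose[OF exp_at_bot])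
      (rule filterlim_tendsto_neg_mult_at_bot[OF tendsto_const _ filterlim_Im_at_ii], simp)
  then show "(qexp \<longlongrightarrow> 0) at_ii"
    by (subst tendsto_norm_zero_iff [symmetric]) (simp only: norm_qexp)
qed auto

lemma tendsto_qexp: "(qexp \<longlongrightarrow> 0) at_ii"
  using filterlim_qexp by (rule filterlim_mono) (auto simp: at_within_le_nhds)

text \<open>As \<open>qexp\<close> is onto the punctured plane and small \<open>q\<close> means
  large \<open>Im \<tau>\<close>, a property near the cusp becomes one on a punctured disc.\<close>

lemma eventually_qexp_imp_at_0:
  assumes "eventually (\<lambda>\<tau>. P (qexp \<tau>)) at_ii"
  shows "eventually P (at 0)"
proof -
  obtain Y where Y: "\<And>\<tau>. Im \<tau> > Y \<Longrightarrow> P (qexp \<tau>)"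
    using assms unfolding eventually_at_ii by blast
  have "P z" if z: "z \<noteq> 0" "norm z < exp (- 2 * pi * Y)" for z
  proof -
    obtain \<tau> where \<tau>: "qexp \<tau> = z" "Im \<tau> = - ln (norm z) / (2 * pi)"
      using qexp_surj[OF z(1)] by blast
    have "ln (norm z) < - 2 * pi * Y"
      using z by (metis exp_ln exp_less_cancel_iff zero_less_norm_iff)
    then have "Im \<tau> > Y" unfolding \<tau>(2) by (simp add: field_simps)
    then show ?thesis using Y \<tau> by blast
  qed
  then show ?thesis unfolding eventually_at by (intro exI[of _ "exp (- 2 * pi * Y)"]) auto
qed

text \<open>Holomorphy in q at the cusp, with \<open>q = 0\<close> included. Only nonnegative powers
  occur, so a function with a simple pole is entered multiplied by \<open>qexp\<close>.\<close>

definition q_fps :: "(complex \<Rightarrow> complex) \<Rightarrow> complex fps \<Rightarrow> bool" where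
  "q_fps f F \<longleftrightarrow> (\<exists>g. g has_fps_expansion F \<and> eventually (\<lambda>\<tau>. f \<tau> = g (qexp \<tau>)) at_ii)"

lemma q_fps_cong:
  assumes "q_fps f F" "eventually (\<lambda>\<tau>. f \<tau> = f' \<tau>) at_ii"
  shows "q_fps f' F"
proof -
  obtain g where g: "g has_fps_expansion F" "eventually (\<lambda>\<tau>. f \<tau> = g (qexp \<tau>)) at_ii"
    using assms unfolding q_fps_def by blast
  from g(2) assms(2) have "eventually (\<lambda>\<tau>. f' \<tau> = g (qexp \<tau>)) at_ii" by eventually_elim simp
  with g show ?thesis unfolding q_fps_def by blast
qed

lemma q_fps_binop:
  assumes "q_fps f F" "q_fps f' F'"
    and "\<And>g g'. g has_fps_expansion F \<Longrightarrow> g' has_fps_expansion F' \<Longrightarrow> (\<lambda>x. h (g x) (g' x)) has_fps_expansion K"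
  shows "q_fps (\<lambda>\<tau>. h (f \<tau>) (f' \<tau>)) K"
proof -
  obtain g where g: "g has_fps_expansion F" "eventually (\<lambda>\<tau>. f \<tau> = g (qexp \<tau>)) at_ii"
    using assms unfolding q_fps_def by blast
  obtain g' where g': "g' has_fps_expansion F'" "eventually (\<lambda>\<tau>. f' \<tau> = g' (qexp \<tau>)) at_ii"
    using assms unfolding q_fps_def by blast
  from g(2) g'(2) have "eventually (\<lambda>\<tau>. h (f \<tau>) (f' \<tau>) = h (g (qexp \<tau>)) (g' (qexp \<tau>))) at_ii"
    by eventually_elim simp
  with assms(3)[OF g(1) g'(1)] show ?thesis unfolding q_fps_def by (intro exI[of _ "\<lambda>x. h (g x) (g' x)"]) simp
qed

lemma q_fps_const [intro, simp]: "q_fps (\<lambda>_. c) (fps_const c)"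
  unfolding q_fps_def by (intro exI[of _ "\<lambda>_. c"]) auto

lemma q_fps_qexp [intro, simp]: "q_fps qexp fps_X"
  unfolding q_fps_def by (intro exI[of _ "\<lambda>x. x"]) (auto intro: fps_expansion_intros)

lemma q_fps_add: "q_fps f F \<Longrightarrow> q_fps g G \<Longrightarrow> q_fps (\<lambda>\<tau>. f \<tau> + g \<tau>) (F + G)"
  by (rule q_fps_binop) (auto intro: fps_expansion_intros)

lemma q_fps_diff: "q_fps f F \<Longrightarrow> q_fps g G \<Longrightarrow> q_fps (\<lambda>\<tau>. f \<tau> - g \<tau>) (F - G)"
  by (rule q_fps_binop) (auto intro: fps_expansion_intros)

lemma q_fps_mult: "q_fps f F \<Longrightarrow> q_fps g G \<Longrightarrow> q_fps (\<lambda>\<tau>. f \<tau> * g \<tau>) (F * G)"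
  by (rule q_fps_binop) (auto intro: fps_expansion_intros)

lemma q_fps_power: "q_fps f F \<Longrightarrow> q_fps (\<lambda>\<tau>. f \<tau> ^ n) (F ^ n)"
  by (induction n) (auto intro: q_fps_mult simp flip: fps_const_1_eq_1)

lemma q_fps_inverse: "q_fps f F \<Longrightarrow> fps_nth F 0 \<noteq> 0 \<Longrightarrow> q_fps (\<lambda>\<tau>. inverse (f \<tau>)) (inverse F)"
  by (rule q_fps_binop[where f = f and f' = f]) (auto intro: fps_expansion_intros)

lemma q_fps_sum:
  "(\<And>x. x \<in> A \<Longrightarrow> q_fps (f x) (F x)) \<Longrightarrow> q_fps (\<lambda>\<tau>. \<Sum>x\<in>A. f x \<tau>) (\<Sum>x\<in>A. F x)"
proof (induction A rule: infinite_finite_induct)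
  case (insert x A) then show ?case by (auto intro!: q_fps_add)
qed (use q_fps_const[of 0] in auto)

text \<open>The difference of two representing functions vanishes on a punctured disc and, by
  continuity, at 0. Through this, identities on the half-plane become identities of
  coefficients.\<close>

lemma q_fps_unique:
  assumes "q_fps f F" "q_fps f G"
  shows "F = G"
proof -
  have "q_fps (\<lambda>\<tau>. 0) (F - G)" using q_fps_diff[OF assms] by simp
  then obtain g where g: "g has_fps_expansion F - G" "eventually (\<lambda>\<tau>. 0 = g (qexp \<tau>)) at_ii"
    unfolding q_fps_def by blast
  have 1: "eventually (\<lambda>z. g z = 0) (at 0)"
    using eventually_qexp_imp_at_0[of "\<lambda>z. 0 = g z"] g(2) by (auto elim: eventually_mono)
  then have "(g \<longlongrightarrow> 0) (at 0)" by (rule tendsto_eventually)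
  moreover have "g \<midarrow>0\<rightarrow> g 0"
    using has_fps_expansion_imp_continuous[OF g(1), of UNIV] by (simp add: continuous_within)
  ultimately have "g 0 = 0" using LIM_unique by blast
  with 1 have "eventually (\<lambda>z. g z = 0) (nhds 0)" by (auto simp: eventually_nhds_conv_at)
  then have "g has_fps_expansion 0" by (simp add: has_fps_expansion_0_iff)
  then have "F - G = 0" using fps_expansion_unique_complex g(1) by blast
  then show ?thesis by simp
qed

lemma q_fps_tendsto:
  assumes "q_fps f F"
  shows "(f \<longlongrightarrow> fps_nth F 0) at_ii"
proof -
  obtain g where g: "g has_fps_expansion F" "eventually (\<lambda>\<tau>. f \<tau> = g (qexp \<tau>)) at_ii"
    using assms unfolding q_fps_def by blast
  have "g \<midarrow>0\<rightarrow> g 0"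
    using has_fps_expansion_imp_continuous[OF g(1), of UNIV] by (simp add: continuous_within)
  then have "((\<lambda>\<tau>. g (qexp \<tau>)) \<longlongrightarrow> g 0) at_ii" using filterlim_qexp by (rule filterlim_compose)
  then show ?thesis
    using g(2) has_fps_expansion_imp_0_eq_fps_nth_0[OF g(1)]
    by (subst tendsto_cong[where g = "\<lambda>\<tau>. g (qexp \<tau>)"]) auto
qed

lemma q_fps_compose_mult:
  assumes "q_fps f F" "n > 0"
  shows "q_fps (\<lambda>\<tau>. f (of_nat n * \<tau>)) (fps_compose F (fps_X ^ n))"
proof -
  obtain g where g: "g has_fps_expansion F" "eventually (\<lambda>\<tau>. f \<tau> = g (qexp \<tau>)) at_ii"
    using assms unfolding q_fps_def by blast
  have "filterlim (\<lambda>\<tau>. of_nat n * \<tau>) at_ii at_ii"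
    using filterlim_at_ii_affine[of "real n" 0] assms(2) by simp
  from eventually_compose_filterlim[OF g(2) this]
  have "eventually (\<lambda>\<tau>. f (of_nat n * \<tau>) = g (qexp \<tau> ^ n)) at_ii"
    by (simp add: qexp_mult_of_nat)
  moreover have "(g \<circ> (\<lambda>x. x ^ n)) has_fps_expansion (fps_compose F (fps_X ^ n))"
    by (rule has_fps_expansion_compose) (use g assms(2) in \<open>auto intro: fps_expansion_intros\<close>)
  ultimately show ?thesis unfolding q_fps_def by (intro exI[of _ "g \<circ> (\<lambda>x. x ^ n)"]) simp
qed

lemma q_fps_translate:
  assumes "q_fps f F"
  shows "q_fps (\<lambda>\<tau>. f (\<tau> + s)) (fps_compose F (fps_const (qexp s) * fps_X))"
proof -
  obtain g where g: "g has_fps_expansion F" "eventually (\<lambda>\<tau>. f \<tau> = g (qexp \<tau>)) at_ii"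
    using assms unfolding q_fps_def by blast
  have "filterlim (\<lambda>\<tau>. \<tau> + s) at_ii at_ii"
    using filterlim_at_ii_affine[of 1 s] by simp
  from eventually_compose_filterlim[OF g(2) this]
  have "eventually (\<lambda>\<tau>. f (\<tau> + s) = g (qexp s * qexp \<tau>)) at_ii"
    by (simp add: qexp_add mult.commute)
  moreover have "(g \<circ> (\<lambda>x. qexp s * x)) has_fps_expansion (fps_compose F (fps_const (qexp s) * fps_X))"
    by (rule has_fps_expansion_compose) (use g in \<open>auto intro: fps_expansion_intros\<close>)
  ultimately show ?thesis unfolding q_fps_def by (intro exI[of _ "g \<circ> (\<lambda>x. qexp s * x)"]) simp
qed

section \<open>From the expansions of the definitions to power series in q\<close>

lemma has_q_expansion_imp_q_fps:
  assumes "has_q_expansion 1 (-1) a f"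
  shows "q_fps (\<lambda>\<tau>. qexp \<tau> * f \<tau>) (Abs_fps (\<lambda>k. a (int k - 1)))"
proof -
  define F where "F = Abs_fps (\<lambda>k. a (int k - 1))"
  obtain Y where Y: "Y > 0" "\<And>\<tau>. Im \<tau> > Y \<Longrightarrow>
        ((\<lambda>n. a n * exp (2 * of_real pi * \<i> * of_int n * \<tau> / of_nat 1)) has_sum f \<tau>) {-1..}"
    using assms unfolding has_q_expansion_def by blast
  have sums: "(\<lambda>k. fps_nth F k * qexp \<tau> ^ k) sums (qexp \<tau> * f \<tau>)" if "Im \<tau> > Y" for \<tau>
  proof -
    have "bij_betw (\<lambda>k. int k - 1) UNIV {-1..}"
      by (rule bij_betwI[of _ _ _ "\<lambda>n. nat (n + 1)"]) auto
    from has_sum_reindex_bij_betw[OF this, of "\<lambda>n. a n * exp (2 * of_real pi * \<i> * of_int n * \<tau> / of_nat 1)" "f \<tau>"] Y(2)[OF that]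
    have "((\<lambda>k. a (int k - 1) * exp (2 * of_real pi * \<i> * of_int (int k - 1) * \<tau>)) has_sum f \<tau>) UNIV"
      by simp
    from has_sum_cmult_right[OF this, of "qexp \<tau>"]
    have "((\<lambda>k. fps_nth F k * qexp \<tau> ^ k) has_sum (qexp \<tau> * f \<tau>)) UNIV"
    proof (rule has_sum_cong[THEN iffD1, rotated])
      fix k :: nat
      have "qexp \<tau> * exp (2 * of_real pi * \<i> * of_int (int k - 1) * \<tau>) = qexp \<tau> ^ k"
        by (simp add: qexp_def exp_add[symmetric] exp_of_nat_mult[symmetric] algebra_simps)
      then show "qexp \<tau> * (a (int k - 1) * exp (2 * of_real pi * \<i> * of_int (int k - 1) * \<tau>)) = fps_nth F k * qexp \<tau> ^ k"
        unfolding F_def by (simp add: mult.left_commute)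
    qed
    then show ?thesis by (rule has_sum_imp_sums)
  qed
  \<comment> \<open>Convergence at the single point \<open>\<i> * (Y + 1)\<close>, where
    \<open>q\<close> is not 0, already gives a positive radius.\<close>
  have "summable (\<lambda>k. fps_nth F k * qexp (\<i> * of_real (Y + 1)) ^ k)"
    using sums[of "\<i> * of_real (Y + 1)"] by (auto simp: sums_iff)
  then have "fps_conv_radius F \<ge> norm (qexp (\<i> * of_real (Y + 1)))"
    unfolding fps_conv_radius_def by (rule conv_radius_geI)
  moreover have "ereal (norm (qexp (\<i> * of_real (Y + 1)))) > 0" by simp
  ultimately have "fps_conv_radius F > 0" by order
  then have "eval_fps F has_fps_expansion F" unfolding has_fps_expansion_def by simp
  moreover have "eventually (\<lambda>\<tau>. qexp \<tau> * f \<tau> = eval_fps F (qexp \<tau>)) at_ii"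
    unfolding eventually_at_ii eval_fps_def using sums by (auto simp: sums_iff intro!: exI[of _ Y])
  ultimately show ?thesis unfolding q_fps_def F_def[symmetric] by blast
qed

text \<open>Replacing \<tau> by \<open>N \<tau>\<close> turns powers of \<open>q ^ (1 / N)\<close>
  into powers of q. Division by \<open>qexp\<close> then shifts the expansion to the form of the
  preceding lemma.\<close>

lemma has_q_expansion_imp_q_fps_cusp:
  assumes "has_q_expansion N 0 a f" "N > 0"
  shows "q_fps (\<lambda>\<tau>. f (of_nat N * \<tau>)) (Abs_fps (\<lambda>k. a (int k)))"
proof -
  obtain Y where Y: "Y > 0" "\<And>\<tau>. Im \<tau> > Y \<Longrightarrow>
        ((\<lambda>n. a n * exp (2 * of_real pi * \<i> * of_int n * \<tau> / of_nat N)) has_sum f \<tau>) {0..}"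
    using assms unfolding has_q_expansion_def by blast
  \<comment> \<open>The unsimplified index \<open>int k - 1 + 1\<close> matches the shifted
    coefficients \<open>b\<close> below.\<close>
  have sums: "((\<lambda>k. a (int k - 1 + 1) * exp (2 * of_real pi * \<i> * of_int (int k) * \<tau> / of_nat N)) has_sum f \<tau>) UNIV" if "Im \<tau> > Y" for \<tau>
  proof -
    have "bij_betw int UNIV {0..}"
      by (rule bij_betwI[of _ _ _ nat]) auto
    from has_sum_reindex_bij_betw[OF this, of "\<lambda>n. a n * exp (2 * of_real pi * \<i> * of_int n * \<tau> / of_nat N)" "f \<tau>"] Y(2)[OF that]
    show ?thesis by simp
  qed
  define b where "b n = a (n + 1)" for n
  define f' where "f' \<tau> = f (of_nat N * \<tau>) / qexp \<tau>" for \<tau>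
  have "has_q_expansion 1 (-1) b f'"
    unfolding has_q_expansion_def
  proof (intro exI[of _ Y] conjI allI impI Y)
    fix \<tau> assume "Im \<tau> > Y"
    moreover have "real N * Im \<tau> \<ge> 1 * Im \<tau>" using assms(2) \<open>Im \<tau> > Y\<close> Y(1) by (intro mult_right_mono) auto
    ultimately have "Im (of_nat N * \<tau>) > Y" by simp
    from has_sum_cmult_right[OF sums[OF this], of "inverse (qexp \<tau>)"]
    have "((\<lambda>k. b (int k - 1) * exp (2 * of_real pi * \<i> * of_int (int k - 1) * \<tau> / of_nat 1)) has_sum f' \<tau>) UNIV"
      unfolding f'_def divide_inverse mult.commute[of "f _"]
    proof (rule has_sum_cong[THEN iffD1, rotated])
      fix k :: nat
      have "inverse (qexp \<tau>) * exp (2 * of_real pi * \<i> * of_int (int k) * (of_nat N * \<tau>) / of_nat N) = exp (2 * of_real pi * \<i> * of_int (int k - 1) * \<tau> / of_nat 1)"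
        using assms(2) by (simp add: qexp_def exp_minus[symmetric] exp_add[symmetric] algebra_simps)
      then show "inverse (qexp \<tau>) * (a (int k - 1 + 1) * exp (2 * of_real pi * \<i> * of_int (int k) * (of_nat N * \<tau>) * inverse (of_nat N)))
        = b (int k - 1) * exp (2 * of_real pi * \<i> * of_int (int k - 1) * \<tau> * inverse (of_nat 1))"
        unfolding b_def by (simp add: mult.left_commute divide_inverse)
    qed
    moreover have "bij_betw (\<lambda>k. int k - 1) UNIV {-1..}"
      by (rule bij_betwI[of _ _ _ "\<lambda>n. nat (n + 1)"]) auto
    ultimately show "((\<lambda>n. b n * exp (2 * of_real pi * \<i> * of_int n * \<tau> / of_nat 1)) has_sum f' \<tau>) {-1..}"
      using has_sum_reindex_bij_betw[OF \<open>bij_betw _ _ _\<close>, of "\<lambda>n. b n * exp (2 * of_real pi * \<i> * of_int n * \<tau> / of_nat 1)" "f' \<tau>"]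
      by simp
  qed
  from has_q_expansion_imp_q_fps[OF this] show ?thesis by (simp add: f'_def b_def)
qed

section \<open>The modular group\<close>

definition mat2 :: "int \<Rightarrow> int \<Rightarrow> int \<Rightarrow> int \<Rightarrow> int^2^2" where
  "mat2 a b c d = vector [vector [a, b], vector [c, d]]"

lemma mat2_nth [simp]:
  "mat2 a b c d $ 1 $ 1 = a" "mat2 a b c d $ 1 $ 2 = b"
  "mat2 a b c d $ 2 $ 1 = c" "mat2 a b c d $ 2 $ 2 = d"
  by (simp_all add: mat2_def)

lemma mat2_eta: "A = mat2 (A $ 1 $ 1) (A $ 1 $ 2) (A $ 2 $ 1) (A $ 2 $ 2)"
  by (simp add: vec_eq_iff forall_2)

lemma mat2_in_SL2Z: "mat2 a b c d \<in> SL2Z \<longleftrightarrow> a * d - b * c = 1"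
  by (simp add: SL2Z_def det_2)

lemma mat2_in_Gamma0: "mat2 a b c d \<in> Gamma0 N \<longleftrightarrow> a * d - b * c = 1 \<and> int N dvd c"
  by (simp add: Gamma0_def mat2_in_SL2Z)

lemma Gamma0_subset: "Gamma0 N \<subseteq> SL2Z" by (auto simp: Gamma0_def)

lemma SL2Z_cases:
  assumes "A \<in> SL2Z"
  obtains a b c d where "A = mat2 a b c d" "a * d - b * c = 1"
  using assms mat2_eta[of A] mat2_in_SL2Z by metis

lemma Gamma0_cases:
  assumes "A \<in> Gamma0 N"
  obtains a b c d where "A = mat2 a b c d" "a * d - b * c = 1" "int N dvd c"
  using assms mat2_eta[of A] mat2_in_Gamma0 by metis

lemma mat2_mult: "mat2 a b c d ** mat2 a' b' c' d' =
  mat2 (a * a' + b * c') (a * b' + b * d') (c * a' + d * c') (c * b' + d * d')"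
  by (simp add: vec_eq_iff forall_2 matrix_matrix_mult_def sum_2)

lemma moebius_mat2: "moebius (mat2 a b c d) \<tau> = (of_int a * \<tau> + of_int b) / (of_int c * \<tau> + of_int d)"
  by (simp add: moebius_def)

lemma in_upper_half_plane [simp]: "\<tau> \<in> upper_half_plane \<longleftrightarrow> Im \<tau> > 0"
  by (simp add: upper_half_plane_def)

lemma open_upper_half_plane [simp, intro]: "open upper_half_plane"
  unfolding upper_half_plane_def by (simp add: open_halfspace_Im_gt)

lemma convex_upper_half_plane: "convex upper_half_plane"
  unfolding upper_half_plane_def by (simp add: convex_halfspace_Im_gt)

lemma connected_upper_half_plane [simp, intro]: "connected upper_half_plane"
  by (intro convex_connected convex_upper_half_plane)

lemma SL2Z_mult: "A \<in> SL2Z \<Longrightarrow> B \<in> SL2Z \<Longrightarrow> A ** B \<in> SL2Z"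
  by (simp add: SL2Z_def det_mul)

lemma denom_nonzero:
  assumes "Im \<tau> > 0" "(c, d) \<noteq> (0 :: int, 0 :: int)"
  shows "of_int c * \<tau> + of_int d \<noteq> 0"
proof
  assume *: "of_int c * \<tau> + of_int d = 0"
  then have "Im (of_int c * \<tau> + of_int d) = 0" by simp
  then have "c = 0" using assms(1) by simp
  with * assms(2) show False by simp
qed

lemma Im_moebius_gen:
  fixes a b c d :: int
  assumes "Im \<tau> > 0" "(c, d) \<noteq> (0, 0)"
  shows "Im ((of_int a * \<tau> + of_int b) / (of_int c * \<tau> + of_int d)) =
    of_int (a * d - b * c) * Im \<tau> / (norm (of_int c * \<tau> + of_int d))\<^sup>2"
  by (simp add: Im_divide cmod_power2 algebra_simps)

lemma Im_moebius:
  assumes "a * d - b * c = 1" "Im \<tau> > 0"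
  shows "Im (moebius (mat2 a b c d) \<tau>) = Im \<tau> / (norm (of_int c * \<tau> + of_int d))\<^sup>2"
  unfolding moebius_mat2 by (subst Im_moebius_gen) (use assms in auto)

lemma Im_moebius_pos: "A \<in> SL2Z \<Longrightarrow> Im \<tau> > 0 \<Longrightarrow> Im (moebius A \<tau>) > 0"
proof (elim SL2Z_cases, simp add: Im_moebius)
  fix a b c d :: int assume *: "Im \<tau> > 0" "a * d - b * c = 1"
  then have "of_int c * \<tau> + of_int d \<noteq> 0" by (intro denom_nonzero) auto
  then show "0 < Im \<tau> / (norm (of_int c * \<tau> + of_int d))\<^sup>2" using * by simp
qed

lemma moebius_mult:
  assumes "A \<in> SL2Z" "B \<in> SL2Z" "Im \<tau> > 0"
  shows "moebius (A ** B) \<tau> = moebius A (moebius B \<tau>)"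
proof -
  obtain a b c d where A: "A = mat2 a b c d" "a * d - b * c = 1" using assms(1) by (rule SL2Z_cases)
  obtain a' b' c' d' where B: "B = mat2 a' b' c' d'" "a' * d' - b' * c' = 1" using assms(2) by (rule SL2Z_cases)
  have 1: "of_int c' * \<tau> + of_int d' \<noteq> 0" using B assms(3) by (intro denom_nonzero) auto
  have "Im (moebius B \<tau>) > 0" using assms Im_moebius_pos by blast
  then have 2: "of_int c * moebius B \<tau> + of_int d \<noteq> 0" using A by (intro denom_nonzero) auto
  have 3: "of_int c * moebius B \<tau> + of_int d = (of_int (c * a' + d * c') * \<tau> + of_int (c * b' + d * d')) / (of_int c' * \<tau> + of_int d')"
    using 1 unfolding B moebius_mat2 by (simp add: field_simps)
  have 4: "of_int a * moebius B \<tau> + of_int b = (of_int (a * a' + b * c') * \<tau> + of_int (a * b' + b * d')) / (of_int c' * \<tau> + of_int d')"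
    using 1 unfolding B moebius_mat2 by (simp add: field_simps)
  have "moebius A (moebius B \<tau>) = (of_int a * moebius B \<tau> + of_int b) / (of_int c * moebius B \<tau> + of_int d)"
    unfolding A moebius_mat2 ..
  also have "\<dots> = moebius (A ** B) \<tau>" unfolding 3 4 unfolding A B mat2_mult moebius_mat2 using 1 by simp
  finally show ?thesis ..
qed

lemma holomorphic_on_moebius:
  assumes "A \<in> SL2Z"
  shows "moebius A holomorphic_on upper_half_plane"
proof -
  obtain a b c d where A: "A = mat2 a b c d" "a * d - b * c = 1" using assms(1) by (rule SL2Z_cases)
  have "moebius A = (\<lambda>\<tau>. (of_int a * \<tau> + of_int b) / (of_int c * \<tau> + of_int d))"
    by (simp add: A moebius_mat2 fun_eq_iff)
  moreover have "of_int c * \<tau> + of_int d \<noteq> 0" if "Im \<tau> > 0" for \<tau>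
    using that A by (intro denom_nonzero) auto
  ultimately show ?thesis by (auto intro!: holomorphic_intros)
qed

definition Smat :: "int^2^2" where "Smat = mat2 0 (-1) 1 0"
definition Tmat :: "int \<Rightarrow> int^2^2" where "Tmat k = mat2 1 k 0 1"

lemma Smat_in_SL2Z [simp]: "Smat \<in> SL2Z" by (simp add: Smat_def mat2_in_SL2Z)
lemma Tmat_in_Gamma0 [simp]: "Tmat k \<in> Gamma0 N" by (simp add: Tmat_def mat2_in_Gamma0)
lemma moebius_Smat: "moebius Smat \<tau> = - 1 / \<tau>" by (simp add: Smat_def moebius_mat2)
lemma moebius_Tmat: "moebius (Tmat k) \<tau> = \<tau> + of_int k" by (simp add: Tmat_def moebius_mat2)

definition adj2 :: "int^2^2 \<Rightarrow> int^2^2" where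
  "adj2 A = mat2 (A $ 2 $ 2) (- A $ 1 $ 2) (- A $ 2 $ 1) (A $ 1 $ 1)"

lemma adj2_mat2: "adj2 (mat2 a b c d) = mat2 d (- b) (- c) a" by (simp add: adj2_def)

lemma adj2_in_SL2Z: "A \<in> SL2Z \<Longrightarrow> adj2 A \<in> SL2Z"
  by (elim SL2Z_cases) (simp add: adj2_mat2 mat2_in_SL2Z algebra_simps)

lemma moebius_one: "moebius (mat2 1 0 0 1) \<tau> = \<tau>" by (simp add: moebius_mat2)

lemma moebius_adj2:
  assumes "A \<in> SL2Z" "Im \<tau> > 0"
  shows "moebius A (moebius (adj2 A) \<tau>) = \<tau>" "moebius (adj2 A) (moebius A \<tau>) = \<tau>"
proof -
  obtain a b c d where A: "A = mat2 a b c d" "a * d - b * c = 1" using assms(1) by (rule SL2Z_cases)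
  have "A ** adj2 A = mat2 1 0 0 1" "adj2 A ** A = mat2 1 0 0 1"
    using A(2) unfolding A(1) adj2_mat2 mat2_mult by (simp_all add: algebra_simps)
  then show "moebius A (moebius (adj2 A) \<tau>) = \<tau>" "moebius (adj2 A) (moebius A \<tau>) = \<tau>"
    using moebius_mult[OF assms(1) adj2_in_SL2Z[OF assms(1)] assms(2)]
      moebius_mult[OF adj2_in_SL2Z[OF assms(1)] assms(1,2)] by (simp_all add: moebius_one)
qed

section \<open>Bounded invariant functions vanish\<close>

lemma finite_bounded_lattice:
  assumes "Im \<tau> > 0"
  shows "finite {(c :: int, d :: int). norm (of_int c * \<tau> + of_int d) \<le> 1}"
proof (rule finite_subset)
  define C where "C = \<lceil>1 / Im \<tau>\<rceil>"
  define D where "D = \<lceil>1 + \<bar>of_int C\<bar> * \<bar>Re \<tau>\<bar>\<rceil>"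
  show "{(c :: int, d :: int). norm (of_int c * \<tau> + of_int d) \<le> 1} \<subseteq> {-C..C} \<times> {-D..D}"
  proof (rule subrelI)
    fix c d :: int assume "(c, d) \<in> {(c :: int, d :: int). norm (of_int c * \<tau> + of_int d) \<le> 1}"
    then have *: "norm (of_int c * \<tau> + of_int d) \<le> 1" by simp
    have "\<bar>Im (of_int c * \<tau> + of_int d)\<bar> \<le> 1" using * abs_Im_le_cmod order_trans by blast
    then have "\<bar>real_of_int c\<bar> \<le> 1 / Im \<tau>" using assms by (simp add: abs_mult field_simps)
    then have c: "\<bar>c\<bar> \<le> C" unfolding C_def by linarith
    have "\<bar>Re (of_int c * \<tau> + of_int d)\<bar> \<le> 1" using * abs_Re_le_cmod order_trans by blast
    then have "\<bar>real_of_int d\<bar> \<le> 1 + \<bar>real_of_int c\<bar> * \<bar>Re \<tau>\<bar>" by (simp flip: abs_mult)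
    also have "\<dots> \<le> 1 + \<bar>of_int C\<bar> * \<bar>Re \<tau>\<bar>" using c by (intro add_left_mono mult_right_mono) auto
    finally have "\<bar>d\<bar> \<le> D" unfolding D_def by linarith
    with c show "(c, d) \<in> {-C..C} \<times> {-D..D}" by auto
  qed
qed auto

text \<open>Among the primitive rows \<open>(c, d)\<close> with
  \<open>norm (c \<tau> + d) \<le> 1\<close> a shortest one is chosen, which maximises the imaginary
  part; \<open>round\<close> then moves the real part into the strip. Minimality forces norm at
  least 1, hence the bound on \<open>Im\<close>.\<close>

lemma SL2Z_reduction:
  assumes "Im \<tau> > 0"
  obtains A where "A \<in> SL2Z" "\<bar>Re (moebius A \<tau>)\<bar> \<le> 1 / 2" "Im (moebius A \<tau>) \<ge> 1 / 2"
proof -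
  define L where "L = {(c :: int, d :: int). norm (of_int c * \<tau> + of_int d) \<le> 1 \<and> (\<exists>a b. a * d - b * c = 1)}"
  have "finite L" by (rule finite_subset[OF _ finite_bounded_lattice[OF assms]]) (auto simp: L_def)
  moreover have "(0, 1) \<in> L" by (auto simp: L_def)
  ultimately have "\<exists>p\<in>L. \<forall>p'\<in>L. norm (of_int (fst p) * \<tau> + of_int (snd p)) \<le> norm (of_int (fst p') * \<tau> + of_int (snd p'))"
    using ex_min_if_finite[of "(\<lambda>p. norm (of_int (fst p) * \<tau> + of_int (snd p))) ` L"]
    by (auto simp: not_less)
  then obtain p where p: "p \<in> L"
    "\<And>p'. p' \<in> L \<Longrightarrow> norm (of_int (fst p) * \<tau> + of_int (snd p)) \<le> norm (of_int (fst p') * \<tau> + of_int (snd p'))"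
    by blast
  obtain c d where cd: "p = (c, d)" by fastforce
  obtain a b where ab: "a * d - b * c = 1" using p(1) unfolding cd L_def by blast
  define k where "k = round (Re (moebius (mat2 a b c d) \<tau>))"
  define B where "B = mat2 (a - k * c) (b - k * d) c d"
  have B: "B \<in> SL2Z" unfolding B_def mat2_in_SL2Z using ab by (simp add: algebra_simps)
  have nz: "of_int c * \<tau> + of_int d \<noteq> 0" using ab assms by (intro denom_nonzero) auto
  have B': "moebius B \<tau> = moebius (mat2 a b c d) \<tau> - of_int k"
    unfolding B_def moebius_mat2 using nz by (simp add: field_simps)
  have Re: "\<bar>Re (moebius B \<tau>)\<bar> \<le> 1 / 2"
    unfolding B' k_def using of_int_round_abs_le[of "Re (moebius (mat2 a b c d) \<tau>)"] by (simp add: abs_minus_commute)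
  have "norm (moebius B \<tau>) \<ge> 1"
  proof (rule ccontr)
    assume "\<not> ?thesis"
    then have less: "norm (moebius B \<tau>) < 1" by simp
    \<comment> \<open>\<open>(c', d')\<close> is the upper row of \<open>B\<close>, that is, the
      lower row of \<open>Smat ** B\<close>; if \<open>moebius B \<tau>\<close> had norm below 1,
      this row would be shorter than \<open>(c, d)\<close>.\<close>
    define c' d' where "c' = a - k * c" and "d' = b - k * d"
    have eq: "moebius B \<tau> = (of_int c' * \<tau> + of_int d') / (of_int c * \<tau> + of_int d)"
      unfolding B_def c'_def d'_def moebius_mat2 ..
    have lt: "norm (of_int c' * \<tau> + of_int d') < norm (of_int c * \<tau> + of_int d)"
      using less nz unfolding eq by (simp add: norm_divide divide_simps)
    also have "\<dots> \<le> 1" using p(1) unfolding cd L_def by simp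
    finally have "norm (of_int c' * \<tau> + of_int d') < 1" .
    moreover have "(- c) * d' - (- d) * c' = 1"
      using B unfolding B_def c'_def[symmetric] d'_def[symmetric] mat2_in_SL2Z by (simp add: algebra_simps)
    ultimately have "(c', d') \<in> L" unfolding L_def by fastforce
    from p(2)[OF this] lt show False unfolding cd by simp
  qed
  then have "(norm (moebius B \<tau>))\<^sup>2 \<ge> 1" by simp
  moreover have "(Re (moebius B \<tau>))\<^sup>2 \<le> (1/2)\<^sup>2" using Re abs_le_square_iff[of "Re (moebius B \<tau>)" "1/2"] by simp
  ultimately have "(Im (moebius B \<tau>))\<^sup>2 \<ge> (1/2)\<^sup>2" using cmod_power2[of "moebius B \<tau>"] by (simp add: power_divide)
  moreover have "Im (moebius B \<tau>) > 0" using B assms Im_moebius_pos by blast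
  ultimately have "Im (moebius B \<tau>) \<ge> 1 / 2" using abs_le_square_iff[of "1/2" "Im (moebius B \<tau>)"] by simp
  with B Re that show ?thesis by blast
qed

text \<open>A factor that is nonzero somewhere is nonzero on an open set, where the remaining
  product vanishes; the identity theorem spreads this over \<open>S\<close>.\<close>

lemma holomorphic_prod_eq_0:
  assumes "finite F" "\<And>g. g \<in> F \<Longrightarrow> g holomorphic_on S" "open S" "connected S" "S \<noteq> {}"
    and "\<And>z. z \<in> S \<Longrightarrow> (\<Prod>g\<in>F. g z) = 0"
  shows "\<exists>g\<in>F. \<forall>z\<in>S. g z = 0"
  using assms(1,2,6)
proof (induction F)
  case empty then show ?case using assms(5) by auto
next
  case (insert g F)
  show ?case
  proof (cases "\<forall>z\<in>S. g z = 0")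
    case False
    then obtain z0 where z0: "z0 \<in> S" "g z0 \<noteq> 0" by blast
    have "g holomorphic_on S" using insert by auto
    then have "continuous_on S g" by (rule holomorphic_on_imp_continuous_on)
    from continuous_open_preimage[OF this assms(3), of "- {0}"]
    have op: "open {z \<in> S. g z \<noteq> 0}"
      by (simp add: vimage_def Int_def open_Compl)
    have "(\<Prod>g\<in>F. g z) = 0" if "z \<in> S" for z
    proof (rule analytic_continuation_open[of "{z \<in> S. g z \<noteq> 0}" S "\<lambda>z. \<Prod>g\<in>F. g z" "\<lambda>_. 0"])
      show "(\<lambda>z. \<Prod>g\<in>F. g z) holomorphic_on S" using insert by (intro holomorphic_intros) auto
      show "(\<Prod>g\<in>F. g z) = 0" if "z \<in> {z \<in> S. g z \<noteq> 0}" for z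
        using insert.prems(2)[of z] insert.hyps that by auto
    qed (use op assms z0 that in auto)
    then show ?thesis using insert by auto
  qed auto
qed

definition bdd_ii :: "(complex \<Rightarrow> complex) \<Rightarrow> bool" where
  "bdd_ii f \<longleftrightarrow> (\<exists>B. eventually (\<lambda>\<tau>. norm (f \<tau>) \<le> B) at_ii)"

lemma bdd_ii_tendsto:
  assumes "(f \<longlongrightarrow> l) at_ii"
  shows "bdd_ii f"
proof -
  have "eventually (\<lambda>\<tau>. dist (f \<tau>) l < 1) at_ii" using assms by (simp add: tendsto_iff)
  then have "eventually (\<lambda>\<tau>. norm (f \<tau>) \<le> 1 + norm l) at_ii"
    by eventually_elim (metis add.commute dist_norm less_eq_real_def norm_triangle_sub add_mono order_refl order_trans)
  then show ?thesis unfolding bdd_ii_def by blast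
qed

text \<open>The lower left entry of the product is \<open>c * d' - d * c'\<close>, which vanishes
  modulo \<open>N\<close>. This makes the family of functions \<open>f \<circ> A\<close>
  finite.\<close>

lemma Gamma0_coset:
  assumes "A \<in> SL2Z" "B \<in> SL2Z" "[A $ 2 $ 1 = B $ 2 $ 1] (mod int N)" "[A $ 2 $ 2 = B $ 2 $ 2] (mod int N)"
  shows "A ** adj2 B \<in> Gamma0 N"
proof -
  obtain a b c d where A: "A = mat2 a b c d" "a * d - b * c = 1" using assms(1) by (rule SL2Z_cases)
  obtain a' b' c' d' where B: "B = mat2 a' b' c' d'" "a' * d' - b' * c' = 1" using assms(2) by (rule SL2Z_cases)
  have "A ** adj2 B \<in> SL2Z" using assms by (intro SL2Z_mult adj2_in_SL2Z)
  moreover have "[c * d' - d * c' = c' * d' - d' * c'] (mod int N)"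
    using assms(3,4) unfolding A B by (intro cong_diff cong_mult) auto
  then have "int N dvd (A ** adj2 B) $ 2 $ 1"
    unfolding A B adj2_mat2 mat2_mult by (simp add: cong_0_iff mult.commute)
  ultimately show ?thesis by (simp add: Gamma0_def)
qed

text \<open>The product of the finitely many functions \<open>f \<circ> A\<close> with \<open>A\<close> in \<^const>\<open>SL2Z\<close> tends to zero at \<open>\<infinity>\<close>, so
  it attains its maximum if it is not zero.\<close>

theorem Gamma0_liouville:
  assumes N: "N > 0" and hol: "f holomorphic_on upper_half_plane"
    and inv: "\<And>A \<tau>. A \<in> Gamma0 N \<Longrightarrow> Im \<tau> > 0 \<Longrightarrow> f (moebius A \<tau>) = f \<tau>"
    and bdd: "\<And>A. A \<in> SL2Z \<Longrightarrow> A \<notin> Gamma0 N \<Longrightarrow> bdd_ii (\<lambda>\<tau>. f (moebius A \<tau>))"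
    and lim: "(f \<longlongrightarrow> 0) at_ii"
    and \<tau>: "Im \<tau> > 0"
  shows "f \<tau> = 0"
proof -
  \<comment> \<open>The value 0 outside the half-plane makes equality of functions mean equality on
    it, so that \<open>F\<close> is a finite set in which coinciding translates count once.\<close>
  define fA where "fA A \<tau> = (if Im \<tau> > 0 then f (moebius A \<tau>) else 0)" for A \<tau>
  define F where "F = fA ` SL2Z"
  have fA_coset: "fA A = fA B" if "A \<in> SL2Z" "B \<in> SL2Z" "A ** adj2 B \<in> Gamma0 N" for A B
  proof
    fix \<tau>
    show "fA A \<tau> = fA B \<tau>"
    proof (cases "Im \<tau> > 0")
      case True
      have "f (moebius A \<tau>) = f (moebius A (moebius (adj2 B) (moebius B \<tau>)))"
        using moebius_adj2[OF that(2) True] by simp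
      also have "\<dots> = f (moebius (A ** adj2 B) (moebius B \<tau>))"
        using that True Im_moebius_pos adj2_in_SL2Z by (subst moebius_mult) auto
      also have "\<dots> = f (moebius B \<tau>)" using that True Im_moebius_pos by (intro inv) auto
      finally show ?thesis by (simp add: fA_def)
    qed (simp add: fA_def)
  qed
  have "finite F"
  proof (rule finite_subset)
    define r where "r p = fA (SOME A. A \<in> SL2Z \<and> A $ 2 $ 1 mod int N = fst p \<and> A $ 2 $ 2 mod int N = snd p)" for p
    show "F \<subseteq> r ` ({0..<int N} \<times> {0..<int N})"
    proof
      fix g assume "g \<in> F"
      then obtain A where A: "A \<in> SL2Z" "g = fA A" unfolding F_def by blast
      define p where "p = (A $ 2 $ 1 mod int N, A $ 2 $ 2 mod int N)"
      define B where "B = (SOME A. A \<in> SL2Z \<and> A $ 2 $ 1 mod int N = fst p \<and> A $ 2 $ 2 mod int N = snd p)"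
      have "B \<in> SL2Z \<and> B $ 2 $ 1 mod int N = fst p \<and> B $ 2 $ 2 mod int N = snd p"
        unfolding B_def by (rule someI[of _ A]) (use A in \<open>auto simp: p_def\<close>)
      then have "g = fA B" using A
        by (auto intro!: fA_coset Gamma0_coset simp: p_def cong_def)
      then have "g = r p" unfolding r_def B_def .
      moreover have "p \<in> {0..<int N} \<times> {0..<int N}" using N by (auto simp: p_def)
      ultimately show "g \<in> r ` ({0..<int N} \<times> {0..<int N})" by blast
    qed
  qed auto
  have F_hol: "g holomorphic_on upper_half_plane" if gF: "g \<in> F" for g
  proof -
    obtain A where A: "A \<in> SL2Z" "g = fA A" using gF unfolding F_def by blast
    have "(f \<circ> moebius A) holomorphic_on upper_half_plane"
      using A Im_moebius_pos by (intro holomorphic_on_compose_gen[OF holomorphic_on_moebius hol]) auto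
    then show ?thesis by (rule holomorphic_transform) (auto simp: A fA_def)
  qed
  define P where "P \<tau> = (\<Prod>g\<in>F. g \<tau>)" for \<tau>
  have P_hol: "P holomorphic_on upper_half_plane"
    unfolding P_def using F_hol by (intro holomorphic_intros) auto
  \<comment> \<open>Composition with \<open>B\<close> permutes the finite set
    \<open>F\<close>.\<close>
  have P_inv: "P (moebius B \<tau>) = P \<tau>" if B: "B \<in> SL2Z" "Im \<tau> > 0" for B \<tau>
  proof -
    define h where "h g \<tau> = (if Im \<tau> > 0 then g (moebius B \<tau>) else 0)" for g :: "complex \<Rightarrow> complex" and \<tau>
    have hfA: "h (fA A) = fA (A ** B)" if "A \<in> SL2Z" for A
      using that B Im_moebius_pos by (auto simp: h_def fA_def moebius_mult fun_eq_iff)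
    have sub: "h ` F \<subseteq> F" unfolding F_def using hfA B SL2Z_mult by auto
    have inj: "inj_on h F"
    proof (rule inj_onI)
      fix g g' assume g: "g \<in> F" "g' \<in> F" "h g = h g'"
      show "g = g'"
      proof
        fix \<tau>
        show "g \<tau> = g' \<tau>"
        proof (cases "Im \<tau> > 0")
          case True
          have "h g (moebius (adj2 B) \<tau>) = h g' (moebius (adj2 B) \<tau>)" using g by simp
          then show ?thesis
            using True B Im_moebius_pos[OF adj2_in_SL2Z[OF B(1)] True] moebius_adj2[OF B(1) True] by (simp add: h_def)
        qed (use g in \<open>auto simp: F_def fA_def\<close>)
      qed
    qed
    have img: "h ` F = F" using sub inj \<open>finite F\<close> by (rule endo_inj_surj[rotated])
    have "P \<tau> = (\<Prod>g\<in>h ` F. g \<tau>)" unfolding P_def img ..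
    also have "\<dots> = (\<Prod>g\<in>F. h g \<tau>)" using inj by (simp add: prod.reindex)
    also have "\<dots> = P (moebius B \<tau>)" unfolding P_def h_def using B by simp
    finally show ?thesis ..
  qed
  define f0 where "f0 = fA (mat2 1 0 0 1)"
  have f0: "f0 \<in> F" unfolding f0_def F_def by (auto simp: mat2_in_SL2Z)
  have ev_f0: "eventually (\<lambda>\<tau>. f0 \<tau> = f \<tau>) at_ii"
    unfolding f0_def fA_def moebius_one eventually_at_ii by auto
  have F_bdd: "bdd_ii g" if gF: "g \<in> F" for g
  proof -
    obtain A where A: "A \<in> SL2Z" "g = fA A" using gF unfolding F_def by blast
    have "bdd_ii (\<lambda>\<tau>. f (moebius A \<tau>))"
    proof (cases "A \<in> Gamma0 N")
      case True
      have "eventually (\<lambda>\<tau>. f (moebius A \<tau>) = f \<tau>) at_ii"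
        using eventually_at_ii_Im_gt[of 0] by eventually_elim (use True inv in auto)
      then show ?thesis using lim by (intro bdd_ii_tendsto[of _ 0]) (subst tendsto_cong)
    qed (use bdd A in auto)
    then obtain K where "eventually (\<lambda>\<tau>. norm (f (moebius A \<tau>)) \<le> K) at_ii" unfolding bdd_ii_def by blast
    then have "eventually (\<lambda>\<tau>. norm (g \<tau>) \<le> K) at_ii" using eventually_at_ii_Im_gt[of 0]
      by eventually_elim (auto simp: A fA_def)
    then show ?thesis unfolding bdd_ii_def by blast
  qed
  \<comment> \<open>One factor is \<open>f\<close> itself, which tends to 0; all others are
    bounded.\<close>
  have P_lim: "(P \<longlongrightarrow> 0) at_ii"
  proof -
    obtain K where K: "\<And>g. g \<in> F \<Longrightarrow> eventually (\<lambda>\<tau>. norm (g \<tau>) \<le> K g) at_ii"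
      using F_bdd unfolding bdd_ii_def by metis
    have ev: "eventually (\<lambda>\<tau>. \<forall>g\<in>F. norm (g \<tau>) \<le> K g) at_ii"
      using K \<open>finite F\<close> by (simp add: eventually_ball_finite)
    have "((\<lambda>\<tau>. norm (f \<tau>) * (\<Prod>g\<in>F - {f0}. K g)) \<longlongrightarrow> 0) at_ii"
      using lim by (intro tendsto_mult_left_zero tendsto_norm_zero)
    moreover have "eventually (\<lambda>\<tau>. norm (P \<tau>) \<le> norm (f \<tau>) * (\<Prod>g\<in>F - {f0}. K g)) at_ii"
      using ev ev_f0
    proof eventually_elim
      case (elim \<tau>)
      have "norm (P \<tau>) = norm (f0 \<tau>) * (\<Prod>g\<in>F - {f0}. norm (g \<tau>))"
        unfolding P_def using f0 \<open>finite F\<close> by (subst prod.remove) (auto simp: norm_mult prod_norm)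
      also have "\<dots> \<le> norm (f0 \<tau>) * (\<Prod>g\<in>F - {f0}. K g)"
        using elim by (intro mult_left_mono prod_mono) auto
      finally show ?case using elim by simp
    qed
    ultimately show ?thesis by (rule Lim_null_comparison[rotated])
  qed
  have P0: "P \<tau>0 = 0" if Im0: "Im \<tau>0 > 0" for \<tau>0
  proof (rule ccontr)
    assume nz: "P \<tau>0 \<noteq> 0"
    then have "eventually (\<lambda>\<tau>. dist (P \<tau>) 0 < norm (P \<tau>0)) at_ii"
      using P_lim unfolding tendsto_iff by simp
    then obtain Y where Y: "\<And>\<tau>. Im \<tau> > Y \<Longrightarrow> norm (P \<tau>) < norm (P \<tau>0)"
      unfolding eventually_at_ii by auto
    \<comment> \<open>Every value of modulus at least \<open>norm (P \<tau>0)\<close> is attained in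
      this box: reduction gives the strip and the lower bound, the choice of \<open>Y\<close> the
      upper one. The maximum on the box is therefore global.\<close>
    define C where "C = cbox (Complex (-1/2) (1/2)) (Complex (1/2) Y)"
    have C: "\<tau> \<in> C \<longleftrightarrow> \<bar>Re \<tau>\<bar> \<le> 1/2 \<and> 1/2 \<le> Im \<tau> \<and> Im \<tau> \<le> Y" for \<tau>
      unfolding C_def by (auto simp: in_cbox_complex_iff)
    have red: "\<exists>\<tau>'\<in>C. P \<tau>' = P \<tau>" if "Im \<tau> > 0" "norm (P \<tau>) \<ge> norm (P \<tau>0)" for \<tau>
    proof -
      obtain A where A: "A \<in> SL2Z" "\<bar>Re (moebius A \<tau>)\<bar> \<le> 1 / 2" "Im (moebius A \<tau>) \<ge> 1 / 2"
        using \<open>Im \<tau> > 0\<close> by (rule SL2Z_reduction)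
      have "P (moebius A \<tau>) = P \<tau>" using P_inv A that by blast
      moreover from this have "Im (moebius A \<tau>) \<le> Y"
        using Y[of "moebius A \<tau>"] that by (intro leI notI) auto
      ultimately show ?thesis using A by (intro bexI[of _ "moebius A \<tau>"]) (auto simp: C)
    qed
    obtain \<tau>1 where \<tau>1: "\<tau>1 \<in> C" "P \<tau>1 = P \<tau>0" using red[of \<tau>0] Im0 by auto
    have "continuous_on C (\<lambda>\<tau>. norm (P \<tau>))"
      by (intro continuous_intros holomorphic_on_imp_continuous_on holomorphic_on_subset[OF P_hol]) (auto simp: C)
    moreover have "compact C" unfolding C_def by simp
    ultimately obtain \<tau>m where \<tau>m: "\<tau>m \<in> C" "\<And>\<tau>. \<tau> \<in> C \<Longrightarrow> norm (P \<tau>) \<le> norm (P \<tau>m)"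
      using continuous_attains_sup[of C "\<lambda>\<tau>. norm (P \<tau>)"] \<tau>1 by blast
    have max: "norm (P \<tau>) \<le> norm (P \<tau>m)" if "Im \<tau> > 0" for \<tau>
    proof (cases "norm (P \<tau>) \<ge> norm (P \<tau>0)")
      case True
      then show ?thesis using red[OF that] \<tau>m by metis
    next
      case False
      then show ?thesis using \<tau>m(2)[OF \<tau>1(1)] \<tau>1 by simp
    qed
    have "Im \<tau>m > 0" using \<tau>m(1) by (simp add: C)
    then have "P constant_on upper_half_plane"
      using max P_hol by (intro maximum_modulus_principle[where U = upper_half_plane and \<xi> = \<tau>m]) auto
    then obtain c where c: "\<And>\<tau>. Im \<tau> > 0 \<Longrightarrow> P \<tau> = c" unfolding constant_on_def by auto
    have "eventually (\<lambda>\<tau>. P \<tau> = c) at_ii" using eventually_at_ii_Im_gt[of 0] by eventually_elim (rule c)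
    then have "(P \<longlongrightarrow> c) at_ii" by (rule tendsto_eventually)
    then have "c = 0" using P_lim tendsto_unique[OF at_ii_neq_bot] by blast
    then show False using nz c that by simp
  qed
  have "\<exists>g\<in>F. \<forall>z\<in>upper_half_plane. g z = 0"
    using \<open>finite F\<close> F_hol P0 \<tau> unfolding P_def by (intro holomorphic_prod_eq_0) auto
  then obtain A where A: "A \<in> SL2Z" "\<And>z. Im z > 0 \<Longrightarrow> fA A z = 0" unfolding F_def by auto
  have "fA A (moebius (adj2 A) \<tau>) = 0" using A Im_moebius_pos adj2_in_SL2Z \<tau> by blast
  then show ?thesis using A \<tau> Im_moebius_pos[OF adj2_in_SL2Z[OF A(1)] \<tau>] by (simp add: fA_def moebius_adj2)
qed

section \<open>The transformation of the weight two Lambert series\<close>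

lemma Digamma_reflection:
  assumes "z \<notin> \<int>"
  shows "Digamma z - Digamma (1 - z) = - of_real pi * cos (of_real pi * z) / sin (of_real pi * (z :: complex))"
proof -
  have z: "z \<notin> \<int>\<^sub>\<le>\<^sub>0" "1 - z \<notin> \<int>\<^sub>\<le>\<^sub>0"
    using assms nonpos_Ints_Int[of z] nonpos_Ints_Int[of "1 - z"] Ints_diff[of 1 "1 - z"] by auto
  have sin_nz: "sin (of_real pi * w) \<noteq> 0" if "w \<notin> \<int>" for w :: complex
    using that by (auto simp: sin_eq_0 mult.commute)
  have "open (- \<int> :: complex set)" by (simp add: open_Compl closed_Ints)
  have "((\<lambda>z. Gamma z * Gamma (1 - z)) has_field_derivative
      Gamma z * Gamma (1 - z) * (Digamma z - Digamma (1 - z))) (at z)"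
    by (rule derivative_eq_intros refl z)+ (simp add: algebra_simps)
  moreover have "((\<lambda>z. of_real pi / sin (of_real pi * z)) has_field_derivative
      (of_real pi / sin (of_real pi * z)) * (- of_real pi * cos (of_real pi * z) / sin (of_real pi * z))) (at z)"
    using sin_nz[OF assms] by (auto intro!: derivative_eq_intros simp: power2_eq_square field_simps)
  ultimately have "Gamma z * Gamma (1 - z) * (Digamma z - Digamma (1 - z)) =
      (of_real pi / sin (of_real pi * z)) * (- of_real pi * cos (of_real pi * z) / sin (of_real pi * z))"
    unfolding Gamma_reflection_complex by (rule DERIV_unique)
  moreover have nz: "of_real pi / sin (of_real pi * z) \<noteq> 0" using sin_nz[OF assms] by simp
  ultimately show ?thesis unfolding Gamma_reflection_complex mult_left_cancel[OF nz] by blast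
qed

text \<open>The second logarithmic derivative of Euler's reflection formula. With the series of
  \<open>Polygamma 1\<close> it is the partial fraction expansion of
  \<open>(pi / sin (pi z))^2\<close>.\<close>

lemma Polygamma_1_reflection:
  fixes z :: complex
  assumes "z \<notin> \<int>"
  shows "Polygamma 1 z + Polygamma 1 (1 - z) = (of_real pi / sin (of_real pi * z))\<^sup>2"
proof -
  have z: "z \<notin> \<int>\<^sub>\<le>\<^sub>0" "1 - z \<notin> \<int>\<^sub>\<le>\<^sub>0"
    using assms nonpos_Ints_Int[of z] nonpos_Ints_Int[of "1 - z"] Ints_diff[of 1 "1 - z"] by auto
  have sin_nz: "sin (of_real pi * w) \<noteq> 0" if "w \<notin> \<int>" for w :: complex
    using that by (auto simp: sin_eq_0 mult.commute)
  have op: "open (- \<int> :: complex set)" by (simp add: open_Compl closed_Ints)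
  have 1: "((\<lambda>z. Digamma z - Digamma (1 - z)) has_field_derivative
      Polygamma 1 z + Polygamma 1 (1 - z)) (at z)"
    by (rule derivative_eq_intros refl z)+ simp
  define s c where "s = sin (of_real pi * z)" and "c = cos (of_real pi * z)"
  have s: "s \<noteq> 0" using sin_nz[OF assms] by (simp add: s_def)
  have "((\<lambda>z. - of_real pi * cos (of_real pi * z)) has_field_derivative of_real pi * (of_real pi * s)) (at z)"
    unfolding s_def by (auto intro!: derivative_eq_intros)
  moreover have "((\<lambda>z. sin (of_real pi * z)) has_field_derivative of_real pi * c) (at z)"
    unfolding c_def by (auto intro!: derivative_eq_intros)
  ultimately have "((\<lambda>z. - of_real pi * cos (of_real pi * z) / sin (of_real pi * z)) has_field_derivative
      (of_real pi * (of_real pi * s) * s - (- of_real pi * c) * (of_real pi * c)) / (s * s)) (at z)"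
    unfolding s_def c_def using sin_nz[OF assms] by (rule DERIV_divide)
  also have "of_real pi * (of_real pi * s) * s - (- of_real pi * c) * (of_real pi * c) = of_real pi ^ 2 * (s\<^sup>2 + c\<^sup>2)"
    by (simp add: power2_eq_square algebra_simps)
  also have "s\<^sup>2 + c\<^sup>2 = 1" unfolding s_def c_def by simp
  finally have 2: "((\<lambda>z. - of_real pi * cos (of_real pi * z) / sin (of_real pi * z)) has_field_derivative
      of_real pi ^ 2 / (s * s)) (at z)" by simp
  have "((\<lambda>z. Digamma z - Digamma (1 - z)) has_field_derivative of_real pi ^ 2 / (s * s)) (at z)"
    by (rule has_field_derivative_transform_within_open[OF 2 op])
      (use assms Digamma_reflection in auto)
  from DERIV_unique[OF 1 this] show ?thesis by (simp add: power_divide s_def power2_eq_square)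
qed

text \<open>With \<open>r = exp (- 2 pi x)\<close> this is the sum of \<open>k * r ^ k\<close> over
  \<open>k > 0\<close>. Summed over the multiples of \<open>y\<close> it yields a Lambert series,
  and with it E2 at \<open>\<i> y\<close>.\<close>

definition lambert_term :: "real \<Rightarrow> real" where
  "lambert_term x = exp (- 2 * pi * x) / (1 - exp (- 2 * pi * x))\<^sup>2"

text \<open>The real part of \<open>1 / (v + \<i> u y)^2\<close>, a term of the weight two
  Eisenstein series at \<open>\<i> y\<close>, in a form that can be differentiated in
  \<open>u\<close> and \<open>v\<close>.\<close>

definition lattice_term :: "real \<Rightarrow> real \<Rightarrow> real \<Rightarrow> real" where
  "lattice_term y u v = (v\<^sup>2 - u\<^sup>2 * y\<^sup>2) / (v\<^sup>2 + u\<^sup>2 * y\<^sup>2)\<^sup>2"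

lemma lattice_term_eq_Re: "lattice_term y u v = Re (1 / (Complex v (u * y))\<^sup>2)"
proof -
  have "(v\<^sup>2 - (u * y)\<^sup>2)\<^sup>2 + (2 * v * (u * y))\<^sup>2 = (v\<^sup>2 + (u * y)\<^sup>2)\<^sup>2"
    by (simp add: power2_eq_square algebra_simps)
  then show ?thesis by (simp add: lattice_term_def Re_divide power_mult_distrib) (simp add: power2_eq_square algebra_simps)
qed

text \<open>The terms for \<open>n\<close> and \<open>- n\<close> are conjugate, so twice the sum
  runs over all nonzero integers. The reflection identity at \<open>z = \<i> x\<close>, without the
  term for 0, gives the closed form.\<close>

lemma row_sum:
  assumes "x > 0"
  shows "(\<lambda>n. lattice_term x 1 (real (Suc n))) sums (1 / (2 * x\<^sup>2) - 2 * pi\<^sup>2 * lambert_term x)"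
proof -
  define z where "z = \<i> * of_real x"
  have zI: "z \<notin> \<int>" using assms by (auto simp: z_def complex_is_Int_iff)
  have z0: "z \<noteq> 0" "1 - z \<noteq> 0" using assms by (auto simp: z_def complex_eq_iff)
  have "(\<lambda>k. inverse ((z + of_nat k)\<^sup>2)) sums Polygamma 1 z"
    using Polygamma_LIMSEQ[OF z0(1), of 1] by (simp add: numeral_2_eq_2)
  then have 1: "(\<lambda>k. inverse ((z + of_nat (Suc k))\<^sup>2)) sums (Polygamma 1 z - inverse (z\<^sup>2))"
    by (subst sums_Suc_iff) simp
  have 2: "(\<lambda>k. inverse ((1 - z + of_nat k)\<^sup>2)) sums Polygamma 1 (1 - z)"
    using Polygamma_LIMSEQ[OF z0(2), of 1] by (simp add: numeral_2_eq_2)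
  have eq: "inverse ((z + of_nat (Suc k))\<^sup>2) + inverse ((1 - z + of_nat k)\<^sup>2) = of_real (2 * lattice_term x 1 (real (Suc k)))" for k
  proof -
    define n where "n = real (Suc k)"
    have n: "n > 0" by (simp add: n_def)
    have a: "z + of_nat (Suc k) = Complex n x" "1 - z + of_nat k = Complex n (-x)"
      by (auto simp: z_def n_def complex_eq_iff)
    have "inverse ((Complex n x)\<^sup>2) + inverse ((Complex n (-x))\<^sup>2) =
        ((Complex n (-x))\<^sup>2 + (Complex n x)\<^sup>2) / (Complex n x * Complex n (-x))\<^sup>2"
    proof -
      have "Complex n x \<noteq> 0" "Complex n (-x) \<noteq> 0" using n by (auto simp: complex_eq_iff)
      then show ?thesis by (simp add: field_simps power_mult_distrib)
    qed
    also have "Complex n x * Complex n (-x) = of_real (n\<^sup>2 + x\<^sup>2)"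
      by (simp add: complex_eq_iff power2_eq_square)
    also have "(Complex n (-x))\<^sup>2 + (Complex n x)\<^sup>2 = of_real (2 * (n\<^sup>2 - x\<^sup>2))"
      by (simp add: complex_eq_iff power2_eq_square)
    finally show ?thesis unfolding a n_def[symmetric] by (simp add: lattice_term_def)
  qed
  define r where "r = exp (- 2 * pi * x)"
  have r: "r < 1" "r > 0" using assms by (auto simp: r_def)
  have sin: "sin (of_real pi * z) = \<i> * of_real (sinh (pi * x))"
    by (simp add: z_def sinh_field_def sin_exp_eq exp_of_real[symmetric] field_simps)
  have sinh: "sinh (pi * x) ^ 2 = (1 - r)\<^sup>2 / (4 * r)"
  proof -
    define e where "e = exp (pi * x)"
    have e: "e > 0" by (simp add: e_def)
    have re: "r = 1 / e\<^sup>2" unfolding r_def e_def by (simp add: exp_minus inverse_eq_divide flip: exp_double)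
    have "sinh (pi * x) = (e - 1 / e) / 2" by (simp add: sinh_field_def e_def exp_minus inverse_eq_divide)
    from this[THEN arg_cong[of _ _ "\<lambda>a. a\<^sup>2"]] show ?thesis
      unfolding re using e by (simp add: power_divide) (simp add: field_simps power2_eq_square)
  qed
  have lambert_term: "lambert_term x = r / (1 - r)\<^sup>2" by (simp add: lambert_term_def r_def)
  have "(of_real pi / sin (of_real pi * z))\<^sup>2 = of_real (- 4 * pi\<^sup>2 * lambert_term x)"
    unfolding sin lambert_term using r sinh
    by (simp add: power_divide power_mult_distrib flip: of_real_power)
  with sums_add[OF 1 2] have "(\<lambda>k. of_real (2 * lattice_term x 1 (real (Suc k))) :: complex) sums
      (of_real (- 4 * pi\<^sup>2 * lambert_term x) - inverse (z\<^sup>2))"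
    unfolding eq using Polygamma_1_reflection[OF zI] by (simp add: algebra_simps)
  also have "of_real (- 4 * pi\<^sup>2 * lambert_term x) - inverse (z\<^sup>2) = (of_real (1 / x\<^sup>2 - 4 * pi\<^sup>2 * lambert_term x) :: complex)"
    by (simp add: z_def power_mult_distrib inverse_eq_divide)
  finally have "(\<lambda>k. 2 * lattice_term x 1 (real (Suc k))) sums (1 / x\<^sup>2 - 4 * pi\<^sup>2 * lambert_term x)"
    by (simp only: sums_of_real_iff)
  from sums_mult[OF this, of "1/2"] show ?thesis by (simp add: algebra_simps)
qed

section \<open>The order of summation in the lattice series\<close>

definition cellsum :: "real \<Rightarrow> real \<Rightarrow> real \<Rightarrow> real" where
  "cellsum y u v = (arctan ((v + 1/2) / ((u + 1/2) * y)) - arctan ((v + 1/2) / ((u - 1/2) * y))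
     - arctan ((v - 1/2) / ((u + 1/2) * y)) + arctan ((v - 1/2) / ((u - 1/2) * y))) / y"

text \<open>The mixed difference of \<open>arctan (v / (u y)) / y\<close> over the unit square around \<open>(u, v)\<close> is a value
  of its mixed derivative \<^const>\<open>lattice_term\<close> there.\<close>

lemma cellsum_mvt:
  assumes "y > 0" "u \<ge> 1" "v \<ge> 1"
  obtains u' v' where "\<bar>u' - u\<bar> \<le> 1/2" "\<bar>v' - v\<bar> \<le> 1/2" "cellsum y u v = lattice_term y u' v'"
proof -
  define g where "g v = arctan (v / ((u + 1/2) * y)) - arctan (v / ((u - 1/2) * y))" for v
  define k where "k v u = u * y / (u\<^sup>2 * y\<^sup>2 + v\<^sup>2)" for u v
  have pos: "u'\<^sup>2 * y\<^sup>2 + v'\<^sup>2 > 0" if "u' > 0" for u' v'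
    using that assms(1) by (intro add_pos_nonneg mult_pos_pos) auto
  have darctan: "((\<lambda>v. arctan (v / (u' * y))) has_field_derivative k v' u') (at v')" if "u' > 0" for u' v'
  proof -
    define w where "w = u' * y"
    have w: "w > 0" using that assms(1) by (simp add: w_def)
    have "((\<lambda>v. arctan (v / w)) has_field_derivative inverse (1 + (v' / w)\<^sup>2) * (1 / w)) (at v')"
      using w by (auto intro!: derivative_eq_intros)
    also have "1 + (v' / w)\<^sup>2 = (w\<^sup>2 + v'\<^sup>2) / w\<^sup>2" using w by (simp add: field_simps)
    also have "inverse \<dots> * (1 / w) = w / (w\<^sup>2 + v'\<^sup>2)" using w by (simp add: power2_eq_square)
    finally show ?thesis by (simp add: k_def w_def power_mult_distrib)
  qed
  have "\<exists>v'. v - 1/2 < v' \<and> v' < v + 1/2 \<and> g (v + 1/2) - g (v - 1/2) = (v + 1/2 - (v - 1/2)) * (k v' (u + 1/2) - k v' (u - 1/2))"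
    unfolding g_def by (rule MVT2) (use assms in \<open>auto intro!: derivative_intros darctan\<close>)
  then obtain v' where v': "v - 1/2 < v'" "v' < v + 1/2" "g (v + 1/2) - g (v - 1/2) = k v' (u + 1/2) - k v' (u - 1/2)"
    by auto
  have dk: "((\<lambda>u. k v' u) has_field_derivative y * lattice_term y u' v') (at u')" if "u' > 0" for u'
    unfolding k_def lattice_term_def using pos[OF that, of v']
    by (auto intro!: derivative_eq_intros simp: power2_eq_square field_simps)
  have "\<exists>u'. u - 1/2 < u' \<and> u' < u + 1/2 \<and> k v' (u + 1/2) - k v' (u - 1/2) = (u + 1/2 - (u - 1/2)) * (y * lattice_term y u' v')"
    by (rule MVT2) (use assms in \<open>auto intro!: dk\<close>)
  then obtain u' where u': "u - 1/2 < u'" "u' < u + 1/2" "k v' (u + 1/2) - k v' (u - 1/2) = y * lattice_term y u' v'"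
    by auto
  have "cellsum y u v = (g (v + 1/2) - g (v - 1/2)) / y" unfolding cellsum_def g_def by (simp add: algebra_simps)
  also have "\<dots> = lattice_term y u' v'" using v' u' assms by simp
  finally have "cellsum y u v = lattice_term y u' v'" .
  moreover have "\<bar>u' - u\<bar> \<le> 1/2" "\<bar>v' - v\<bar> \<le> 1/2" using u' v' by linarith+
  ultimately show ?thesis using that by blast
qed

text \<open>Moving a point inside its unit cell changes \<open>1 / z^2\<close> by the order of
  \<open>1 / norm z ^ 3\<close>, and \<open>(norm z)^2 \<ge> 2 y u v\<close> splits this bound into
  a product of two summable powers.\<close>

lemma cellsum_bound:
  assumes "y > 0" "u \<ge> 1" "v \<ge> 1"
  shows "\<bar>lattice_term y u v - cellsum y u v\<bar> \<le> 3 * (1 + y) / (sqrt (2 * y)) ^ 3 * (u powr (-3/2) * v powr (-3/2))"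
proof -
  obtain u' v' where uv': "\<bar>u' - u\<bar> \<le> 1/2" "\<bar>v' - v\<bar> \<le> 1/2" "cellsum y u v = lattice_term y u' v'"
    using assms by (rule cellsum_mvt)
  have half: "v / 2 \<le> v'" "u / 2 \<le> u'" using uv' assms by linarith+
  define z w where "z = Complex v (u * y)" and "w = Complex v' (u' * y)"
  have nz: "norm z > 0" using assms by (auto simp: z_def complex_eq_iff)
  have "norm z / 2 = norm (Complex (v / 2) (u / 2 * y))"
    using norm_mult[of "1/2" z] by (simp add: z_def complex_eq_iff mult.commute scaleR_conv_of_real) (simp add: complex_norm power_divide real_sqrt_divide flip: add_divide_distrib)
  also have "\<dots> \<le> norm w"
    unfolding w_def complex_norm complex.sel using assms half
    by (intro real_sqrt_le_mono add_mono power_mono mult_right_mono) auto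
  finally have w: "norm w \<ge> norm z / 2" .
  have wz: "norm (w - z) \<le> 1 / 2 * (1 + y)"
  proof -
    have "norm (w - z) \<le> \<bar>v' - v\<bar> + \<bar>(u' - u) * y\<bar>"
      using cmod_le[of "w - z"] by (simp add: z_def w_def left_diff_distrib)
    also have "\<dots> \<le> 1 / 2 + 1 / 2 * y"
      unfolding abs_mult using uv' assms by (intro add_mono mult_mono) auto
    finally show ?thesis by (simp add: algebra_simps)
  qed
  have nw: "norm w > 0" using w nz by linarith
  have "lattice_term y u v - cellsum y u v = Re (1 / z\<^sup>2 - 1 / w\<^sup>2)" unfolding uv' lattice_term_eq_Re z_def w_def by simp
  also have "\<bar>\<dots>\<bar> \<le> norm (1 / z\<^sup>2 - 1 / w\<^sup>2)" by (rule abs_Re_le_cmod)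
  also have "1 / z\<^sup>2 - 1 / w\<^sup>2 = (w - z) * (w + z) / (w\<^sup>2 * z\<^sup>2)"
    using nz nw by (auto simp: field_simps power2_eq_square)
  also have "norm \<dots> = norm (w - z) * norm (w + z) / ((norm w)\<^sup>2 * (norm z)\<^sup>2)"
    by (simp add: norm_mult norm_divide norm_power)
  also have "\<dots> \<le> (1 / 2 * (1 + y)) * (norm w + norm z) / ((norm w)\<^sup>2 * (norm z)\<^sup>2)"
    using assms wz by (intro divide_right_mono mult_mono norm_triangle_ineq) auto
  also have "\<dots> = 1 / 2 * (1 + y) * ((1 / norm w) / (norm z)\<^sup>2 + (1 / norm w)\<^sup>2 / norm z)"
    using nz nw by (simp add: field_simps power2_eq_square)
  also have "\<dots> \<le> 1 / 2 * (1 + y) * ((2 / norm z) / (norm z)\<^sup>2 + (2 / norm z)\<^sup>2 / norm z)"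
  proof -
    have "1 / norm w \<le> 2 / norm z" using w nz nw by (simp add: field_simps)
    then show ?thesis using assms nw by (intro mult_left_mono add_mono divide_right_mono power_mono) auto
  qed
  also have "\<dots> = 3 * (1 + y) * (1 / norm z) ^ 3" using nz by (simp add: field_simps power2_eq_square power3_eq_cube)
  also have "\<dots> \<le> 3 * (1 + y) * (1 / sqrt (2 * y * (u * v))) ^ 3"
  proof -
    have "2 * y * (u * v) \<le> v\<^sup>2 + (u * y)\<^sup>2" using sum_squares_bound[of v "u * y"] by (simp add: algebra_simps)
    then have "sqrt (2 * y * (u * v)) \<le> norm z" unfolding z_def complex_norm by simp
    moreover have "sqrt (2 * y * (u * v)) > 0" using assms by simp
    ultimately show ?thesis using assms nz by (intro mult_left_mono power_mono divide_left_mono mult_pos_pos) auto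
  qed
  also have "(1 / sqrt (2 * y * (u * v))) ^ 3 = 1 / (sqrt (2 * y)) ^ 3 * (u powr (-3/2) * v powr (-3/2))"
  proof -
    have "(1 / sqrt x) ^ 3 = x powr (-3/2)" if "x > 0" for x
      using that by (simp add: powr_half_sqrt[symmetric] powr_minus_divide[symmetric] powr_powr flip: powr_realpow)
    from this[of u] this[of v] assms have "u powr (-3/2) * v powr (-3/2) = (1 / sqrt u) ^ 3 * (1 / sqrt v) ^ 3" by simp
    then show ?thesis by (simp add: real_sqrt_mult power_mult_distrib power_divide)
  qed
  finally show ?thesis by simp
qed

text \<open>The double series does not converge absolutely, but its difference from the telescoping
  series of the \<^const>\<open>cellsum\<close> does; hence the defect \<open>\<pi> / (2 y)\<close> between the two orders of summation.\<close>

lemma double_sum_difference: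
  assumes y: "y > 0"
    and rows: "\<And>m. (\<lambda>n. lattice_term y (real (Suc m)) (real (Suc n))) sums R m"
    and cols: "\<And>n. (\<lambda>m. lattice_term y (real (Suc m)) (real (Suc n))) sums C n"
  obtains D where "R sums D" "C sums (D - pi / (2 * y))"
proof -
  define d where "d m n = lattice_term y (real (Suc m)) (real (Suc n)) - cellsum y (real (Suc m)) (real (Suc n))" for m n
  define p where "p n = real (Suc n) powr (-3/2)" for n
  have "summable (\<lambda>n. real n powr (-3/2))" by (simp add: summable_real_powr_iff)
  then have "summable p" unfolding p_def by (subst summable_Suc_iff)
  then have p: "(p has_sum suminf p) UNIV"
    by (intro sums_nonneg_imp_has_sum summable_sums) (auto simp: p_def)
  define K where "K = 3 * (1 + y) / (sqrt (2 * y)) ^ 3"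
  have "(\<lambda>(m, n). K * (p m * p n)) summable_on UNIV \<times> UNIV"
  proof (rule summable_on_SigmaI)
    fix m
    show "((\<lambda>n. case (m, n) of (m, n) \<Rightarrow> K * (p m * p n)) has_sum K * (p m * suminf p)) UNIV"
      using p by (simp add: has_sum_cmult_right)
  next
    show "(\<lambda>m. K * (p m * suminf p)) summable_on UNIV"
      using p by (intro summable_on_cmult_right summable_on_cmult_left) (auto simp: summable_on_def)
  qed (use y in \<open>auto simp: K_def p_def\<close>)
  then have "(\<lambda>x. norm (case x of (m, n) \<Rightarrow> d m n)) summable_on UNIV \<times> UNIV"
  proof (rule Infinite_Sum.abs_summable_on_comparison_test')
    fix x :: "nat \<times> nat"
    show "norm (case x of (m, n) \<Rightarrow> d m n) \<le> (case x of (m, n) \<Rightarrow> K * (p m * p n))"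
      using cellsum_bound[OF y] by (cases x) (simp add: d_def K_def p_def)
  qed
  then have "(\<lambda>(m, n). d m n) summable_on UNIV \<times> UNIV" by (rule abs_summable_summable)
  then obtain D where D: "((\<lambda>(m, n). d m n) has_sum D) (UNIV \<times> UNIV)" by (auto simp: summable_on_def)
  have row: "((\<lambda>n. d m n) has_sum (\<Sum>\<^sub>\<infinity>n. d m n)) UNIV" for m
    by (intro has_sum_infsum summable_on_SigmaD1[where f = d and A = UNIV] has_sum_imp_summable[OF D] UNIV_I)
  have "((\<lambda>m. \<Sum>\<^sub>\<infinity>n. d m n) has_sum D) UNIV"
    by (rule has_sum_SigmaD[OF D]) (use row in simp)
  then have rowD: "(\<lambda>m. \<Sum>\<^sub>\<infinity>n. d m n) sums D" by (rule has_sum_imp_sums)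
  have D': "((\<lambda>(n, m). d m n) has_sum D) (UNIV \<times> UNIV)"
    using D by (subst (asm) has_sum_swap) simp
  have col: "((\<lambda>m. d m n) has_sum (\<Sum>\<^sub>\<infinity>m. d m n)) UNIV" for n
    by (intro has_sum_infsum summable_on_SigmaD1[where f = "\<lambda>n m. d m n" and A = UNIV] has_sum_imp_summable[OF D'] UNIV_I)
  have "((\<lambda>n. \<Sum>\<^sub>\<infinity>m. d m n) has_sum D) UNIV"
    by (rule has_sum_SigmaD[OF D']) (use col in simp)
  then have colD: "(\<lambda>n. \<Sum>\<^sub>\<infinity>m. d m n) sums D" by (rule has_sum_imp_sums)
  \<comment> \<open>The antiderivative sampled at the corners of the cells. It tends to
    \<open>pi / (2 y)\<close> as \<open>v\<close> grows but to 0 as \<open>u\<close> grows; this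
    asymmetry is the whole defect.\<close>
  define t where "t u v = arctan ((real v + 1/2) / ((real u + 1/2) * y)) / y" for u v
  have cell: "cellsum y (real (Suc m)) (real (Suc n)) = (t (Suc m) (Suc n) - t m (Suc n)) - (t (Suc m) n - t m n)" for m n
    by (simp add: cellsum_def t_def algebra_simps add_divide_distrib diff_divide_distrib)
  have inf1: "filterlim (\<lambda>n. real n + 1/2) at_top sequentially"
    using filterlim_tendsto_add_at_top[OF tendsto_const filterlim_real_sequentially, of "1/2"] by (simp add: add.commute)
  have tv: "(\<lambda>n. t m n) \<longlonglongrightarrow> (pi / 2) / y" for m
  proof -
    have "filterlim (\<lambda>n. (real n + 1/2) / ((real m + 1/2) * y)) at_top sequentially"
      unfolding divide_inverse using y
      by (intro filterlim_at_top_mult_tendsto_pos[OF tendsto_const _ inf1[unfolded divide_inverse]]) auto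
    then show ?thesis unfolding t_def
      by (intro tendsto_divide filterlim_compose[OF tendsto_arctan_at_top] tendsto_const) (use y in auto)
  qed
  have tu: "(\<lambda>m. t m n) \<longlonglongrightarrow> 0" for n
  proof -
    have "(\<lambda>m. (real n + 1/2) / ((real m + 1/2) * y)) \<longlonglongrightarrow> 0"
      using y by (intro real_tendsto_divide_at_top[OF tendsto_const] filterlim_at_top_mult_tendsto_pos[OF tendsto_const _ inf1])
    then have "(\<lambda>m. arctan ((real n + 1/2) / ((real m + 1/2) * y)) / y) \<longlonglongrightarrow> arctan 0 / y"
      by (intro tendsto_intros) (use y in auto)
    then show ?thesis by (simp add: t_def)
  qed
  have rowb: "(\<lambda>n. cellsum y (real (Suc m)) (real (Suc n))) sums (0 - (t (Suc m) 0 - t m 0))" for m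
    unfolding cell
    by (rule telescope_sums[where f = "\<lambda>n. t (Suc m) n - t m n"])
      (use tendsto_diff[OF tv[of "Suc m"] tv[of m]] in simp)
  have colb: "(\<lambda>m. cellsum y (real (Suc m)) (real (Suc n))) sums (0 - (t 0 (Suc n) - t 0 n))" for n
  proof -
    have "(\<lambda>m. (t (Suc m) (Suc n) - t (Suc m) n) - (t m (Suc n) - t m n)) sums (0 - (t 0 (Suc n) - t 0 n))"
      by (rule telescope_sums[where f = "\<lambda>m. t m (Suc n) - t m n"])
        (use tendsto_diff[OF tu[of "Suc n"] tu[of n]] in simp)
    then show ?thesis unfolding cell by (simp add: algebra_simps)
  qed
  have R: "R m = (\<Sum>\<^sub>\<infinity>n. d m n) - (t (Suc m) 0 - t m 0)" for m
  proof -
    have "(\<lambda>n. d m n) sums (R m - (0 - (t (Suc m) 0 - t m 0)))"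
      unfolding d_def by (intro sums_diff rows rowb)
    from sums_unique2[OF this has_sum_imp_sums[OF row]] show ?thesis by simp
  qed
  have C: "C n = (\<Sum>\<^sub>\<infinity>m. d m n) - (t 0 (Suc n) - t 0 n)" for n
  proof -
    have "(\<lambda>m. d m n) sums (C n - (0 - (t 0 (Suc n) - t 0 n)))"
      unfolding d_def by (intro sums_diff cols colb)
    from sums_unique2[OF this has_sum_imp_sums[OF col]] show ?thesis by simp
  qed
  \<comment> \<open>Both orders leave the corner term \<open>t 0 0\<close>, which is absorbed into
    the common value at the end.\<close>
  have "R sums (D - (0 - t 0 0))"
    unfolding R by (intro sums_diff rowD telescope_sums tu)
  moreover have "C sums (D - (pi / 2 / y - t 0 0))"
    unfolding C by (intro sums_diff colD telescope_sums tv)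
  ultimately show ?thesis using that[of "D + t 0 0"] by (simp add: algebra_simps)
qed

text \<open>This rests on \<open>v + \<i> u y = \<i> y (u - \<i> v / y)\<close>: exchanging the axes
  is the inversion of \<tau> = \<open>\<i> y\<close>.\<close>

lemma lattice_term_swap: "y > 0 \<Longrightarrow> u > 0 \<Longrightarrow> v > 0 \<Longrightarrow> lattice_term y u v = - (1 / y\<^sup>2) * lattice_term (1 / y) v u"
proof -
  assume a: "y > 0" "u > 0" "v > 0"
  have "lattice_term (1 / y) v u = (u\<^sup>2 - v\<^sup>2 / y\<^sup>2) / (u\<^sup>2 + v\<^sup>2 / y\<^sup>2)\<^sup>2" by (simp add: lattice_term_def power_divide)
  also have "u\<^sup>2 - v\<^sup>2 / y\<^sup>2 = (u\<^sup>2 * y\<^sup>2 - v\<^sup>2) / y\<^sup>2" using a by (simp add: field_simps)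
  also have "u\<^sup>2 + v\<^sup>2 / y\<^sup>2 = (v\<^sup>2 + u\<^sup>2 * y\<^sup>2) / y\<^sup>2" using a by (simp add: field_simps)
  also have "(u\<^sup>2 * y\<^sup>2 - v\<^sup>2) / y\<^sup>2 / ((v\<^sup>2 + u\<^sup>2 * y\<^sup>2) / y\<^sup>2)\<^sup>2 = - y\<^sup>2 * lattice_term y u v"
  proof -
    have "A / p / ((B :: real) / p)\<^sup>2 = - p * (- A / B\<^sup>2)" if "p \<noteq> 0" for A B p
      using that by (simp add: power_divide) (simp add: power2_eq_square)
    from this[of "y\<^sup>2" "u\<^sup>2 * y\<^sup>2 - v\<^sup>2" "v\<^sup>2 + u\<^sup>2 * y\<^sup>2"] a show ?thesis by (simp add: lattice_term_def)
  qed
  finally show ?thesis using a by simp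
qed

text \<open>This is the law of E2 under inversion on the imaginary axis: \<open>1 - 24 * A\<close>
  and \<open>1 - 24 * B\<close> are its values at \<open>\<i> y\<close> and \<open>\<i> / y\<close>.
  Columns are rows for \<open>1 / y\<close>, and \<open>6 * y / pi\<close> comes from the defect
  \<open>pi / (2 * y)\<close>.\<close>

theorem lambert_term_sum_reciprocity:
  assumes y: "y > 0"
  obtains A B where "(\<lambda>m. lambert_term (real (Suc m) * y)) sums A" "(\<lambda>m. lambert_term (real (Suc m) / y)) sums B"
    "1 - 24 * B = - (y\<^sup>2) * (1 - 24 * A) + 6 * y / pi"
proof -
  define Q where "Q y m = 1 / (2 * (real (Suc m) * y)\<^sup>2) - 2 * pi\<^sup>2 * lambert_term (real (Suc m) * y)" for y m
  have rowQ: "(\<lambda>n. lattice_term y (real (Suc m)) (real (Suc n))) sums Q y m" if "y > 0" for y m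
  proof -
    have "lattice_term y (real (Suc m)) v = lattice_term (real (Suc m) * y) 1 v" for v by (simp add: lattice_term_def power_mult_distrib)
    then show ?thesis using row_sum[of "real (Suc m) * y"] that by (simp add: Q_def)
  qed
  have colQ: "(\<lambda>m. lattice_term y (real (Suc m)) (real (Suc n))) sums (- (1 / y\<^sup>2) * Q (1 / y) n)" for n
    using sums_mult[OF rowQ[of "1/y" n], of "- (1 / y\<^sup>2)"] y by (subst lattice_term_swap) auto
  obtain D where D: "Q y sums D" "(\<lambda>n. - (1 / y\<^sup>2) * Q (1 / y) n) sums (D - pi / (2 * y))"
    using double_sum_difference[OF y rowQ[OF y] colQ] .
  have D2: "Q (1 / y) sums (- (y\<^sup>2) * (D - pi / (2 * y)))"
    using sums_mult[OF D(2), of "- (y\<^sup>2)"] y by simp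
  \<comment> \<open>Solves \<open>row_sum\<close> for the Lambert terms;
    \<open>pi\<^sup>2 / 12\<close> is half the sum of the inverse squares.\<close>
  have lam: "(\<lambda>m. lambert_term (real (Suc m) * x)) sums ((pi\<^sup>2 / 12 / x\<^sup>2 - E) / (2 * pi\<^sup>2))" if "x > 0" "Q x sums E" for x E
  proof -
    have "(\<lambda>m. 1 / (2 * (real (Suc m) * x)\<^sup>2)) sums (pi\<^sup>2 / 12 / x\<^sup>2)"
      using sums_mult[OF inverse_squares_sums, of "1 / (2 * x\<^sup>2)"] by (simp add: power_mult_distrib add.commute mult_ac)
    from sums_divide[OF sums_diff[OF this that(2)], of "2 * pi\<^sup>2"] show ?thesis by (simp add: Q_def)
  qed
  have "1 - 24 * ((pi\<^sup>2 / 12 / (1 / y)\<^sup>2 - (- (y\<^sup>2) * (D - pi / (2 * y)))) / (2 * pi\<^sup>2)) =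
     - (y\<^sup>2) * (1 - 24 * ((pi\<^sup>2 / 12 / y\<^sup>2 - D) / (2 * pi\<^sup>2))) + 6 * y / pi"
    using y by (simp add: field_simps power2_eq_square)
  then show ?thesis using that[OF lam[OF y D(1)]] lam[of "1/y", OF _ D2] y by (simp add: field_simps)
qed

section \<open>The discriminant\<close>

definition dsig :: "nat \<Rightarrow> nat" where "dsig n = (\<Sum>d | d dvd n. d)"

lemma dsig_0 [simp]: "dsig 0 = 0" by (simp add: dsig_def)

lemma dsig_le: "dsig n \<le> n * n"
proof (cases "n = 0")
  case False
  then have "dsig n \<le> (\<Sum>d\<in>{1..n}. n)"
    unfolding dsig_def using dvd_imp_le by (intro order.trans[OF sum_mono2 sum_mono]) (auto intro!: Nat.gr0I)
  then show ?thesis by simp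
qed auto

definition dsig_fps :: "complex fps" where "dsig_fps = Abs_fps (\<lambda>n. of_nat (dsig n))"
text \<open>Minus the logarithm of the product of all \<open>1 - q ^ n\<close>.\<close>

definition log_fps :: "complex fps" where "log_fps = Abs_fps (\<lambda>n. of_nat (dsig n) / of_nat n)"

lemma log_fps_0 [simp]: "fps_nth log_fps 0 = 0" by (simp add: log_fps_def)

lemma fps_X_deriv_log_fps: "fps_X * fps_deriv log_fps = dsig_fps"
  by (rule fps_ext) (simp add: log_fps_def dsig_fps_def)

lemma conv_radius_log_fps: "fps_conv_radius log_fps \<ge> 1"
  unfolding fps_conv_radius_def
proof (rule conv_radius_geI_ex')
  fix r :: real assume r: "0 < r" "ereal r < 1"
  have "summable (\<lambda>n. real (Suc n) * r ^ n)"
    using geometric_deriv_sums[of r] r by (auto simp: sums_iff)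
  then show "summable (\<lambda>n. fps_nth log_fps n * of_real r ^ n)"
  proof (rule summable_comparison_test[rotated], intro exI[of _ 0] allI impI)
    fix n :: nat
    have "real (dsig n) \<le> real n * real n" using dsig_le[of n] by (metis of_nat_le_iff of_nat_mult)
    then have "real (dsig n) / real n \<le> real (Suc n)" by (cases "n = 0") (auto simp: field_simps)
    then show "norm (fps_nth log_fps n * of_real r ^ n) \<le> real (Suc n) * r ^ n"
      using r mult_right_mono[of "real (dsig n) / real n" "real (Suc n)" "r ^ n"]
      by (simp add: log_fps_def norm_mult norm_divide norm_power)
  qed
qed

lemma conv_radius_dsig_fps: "fps_conv_radius dsig_fps \<ge> 1"
proof -
  have "1 \<le> fps_conv_radius (fps_deriv log_fps)" using conv_radius_log_fps fps_conv_radius_deriv order_trans by blast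
  moreover have "min (fps_conv_radius (fps_X :: complex fps)) (fps_conv_radius (fps_deriv log_fps)) \<le> fps_conv_radius dsig_fps"
    unfolding fps_X_deriv_log_fps[symmetric] by (rule fps_conv_radius_mult)
  ultimately show ?thesis by simp
qed

text \<open>A single-valued logarithm of q times the product of all \<open>(1 - q ^ n) ^ 24\<close>.
  Starting from it avoids infinite products and choices of branch.\<close>

definition Deltalog :: "complex \<Rightarrow> complex" where
  "Deltalog \<tau> = 2 * of_real pi * \<i> * \<tau> - 24 * eval_fps log_fps (qexp \<tau>)"

definition Delta :: "complex \<Rightarrow> complex" where "Delta \<tau> = exp (Deltalog \<tau>)"

definition E2 :: "complex \<Rightarrow> complex" where "E2 \<tau> = 1 - 24 * eval_fps dsig_fps (qexp \<tau>)"

lemma Delta_nonzero [simp]: "Delta \<tau> \<noteq> 0" by (simp add: Delta_def)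

lemma norm_less_conv_radius:
  assumes "Im \<tau> > 0"
  shows "ereal (norm (qexp \<tau>)) < fps_conv_radius log_fps" "ereal (norm (qexp \<tau>)) < fps_conv_radius dsig_fps"
proof -
  have "ereal (norm (qexp \<tau>)) < 1" using norm_qexp_less_1[OF assms] by simp
  then show "ereal (norm (qexp \<tau>)) < fps_conv_radius log_fps" "ereal (norm (qexp \<tau>)) < fps_conv_radius dsig_fps"
    using conv_radius_log_fps conv_radius_dsig_fps order_less_le_trans by blast+
qed

lemma has_field_derivative_Deltalog:
  assumes "Im \<tau> > 0"
  shows "(Deltalog has_field_derivative 2 * of_real pi * \<i> * E2 \<tau>) (at \<tau>)"
proof -
  note less = norm_less_conv_radius[OF assms]
  have q: "(qexp has_field_derivative 2 * of_real pi * \<i> * qexp \<tau>) (at \<tau>)"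
    unfolding qexp_def by (auto intro!: derivative_eq_intros)
  have "((\<lambda>\<tau>. eval_fps log_fps (qexp \<tau>)) has_field_derivative
      eval_fps (fps_deriv log_fps) (qexp \<tau>) * (2 * of_real pi * \<i> * qexp \<tau>)) (at \<tau>)"
    by (rule DERIV_chain2[OF has_field_derivative_eval_fps q]) (use less in auto)
  then have "(Deltalog has_field_derivative 2 * of_real pi * \<i> * 1 -
      24 * (eval_fps (fps_deriv log_fps) (qexp \<tau>) * (2 * of_real pi * \<i> * qexp \<tau>))) (at \<tau>)"
    unfolding Deltalog_def by (intro DERIV_diff DERIV_cmult DERIV_ident)
  moreover have "eval_fps dsig_fps (qexp \<tau>) = qexp \<tau> * eval_fps (fps_deriv log_fps) (qexp \<tau>)"
    unfolding fps_X_deriv_log_fps[symmetric] using order_less_le_trans[OF less(1) fps_conv_radius_deriv]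
    by (subst eval_fps_mult) auto
  ultimately show ?thesis by (simp add: E2_def algebra_simps)
qed

lemma holomorphic_Deltalog: "Deltalog holomorphic_on upper_half_plane"
  unfolding holomorphic_on_open[OF open_upper_half_plane]
  by (intro ballI exI, rule has_field_derivative_Deltalog) simp

lemma holomorphic_Delta: "Delta holomorphic_on upper_half_plane"
  unfolding Delta_def by (intro holomorphic_intros holomorphic_Deltalog)

lemma holomorphic_E2: "E2 holomorphic_on upper_half_plane"
proof -
  have "(\<lambda>\<tau>. deriv Deltalog \<tau> / (2 * of_real pi * \<i>)) holomorphic_on upper_half_plane"
    by (intro holomorphic_intros holomorphic_deriv holomorphic_Deltalog) auto
  then show ?thesis
    by (rule holomorphic_transform) (use DERIV_imp_deriv[OF has_field_derivative_Deltalog] in auto)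
qed

text \<open>Both series arrange the terms \<open>k * r ^ (m * k)\<close> with positive
  \<open>m\<close>, \<open>k\<close>, grouped by \<open>m\<close> or by the product. Summability
  comes from the radius of convergence, and nonnegativity permits the rearrangement.\<close>

lemma lambert_sums:
  assumes r: "0 < r" "r < 1" and A: "(\<lambda>m. r ^ Suc m / (1 - r ^ Suc m)\<^sup>2) sums A"
  shows "(\<lambda>n. real (dsig n) * r ^ n) sums A"
proof -
  have "ereal (norm (complex_of_real r)) < 1" using r by simp
  then have "ereal (norm (complex_of_real r)) < fps_conv_radius dsig_fps"
    using conv_radius_dsig_fps by (rule order_less_le_trans)
  then have "summable (\<lambda>n. norm (fps_nth dsig_fps n * of_real r ^ n))"
    unfolding fps_conv_radius_def by (intro abs_summable_in_conv_radius)
  then have "summable (\<lambda>n. real (dsig n) * r ^ n)" using r by (simp add: dsig_fps_def norm_mult norm_power)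
  then obtain S where S: "(\<lambda>n. real (dsig n) * r ^ n) sums S" by blast
  then have "((\<lambda>n. real (dsig n) * r ^ n) has_sum S) UNIV"
    using r by (intro sums_nonneg_imp_has_sum) auto
  then have S': "((\<lambda>n. real (dsig n) * r ^ n) has_sum S) {1..}"
    by (rule has_sum_cong_neutral[THEN iffD1, rotated -1]) (auto simp: not_le)
  define f where "f = (\<lambda>(n, d). real d * r ^ n)"
  have fin: "((\<lambda>d. f (n, d)) has_sum real (dsig n) * r ^ n) {d. d dvd n}" if "n \<in> {1..}" for n
    using that by (intro has_sum_finiteI) (auto simp: f_def dsig_def sum_distrib_right)
  have "f summable_on Sigma {1..} (\<lambda>n. {d. d dvd n})"
    using fin S' r by (intro summable_on_SigmaI[where g = "\<lambda>n. real (dsig n) * r ^ n"]) (auto simp: f_def summable_on_def)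
  with fin S' have *: "(f has_sum S) (Sigma {1..} (\<lambda>n. {d. d dvd n}))"
    by (intro has_sum_SigmaI[where g = "\<lambda>n. real (dsig n) * r ^ n"]) auto
  \<comment> \<open>A pair \<open>(m, k)\<close> is a number \<open>n = m * k\<close> with a chosen
    divisor \<open>k\<close>.\<close>
  have "bij_betw (\<lambda>(m :: nat, k :: nat). (m * k, k)) ({1..} \<times> {1..}) (Sigma {1..} (\<lambda>n. {d. d dvd n}))"
  proof (rule bij_betwI[of _ _ _ "\<lambda>(n, d). (n div d, d)"])
    show "(\<lambda>(n :: nat, d :: nat). (n div d, d)) \<in> Sigma {1..} (\<lambda>n. {d. d dvd n}) \<rightarrow> {1..} \<times> {1..}"
    proof (rule Pi_I)
      fix x :: "nat \<times> nat" assume "x \<in> Sigma {1..} (\<lambda>n. {d. d dvd n})"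
      then obtain n d where x: "x = (n, d)" "n > 0" "d dvd n" by auto
      then have "d > 0" "d \<le> n" by (auto intro: dvd_imp_le Nat.gr0I)
      with x show "(case x of (n, d) \<Rightarrow> (n div d, d)) \<in> {1..} \<times> {1..}"
        by (simp add: Suc_le_eq div_greater_zero_iff)
    qed
  qed auto
  from has_sum_reindex_bij_betw[OF this, of f S] *
  have **: "((\<lambda>(m, k). real k * r ^ (m * k)) has_sum S) ({1..} \<times> {1..})"
    by (simp add: f_def case_prod_unfold)
  have bij: "bij_betw Suc UNIV {1..}" by (rule bij_betwI[of _ _ _ "\<lambda>n. n - 1"]) auto
  have row: "((\<lambda>k. case (m, k) of (m, k) \<Rightarrow> real k * r ^ (m * k)) has_sum r ^ m / (1 - r ^ m)\<^sup>2) {1..}" if "m \<in> {1..}" for m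
  proof -
    have rm: "0 < r ^ m" "r ^ m < 1" using r that by (auto simp: power_less_one_iff)
    have "(\<lambda>k. real (Suc k) * (r ^ m) ^ k) sums (1 / (1 - r ^ m)\<^sup>2)"
      using rm by (intro geometric_deriv_sums) auto
    from sums_mult[OF this, of "r ^ m"] have "(\<lambda>k. real (Suc k) * r ^ (m * Suc k)) sums (r ^ m / (1 - r ^ m)\<^sup>2)"
      by (simp add: power_mult power_add mult.left_commute del: of_nat_Suc)
    then have "((\<lambda>k. real (Suc k) * r ^ (m * Suc k)) has_sum r ^ m / (1 - r ^ m)\<^sup>2) UNIV"
      using r by (intro sums_nonneg_imp_has_sum) auto
    then show ?thesis using has_sum_reindex_bij_betw[OF bij, of "\<lambda>k. real k * r ^ (m * k)"] by simp
  qed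
  have "((\<lambda>m. r ^ m / (1 - r ^ m)\<^sup>2) has_sum S) {1..}"
    by (rule has_sum_SigmaD[OF ** row])
  then have "((\<lambda>m. r ^ Suc m / (1 - r ^ Suc m)\<^sup>2) has_sum S) UNIV"
    using has_sum_reindex_bij_betw[OF bij, of "\<lambda>m. r ^ m / (1 - r ^ m)\<^sup>2"] by simp
  then have "S = A" using A has_sum_imp_sums sums_unique2 by blast
  with S show ?thesis by simp
qed

lemma E2_imaginary_axis:
  assumes "y > 0" "(\<lambda>m. lambert_term (real (Suc m) * y)) sums A"
  shows "E2 (\<i> * of_real y) = of_real (1 - 24 * A)"
proof -
  define r where "r = exp (- 2 * pi * y)"
  have r: "0 < r" "r < 1" using assms by (auto simp: r_def)
  have "lambert_term (real (Suc m) * y) = r ^ Suc m / (1 - r ^ Suc m)\<^sup>2" for m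
    by (simp add: lambert_term_def r_def exp_of_nat_mult[symmetric] mult_ac del: of_nat_Suc power_Suc)
  with assms have "(\<lambda>n. real (dsig n) * r ^ n) sums A" using lambert_sums[OF r] by simp
  then have "(\<lambda>n. fps_nth dsig_fps n * of_real r ^ n) sums (of_real A)"
    by (subst (asm) sums_of_real_iff[where ?'a = complex, symmetric]) (simp add: dsig_fps_def)
  moreover have "qexp (\<i> * of_real y) = of_real r"
    by (simp add: qexp_def r_def exp_of_real[symmetric] algebra_simps)
  ultimately show ?thesis by (simp add: E2_def eval_fps_def sums_iff)
qed

text \<open>The identity is known on the positive imaginary axis, which accumulates at
  \<open>\<i>\<close>; analytic continuation gives the rest.\<close>

lemma E2_reciprocity:
  assumes "Im \<tau> > 0"
  shows "E2 (- 1 / \<tau>) = \<tau>\<^sup>2 * E2 \<tau> + 6 * \<tau> / (of_real pi * \<i>)"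
proof -
  define f where "f \<tau> = E2 (- 1 / \<tau>) - (\<tau>\<^sup>2 * E2 \<tau> + 6 * \<tau> / (of_real pi * \<i>))" for \<tau>
  define U where "U = (\<lambda>y. \<i> * of_real y) ` {0<..}"
  have Sinv: "(\<lambda>\<tau>. - 1 / \<tau>) ` upper_half_plane \<subseteq> upper_half_plane"
    using Im_moebius_pos[OF Smat_in_SL2Z] by (auto simp: moebius_Smat)
  have "(E2 \<circ> (\<lambda>\<tau>. - 1 / \<tau>)) holomorphic_on upper_half_plane"
    by (intro holomorphic_on_compose_gen[OF _ holomorphic_E2 Sinv] holomorphic_intros) auto
  then have hol: "f holomorphic_on upper_half_plane"
    unfolding f_def by (intro holomorphic_intros holomorphic_E2) (auto simp: o_def)
  have U0: "f z = 0" if zU: "z \<in> U" for z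
  proof -
    obtain y where y: "y > 0" "z = \<i> * of_real y" using zU by (auto simp: U_def)
    obtain A B where AB: "(\<lambda>m. lambert_term (real (Suc m) * y)) sums A" "(\<lambda>m. lambert_term (real (Suc m) / y)) sums B"
      "1 - 24 * B = - (y\<^sup>2) * (1 - 24 * A) + 6 * y / pi" using lambert_term_sum_reciprocity[OF y(1)] .
    have "- 1 / z = \<i> * of_real (1 / y)" using y by (simp add: field_simps)
    then have "E2 (- 1 / z) = of_real (1 - 24 * B)" using E2_imaginary_axis[of "1/y" B] AB y by simp
    moreover have "E2 z = of_real (1 - 24 * A)" using E2_imaginary_axis[of y A] AB y by simp
    ultimately show ?thesis unfolding f_def AB(3) using y(1) by (simp add: y(2) power_mult_distrib) (simp add: field_simps)?
  qed
  have lim: "\<i> islimpt U"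
    unfolding islimpt_approachable
  proof (intro allI impI)
    fix e :: real assume "e > 0"
    then have "\<i> * of_real (1 + e / 2) \<in> U \<and> \<i> * of_real (1 + e / 2) \<noteq> \<i> \<and> dist (\<i> * of_real (1 + e / 2)) \<i> < e"
      by (auto simp: U_def dist_norm algebra_simps norm_mult complex_eq_iff)
    then show "\<exists>x'\<in>U. x' \<noteq> \<i> \<and> dist x' \<i> < e" by blast
  qed
  have "f \<tau> = 0"
    by (rule analytic_continuation[OF hol open_upper_half_plane connected_upper_half_plane _ _ lim U0])
      (use assms in \<open>simp_all add: U_def image_subset_iff\<close>)
  then show ?thesis by (simp add: f_def)
qed

text \<open>The law of E2 says that \<open>G\<close> has derivative zero, and its value is read off
  at the fixed point \<open>\<i>\<close>. The factor \<open>- \<i>\<close> keeps the argument of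
  \<open>Ln\<close> in the right half-plane.\<close>

lemma Delta_S:
  assumes "Im \<tau> > 0"
  shows "Delta (- 1 / \<tau>) = \<tau> ^ 12 * Delta \<tau>"
proof -
  define G where "G \<tau> = Deltalog (- 1 / \<tau>) - Deltalog \<tau> - 12 * Ln (- \<i> * \<tau>)" for \<tau>
  have "(G has_field_derivative 0) (at \<tau>)" if "Im \<tau> > 0" for \<tau>
  proof -
    have nz: "\<tau> \<noteq> 0" using that by auto
    have "Im (- 1 / \<tau>) > 0" using Im_moebius_pos[OF Smat_in_SL2Z that] by (simp add: moebius_Smat)
    note 1 = has_field_derivative_Deltalog[OF this]
    have "((\<lambda>\<tau>. - 1 / \<tau>) has_field_derivative 1 / \<tau>\<^sup>2) (at \<tau>)"
      using nz by (auto intro!: derivative_eq_intros simp: power2_eq_square)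
    from DERIV_chain2[OF 1 this]
    have "((\<lambda>\<tau>. Deltalog (- 1 / \<tau>)) has_field_derivative 2 * of_real pi * \<i> * E2 (- 1 / \<tau>) * (1 / \<tau>\<^sup>2)) (at \<tau>)" .
    moreover have "((\<lambda>\<tau>. Ln (- \<i> * \<tau>)) has_field_derivative 1 / \<tau>) (at \<tau>)"
      using that nz by (auto intro!: derivative_eq_intros simp: complex_nonpos_Reals_iff field_simps)
    ultimately have "(G has_field_derivative
       2 * of_real pi * \<i> * E2 (- 1 / \<tau>) * (1 / \<tau>\<^sup>2) - 2 * of_real pi * \<i> * E2 \<tau> - 12 * (1 / \<tau>)) (at \<tau>)"
      unfolding G_def by (intro derivative_intros DERIV_cmult has_field_derivative_Deltalog that)
    also have "2 * of_real pi * \<i> * E2 (- 1 / \<tau>) * (1 / \<tau>\<^sup>2) - 2 * of_real pi * \<i> * E2 \<tau> - 12 * (1 / \<tau>) = 0"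
      unfolding E2_reciprocity[OF that] using nz by (simp add: field_simps power2_eq_square)
    finally show ?thesis .
  qed
  then have "\<exists>c. \<forall>\<tau>\<in>upper_half_plane. G \<tau> = c"
    by (intro has_field_derivative_zero_constant convex_upper_half_plane) (auto intro: has_field_derivative_at_within)
  then have "G \<tau> = G \<i>" using assms by auto
  also have "G \<i> = 0" by (simp add: G_def)
  finally have "Deltalog (- 1 / \<tau>) = 12 * Ln (- \<i> * \<tau>) + Deltalog \<tau>" by (simp add: G_def algebra_simps)
  moreover have "exp (12 * Ln (- \<i> * \<tau>)) = exp (Ln (- \<i> * \<tau>)) ^ 12"
    using exp_of_nat_mult[of 12 "Ln (- \<i> * \<tau>)"] by simp
  moreover have "\<dots> = \<tau> ^ 12" using assms by (subst exp_Ln) (auto simp: power_mult_distrib)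
  ultimately show ?thesis by (simp add: Delta_def exp_add)
qed

lemma Delta_T: "Delta (\<tau> + of_int k) = Delta \<tau>"
proof -
  have "Deltalog (\<tau> + of_int k) = Deltalog \<tau> + 2 * of_real pi * \<i> * of_int k"
    by (simp add: Deltalog_def qexp_add algebra_simps)
  then show ?thesis using qexp_of_int[of k] by (simp add: Delta_def exp_add qexp_def)
qed

text \<open>Euclid's algorithm on the lower row: translation by \<open>d div c\<close> and inversion
  replace \<open>c\<close> by the remainder of \<open>d\<close>. Even weight absorbs the sign of the
  matrix. It serves for weight 12 and for weight 0.\<close>

theorem SL2Z_weight:
  fixes f :: "complex \<Rightarrow> complex"
  assumes w: "even w" and T: "\<And>\<tau>. Im \<tau> > 0 \<Longrightarrow> f (\<tau> + 1) = f \<tau>"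
    and S: "\<And>\<tau>. Im \<tau> > 0 \<Longrightarrow> f (- 1 / \<tau>) = \<tau> ^ w * f \<tau>"
    and "a * d - b * c = 1" "Im \<tau> > 0"
  shows "f (moebius (mat2 a b c d) \<tau>) = (of_int c * \<tau> + of_int d) ^ w * f \<tau>"
  using assms(4,5)
proof (induction "nat \<bar>c\<bar>" arbitrary: a b c d \<tau> rule: less_induct)
  case less
  have T': "f (\<tau> + of_int k) = f \<tau>" if "Im \<tau> > 0" for \<tau> k
  proof -
    have *: "f (\<tau> + of_nat n) = f \<tau>" if "Im \<tau> > 0" for \<tau> n
      by (induction n) (use T[of "\<tau> + of_nat _"] that in \<open>auto simp: algebra_simps\<close>)
    show ?thesis
      using *[of \<tau> "nat k"] *[of "\<tau> + of_int k" "nat (- k)"] that by (cases "k \<ge> 0") auto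
  qed
  show ?case
  proof (cases "c = 0")
    case True
    then have "a * d = 1" using less by simp
    then have "a = 1 \<and> d = 1 \<or> a = -1 \<and> d = -1" by (simp add: zmult_eq_1_iff)
    then show ?thesis
    proof
      assume ad: "a = 1 \<and> d = 1"
      then show ?thesis using True T'[of \<tau> b] less by (simp add: moebius_mat2)
    next
      assume ad: "a = -1 \<and> d = -1"
      then show ?thesis using True T'[of \<tau> "- b"] less w by (simp add: moebius_mat2)
    qed
  next
    case False
    define k where "k = d div c"
    define \<sigma> where "\<sigma> = - 1 / (\<tau> + of_int k)"
    have Imk: "Im (\<tau> + of_int k) > 0" using less by simp
    then have nz: "\<tau> + of_int k \<noteq> 0" by (metis zero_complex.sel(2) less_irrefl)
    have \<sigma>: "Im \<sigma> > 0" using Im_moebius_pos[OF Smat_in_SL2Z Imk] by (simp add: moebius_Smat \<sigma>_def)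
    have "d - k * c = d mod c" by (simp add: k_def minus_div_mult_eq_mod)
    then have "nat \<bar>d - k * c\<bar> < nat \<bar>c\<bar>" using False abs_mod_less[of c d] by simp
    from less(1)[OF this, of "b - k * a" "- c"  "- a" \<sigma>]
    have IH: "f (moebius (mat2 (b - k * a) (- a) (d - k * c) (- c)) \<sigma>) = (of_int (d - k * c) * \<sigma> + of_int (- c)) ^ w * f \<sigma>"
      using less(2) \<sigma> by (simp add: algebra_simps)
    have cancel: "(- x / s) / (- z / s) = x / z" if "s \<noteq> 0" for x z s :: complex
      using that by simp
    have 1: "of_int (b - k * a) * \<sigma> + of_int (- a) = - (of_int a * \<tau> + of_int b) / (\<tau> + of_int k)"
      using nz unfolding \<sigma>_def by (simp add: field_simps)
    have 2: "of_int (d - k * c) * \<sigma> + of_int (- c) = - (of_int c * \<tau> + of_int d) / (\<tau> + of_int k)"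
      using nz unfolding \<sigma>_def by (simp add: field_simps)
    have 3: "moebius (mat2 (b - k * a) (- a) (d - k * c) (- c)) \<sigma> = moebius (mat2 a b c d) \<tau>"
      unfolding moebius_mat2 1 2 by (rule cancel[OF nz])
    have 4: "f \<sigma> = (\<tau> + of_int k) ^ w * f \<tau>"
      unfolding \<sigma>_def using S[OF Imk] T' less by simp
    have cancel12: "(- x / s) ^ w * (s ^ w * D) = x ^ w * D" if "s \<noteq> 0" for x s D :: complex
      using that w by (simp add: power_divide)
    show ?thesis using IH unfolding 2 3 4 cancel12[OF nz] .
  qed
qed

corollary Delta_moebius:
  assumes "a * d - b * c = 1" "Im \<tau> > 0"
  shows "Delta (moebius (mat2 a b c d) \<tau>) = (of_int c * \<tau> + of_int d) ^ 12 * Delta \<tau>"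
  using Delta_S Delta_T[of _ 1] assms by (intro SL2Z_weight) auto

section \<open>The power series of the discriminant\<close>

definition Delta_fps :: "complex fps" where
  "Delta_fps = fps_compose (fps_exp 1) (fps_const (- 24) * log_fps)"

lemma Delta_fps_0 [simp]: "fps_nth Delta_fps 0 = 1" by (simp add: Delta_fps_def)

lemma fps_X_deriv_Delta_fps: "fps_X * fps_deriv Delta_fps = fps_const (- 24) * dsig_fps * Delta_fps"
proof -
  have "fps_deriv Delta_fps = Delta_fps * (fps_const (- 24) * fps_deriv log_fps)"
    unfolding Delta_fps_def by (subst fps_compose_deriv) auto
  then show ?thesis unfolding fps_X_deriv_log_fps[symmetric] by (simp only: mult_ac)
qed

lemma q_fps_Delta: "q_fps (\<lambda>\<tau>. Delta \<tau> / qexp \<tau>) Delta_fps"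
proof -
  have "(exp \<circ> (\<lambda>q. - 24 * eval_fps log_fps q)) has_fps_expansion Delta_fps"
    unfolding Delta_fps_def using conv_radius_log_fps
    by (intro has_fps_expansion_compose fps_expansion_intros eval_fps_has_fps_expansion) (auto intro: order_less_le_trans[of 0 1])
  moreover have "eventually (\<lambda>\<tau>. Delta \<tau> / qexp \<tau> = (exp \<circ> (\<lambda>q. - 24 * eval_fps log_fps q)) (qexp \<tau>)) at_ii"
    by (simp add: Delta_def Deltalog_def exp_diff qexp_def exp_minus inverse_eq_divide)
  ultimately show ?thesis unfolding q_fps_def by blast
qed

lemma fps_nth_compose_fps_X_power:
  fixes F :: "complex fps"
  assumes "p > 0"
  shows "fps_nth (F oo fps_X ^ p) n = (if p dvd n then fps_nth F (n div p) else 0)"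
proof -
  have "fps_nth (F oo fps_X ^ p) n = (\<Sum>i=0..n. if n = p * i then fps_nth F i else 0)"
    unfolding fps_compose_nth by (intro sum.cong refl) (simp flip: power_mult)
  also have "\<dots> = (\<Sum>i=0..n. if i = n div p then (if p dvd n then fps_nth F (n div p) else 0) else 0)"
    using assms by (intro sum.cong refl) auto
  also have "\<dots> = (if p dvd n then fps_nth F (n div p) else 0)" by (auto simp: sum.delta)
  finally show ?thesis .
qed

lemma q_fps_divide_qexp:
  assumes "q_fps f F" "fps_nth F 0 = 0"
  shows "q_fps (\<lambda>\<tau>. f \<tau> / qexp \<tau>) (fps_shift 1 F)"
\<comment> \<open>The zero series has subdegree 0, so the shift rule does not cover it.\<close>
proof (cases "F = 0")
  case True
  then have "q_fps f 0" using assms by simp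
  then obtain g where "g has_fps_expansion 0" "eventually (\<lambda>\<tau>. f \<tau> = g (qexp \<tau>)) at_ii"
    unfolding q_fps_def by blast
  moreover from this have "eventually (\<lambda>z. g z = 0) (nhds 0)" by (simp add: has_fps_expansion_0_iff)
  then have "eventually (\<lambda>\<tau>. g (qexp \<tau>) = 0) at_ii"
    using tendsto_qexp by (rule eventually_compose_filterlim)
  ultimately have "eventually (\<lambda>\<tau>. f \<tau> / qexp \<tau> = 0) at_ii" by (auto elim: eventually_elim2)
  then have "q_fps (\<lambda>\<tau>. f \<tau> / qexp \<tau>) 0" unfolding q_fps_def by (intro exI[of _ "\<lambda>_. 0"]) auto
  then show ?thesis using True by simp
next
  case False
  then have "1 \<le> subdegree F" using assms(2) by (intro subdegree_geI) auto
  obtain g where g: "g has_fps_expansion F" "eventually (\<lambda>\<tau>. f \<tau> = g (qexp \<tau>)) at_ii"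
    using assms unfolding q_fps_def by blast
  define g' where "g' x = (if x = 0 then fps_nth F 1 else g x / x ^ 1)" for x
  have "g' has_fps_expansion fps_shift 1 F"
    unfolding g'_def by (rule has_fps_expansion_shift[OF g(1) \<open>1 \<le> subdegree F\<close> refl])
  moreover have "eventually (\<lambda>\<tau>. f \<tau> / qexp \<tau> = g' (qexp \<tau>)) at_ii"
    using g(2) by eventually_elim (simp add: g'_def)
  ultimately show ?thesis unfolding q_fps_def by blast
qed

section \<open>Hauptmoduln of prime level\<close>

text \<open>Since \<open>F\<close> expands \<open>q * f\<close>, the coefficient of \<open>q ^ n\<close> in \<open>f\<close> is \<open>fps_nth F (n + 1)\<close>.\<close>

definition haupt :: "nat \<Rightarrow> (complex \<Rightarrow> complex) \<Rightarrow> complex fps \<Rightarrow> bool" where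
  "haupt N f F \<longleftrightarrow> N > 0 \<and> f holomorphic_on upper_half_plane \<and>
     (\<forall>A\<in>Gamma0 N. \<forall>\<tau>. Im \<tau> > 0 \<longrightarrow> f (moebius A \<tau>) = f \<tau>) \<and>
     (\<forall>A\<in>SL2Z - Gamma0 N. \<exists>K. q_fps (\<lambda>\<tau>. f (moebius A (of_nat N * \<tau>))) K) \<and>
     q_fps (\<lambda>\<tau>. qexp \<tau> * f \<tau>) F \<and> fps_nth F 0 = 1 \<and> fps_nth F 1 = 0"

text \<open>From \<open>a * c' = a' * c\<close> and the coprimality of \<open>a'\<close> and
  \<open>c'\<close> it follows that \<open>c'\<close> divides \<open>c\<close>. This turns "cusp not
  equivalent to \<infinity>" into "\<open>A\<close> outside \<open>Gamma0 N\<close>".\<close>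

lemma orbit_None_imp_Gamma0:
  assumes "A \<in> SL2Z" "moebius_ext A None \<in> orbit_ext N None"
  shows "A \<in> Gamma0 N"
proof -
  obtain a b c d where A: "A = mat2 a b c d" "a * d - b * c = 1" using assms(1) by (rule SL2Z_cases)
  obtain B where B: "B \<in> Gamma0 N" "moebius_ext A None = moebius_ext B None"
    using assms(2) by (auto simp: orbit_ext_def)
  obtain a' b' c' d' where B': "B = mat2 a' b' c' d'" "a' * d' - b' * c' = 1" "int N dvd c'"
    using B(1) by (rule Gamma0_cases)
  have "int N dvd c"
  proof (cases "c = 0")
    case False
    then have "c' \<noteq> 0" "of_int a / of_int c = (of_int a' / of_int c' :: complex)"
      using B(2) unfolding A B' by (auto split: if_splits)
    then have "of_int (a * c') = (of_int (a' * c) :: complex)" using False by (simp add: field_simps)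
    then have "a * c' = a' * c" by (simp only: of_int_eq_iff)
    then have "c' dvd a' * c" by (metis dvd_triv_right)
    moreover have "c = d' * (a' * c) - c * b' * c'"
      using arg_cong[OF B'(2), of "\<lambda>x. c * x"] by (simp add: algebra_simps)
    ultimately have "c' dvd c" by (metis dvd_diff dvd_mult dvd_triv_right)
    then show ?thesis using B'(3) dvd_trans by blast
  qed simp
  then show ?thesis using A by (simp add: mat2_in_Gamma0)
qed

text \<open>Uniqueness of expansions transfers the normalisation from the coefficients promised by
  the definition to the given ones, later the traces.\<close>

lemma haupt_intro:
  assumes "normalized_hauptmodul N f" "has_q_expansion 1 (-1) a f" "N > 0"
  shows "haupt N f (Abs_fps (\<lambda>k. a (int k - 1)))"
proof -
  obtain b where b: "has_q_expansion 1 (-1) b f" "b (-1) = 1" "b 0 = 0"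
    using assms(1) unfolding normalized_hauptmodul_def by blast
  have "Abs_fps (\<lambda>k. a (int k - 1)) = Abs_fps (\<lambda>k. b (int k - 1))"
    by (rule q_fps_unique[OF has_q_expansion_imp_q_fps[OF assms(2)] has_q_expansion_imp_q_fps[OF b(1)]])
  then have "fps_nth (Abs_fps (\<lambda>k. a (int k - 1))) 0 = 1 \<and> fps_nth (Abs_fps (\<lambda>k. a (int k - 1))) 1 = 0"
    by (simp only: fps_nth_Abs_fps) (simp add: b)
  moreover have "\<exists>K. q_fps (\<lambda>\<tau>. f (moebius A (of_nat N * \<tau>))) K" if A: "A \<in> SL2Z" "A \<notin> Gamma0 N" for A
  proof -
    obtain k where "has_q_expansion N 0 k (f \<circ> moebius A)"
      using assms(1) A orbit_None_imp_Gamma0[of A N] unfolding normalized_hauptmodul_def by blast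
    from has_q_expansion_imp_q_fps_cusp[OF this assms(3)] show ?thesis by auto
  qed
  ultimately show ?thesis
    using assms has_q_expansion_imp_q_fps[OF assms(2)]
    unfolding haupt_def normalized_hauptmodul_def modular_function_def by auto
qed

section \<open>Behaviour at the cusps\<close>

lemma filterlim_at_ii_div: "n > 0 \<Longrightarrow> filterlim (\<lambda>\<tau>. \<tau> / of_nat n) at_ii at_ii"
  using filterlim_at_ii_affine[of "1 / real n" 0] by simp

lemma filterlim_at_ii_add: "filterlim (\<lambda>\<tau>. \<tau> + s) at_ii at_ii"
  using filterlim_at_ii_affine[of 1 s] by simp

lemma haupt_tendsto_cusp:
  assumes "haupt N f F" "A \<in> SL2Z" "A \<notin> Gamma0 N"
  obtains l where "((\<lambda>\<tau>. f (moebius A \<tau>)) \<longlongrightarrow> l) at_ii"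
proof -
  have N: "N > 0" using assms by (simp add: haupt_def)
  obtain K where "q_fps (\<lambda>\<tau>. f (moebius A (of_nat N * \<tau>))) K" using assms unfolding haupt_def by blast
  from filterlim_compose[OF q_fps_tendsto[OF this] filterlim_at_ii_div[OF N]]
  have "((\<lambda>\<tau>. f (moebius A \<tau>)) \<longlongrightarrow> fps_nth K 0) at_ii" using N by simp
  then show ?thesis using that by blast
qed

lemma haupt_inv: "haupt N f F \<Longrightarrow> A \<in> Gamma0 N \<Longrightarrow> Im \<tau> > 0 \<Longrightarrow> f (moebius A \<tau>) = f \<tau>"
  by (simp add: haupt_def)

lemma haupt_translate: "haupt N f F \<Longrightarrow> Im \<tau> > 0 \<Longrightarrow> f (\<tau> + of_int k) = f \<tau>"
  using haupt_inv[of N f F "Tmat k" \<tau>] by (simp add: moebius_Tmat)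

lemma haupt_pole: "haupt N f F \<Longrightarrow> ((\<lambda>\<tau>. f \<tau> - 1 / qexp \<tau>) \<longlongrightarrow> 0) at_ii"
proof -
  assume a: "haupt N f F"
  then have "q_fps (\<lambda>\<tau>. qexp \<tau> * f \<tau> - 1) (F - 1)"
    using q_fps_const[of 1] unfolding haupt_def by (intro q_fps_diff) auto
  then have "q_fps (\<lambda>\<tau>. (qexp \<tau> * f \<tau> - 1) / qexp \<tau>) (fps_shift 1 (F - 1))"
    using a by (intro q_fps_divide_qexp) (auto simp: haupt_def)
  from q_fps_tendsto[OF this] a show ?thesis by (simp add: haupt_def diff_divide_distrib)
qed

text \<open>A prime level has only the cusps \<infinity> and 0: \<open>c\<close> is invertible
  modulo \<open>p\<close>, so some \<open>k\<close> makes \<open>d - k * c\<close> divisible by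
  \<open>p\<close>, and \<open>A\<close> factors through \<open>Smat\<close> and a
  translation.\<close>

lemma prime_level_cusp:
  assumes "prime p" "A \<in> SL2Z" "A \<notin> Gamma0 p"
  obtains B k where "B \<in> Gamma0 p" "\<And>\<tau>. Im \<tau> > 0 \<Longrightarrow> moebius A \<tau> = moebius B (- 1 / (\<tau> + of_int k))"
proof -
  obtain a b c d where A: "A = mat2 a b c d" "a * d - b * c = 1" using assms(2) by (rule SL2Z_cases)
  have "\<not> int p dvd c" using assms A by (auto simp: mat2_in_Gamma0)
  then have "coprime c (int p)" using assms(1) prime_imp_coprime[of "int p" c] by (simp add: coprime_commute)
  then obtain x where x: "[c * x = 1] (mod int p)" using cong_solve_coprime_int by blast
  define k where "k = d * x"
  have "[d - k * c = d - d * 1] (mod int p)"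
    unfolding k_def mult.assoc mult.commute[of x c] by (intro cong_diff cong_mult x cong_refl)
  then have dvd: "int p dvd d - k * c" by (simp add: cong_0_iff)
  define B where "B = mat2 (k * a - b) a (k * c - d) c"
  have "B \<in> Gamma0 p" unfolding B_def mat2_in_Gamma0 using A(2) dvd
    by (auto simp: algebra_simps dvd_diff_commute)
  moreover have "moebius A \<tau> = moebius B (- 1 / (\<tau> + of_int k))" if "Im \<tau> > 0" for \<tau>
  proof -
    have nz: "\<tau> + of_int k \<noteq> 0" using denom_nonzero[of \<tau> 1 k] that by simp
    have 1: "of_int (k * a - b) * (- 1 / (\<tau> + of_int k)) + of_int a = (of_int a * \<tau> + of_int b) / (\<tau> + of_int k)"
      using nz by (simp add: field_simps)
    have 2: "of_int (k * c - d) * (- 1 / (\<tau> + of_int k)) + of_int c = (of_int c * \<tau> + of_int d) / (\<tau> + of_int k)"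
      using nz by (simp add: field_simps)
    show ?thesis unfolding A B_def moebius_mat2 1 2 using nz by simp
  qed
  ultimately show ?thesis using that by blast
qed

lemma Im_S: "Im \<tau> > 0 \<Longrightarrow> Im (- 1 / \<tau>) > 0"
  using Im_moebius_pos[OF Smat_in_SL2Z] by (simp add: moebius_Smat)

text \<open>All cusps other than \<infinity> are equivalent to 0, so one limit replaces all
  boundedness conditions.\<close>

lemma prime_liouville:
  assumes p: "prime p" and hol: "f holomorphic_on upper_half_plane"
    and inv: "\<And>A \<tau>. A \<in> Gamma0 p \<Longrightarrow> Im \<tau> > 0 \<Longrightarrow> f (moebius A \<tau>) = f \<tau>"
    and lim0: "((\<lambda>\<tau>. f (- 1 / \<tau>)) \<longlongrightarrow> l) at_ii"
    and lim: "(f \<longlongrightarrow> 0) at_ii" and \<tau>: "Im \<tau> > 0"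
  shows "f \<tau> = 0"
proof (rule Gamma0_liouville[OF _ hol inv _ lim \<tau>, of p])
  show "p > 0" using p prime_gt_0_nat by blast
  fix A assume A: "A \<in> SL2Z" "A \<notin> Gamma0 p"
  obtain B k where B: "B \<in> Gamma0 p" "\<And>\<tau>. Im \<tau> > 0 \<Longrightarrow> moebius A \<tau> = moebius B (- 1 / (\<tau> + of_int k))"
    using p A by (rule prime_level_cusp) blast
  have "((\<lambda>\<tau>. f (- 1 / (\<tau> + of_int k))) \<longlongrightarrow> l) at_ii"
    using filterlim_compose[OF lim0 filterlim_at_ii_add] .
  moreover have "eventually (\<lambda>\<tau>. f (- 1 / (\<tau> + of_int k)) = f (moebius A \<tau>)) at_ii"
    using eventually_at_ii_Im_gt[of 0]
  proof eventually_elim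
    case (elim \<tau>)
    then have "Im (- 1 / (\<tau> + of_int k)) > 0" by (intro Im_S) simp
    then show ?case using B elim inv by simp
  qed
  ultimately have "((\<lambda>\<tau>. f (moebius A \<tau>)) \<longlongrightarrow> l) at_ii" by (rule Lim_transform_eventually)
  then show "bdd_ii (\<lambda>\<tau>. f (moebius A \<tau>))" by (rule bdd_ii_tendsto)
qed auto

text \<open>\<open>\<Delta>(\<tau>) / \<Delta>(p \<tau>)\<close> is a unit at level \<open>p\<close>: it has its only pole at \<open>\<infinity>\<close> and its only zero at \<open>0\<close>,
  both of order \<open>p - 1\<close>.\<close>

definition Dquot :: "nat \<Rightarrow> complex \<Rightarrow> complex" where
  "Dquot p \<tau> = Delta \<tau> / Delta (of_nat p * \<tau>)"

lemma Dquot_nonzero [simp]: "Dquot p \<tau> \<noteq> 0" by (simp add: Dquot_def)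

lemma holomorphic_Delta_mult: "p > 0 \<Longrightarrow> (\<lambda>\<tau>. Delta (of_nat p * \<tau>)) holomorphic_on upper_half_plane"
  using holomorphic_on_compose_gen[OF _ holomorphic_Delta, of "\<lambda>\<tau>. of_nat p * \<tau>" upper_half_plane]
  by (simp add: o_def image_subset_iff holomorphic_intros)

lemma holomorphic_Dquot: "p > 0 \<Longrightarrow> Dquot p holomorphic_on upper_half_plane"
  unfolding Dquot_def by (intro holomorphic_intros holomorphic_Delta holomorphic_Delta_mult) auto

lemma Dquot_inv:
  assumes "p > 0" "A \<in> Gamma0 p" "Im \<tau> > 0"
  shows "Dquot p (moebius A \<tau>) = Dquot p \<tau>"
proof -
  obtain a b c d where A: "A = mat2 a b c d" "a * d - b * c = 1" "int p dvd c" using assms(2) by (rule Gamma0_cases)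
  then obtain c' where c': "c = int p * c'" by (elim dvdE)
  have nz: "of_int c * \<tau> + of_int d \<noteq> 0" using assms A by (intro denom_nonzero) auto
  have "of_nat p * moebius A \<tau> = moebius (mat2 a (int p * b) c' d) (of_nat p * \<tau>)"
    unfolding A moebius_mat2 c' by (simp add: algebra_simps)
  moreover have "Delta (moebius (mat2 a (int p * b) c' d) (of_nat p * \<tau>)) = (of_int c * \<tau> + of_int d) ^ 12 * Delta (of_nat p * \<tau>)"
    using A(2) assms by (subst Delta_moebius) (auto simp: c' mult_ac)
  ultimately show ?thesis unfolding Dquot_def using A Delta_moebius[OF A(2) assms(3)] nz by simp
qed

text \<open>The Fricke involution interchanges \<open>Delta \<tau>\<close> and
  \<open>Delta (p \<tau>)\<close> up to elementary factors and so inverts the quotient. It moves the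
  cusp 0 to \<infinity>.\<close>

lemma Dquot_S:
  assumes "p > 0" "Im \<tau> > 0"
  shows "Dquot p (- 1 / (of_nat p * \<tau>)) = of_nat p ^ 12 / Dquot p \<tau>"
proof -
  have "Delta (- 1 / (of_nat p * \<tau>)) = (of_nat p * \<tau>) ^ 12 * Delta (of_nat p * \<tau>)" using assms by (intro Delta_S) simp
  moreover have "of_nat p * (- 1 / (of_nat p * \<tau>)) = - 1 / \<tau>" using assms by simp
  moreover have "Delta (- 1 / \<tau>) = \<tau> ^ 12 * Delta \<tau>" using assms by (intro Delta_S)
  moreover have "\<tau> \<noteq> 0" using assms by auto
  ultimately show ?thesis unfolding Dquot_def by (simp add: power_mult_distrib)
qed

definition Delta_mult_fps :: "nat \<Rightarrow> complex fps" where "Delta_mult_fps p = Delta_fps oo fps_X ^ p"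

lemma Delta_mult_fps_0 [simp]: "p > 0 \<Longrightarrow> fps_nth (Delta_mult_fps p) 0 = 1" by (simp add: Delta_mult_fps_def fps_nth_compose_fps_X_power)

lemma q_fps_Delta_mult: "p > 0 \<Longrightarrow> q_fps (\<lambda>\<tau>. Delta (of_nat p * \<tau>) / qexp \<tau> ^ p) (Delta_mult_fps p)"
  unfolding Delta_mult_fps_def using q_fps_compose_mult[OF q_fps_Delta, of p] by (simp add: qexp_mult_of_nat)

text \<open>With \<open>c\<close> the value at 0, \<open>f - c\<close> has a simple pole at
  \<infinity> and vanishes at 0, so its power \<open>p - 1\<close> divided by the zero-free
  \<open>Dquot p\<close> tends to 1 at \<infinity> and stays bounded at 0. Hence it is 1.\<close>

theorem haupt_prime_identity:
  assumes p: "prime p" and f: "haupt p f F"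
  obtains c where "((\<lambda>\<tau>. f (- 1 / \<tau>)) \<longlongrightarrow> c) at_ii"
    "(F - fps_const c * fps_X) ^ (p - 1) * Delta_mult_fps p = Delta_fps"
proof -
  have p0: "p > 0" "p \<ge> 2" using p prime_gt_0_nat prime_ge_2_nat by auto
  have "Smat \<in> SL2Z - Gamma0 p" using p by (auto simp: Smat_def mat2_in_Gamma0 mat2_in_SL2Z)
  then obtain K where "q_fps (\<lambda>\<tau>. f (moebius Smat (of_nat p * \<tau>))) K"
    using f unfolding haupt_def by blast
  then have K: "q_fps (\<lambda>\<tau>. f (- 1 / (of_nat p * \<tau>))) K" by (simp add: moebius_Smat)
  define c where "c = fps_nth K 0"
  from filterlim_compose[OF q_fps_tendsto[OF K] filterlim_at_ii_div[OF p0(1)]]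
  have lim: "((\<lambda>\<tau>. f (- 1 / \<tau>)) \<longlongrightarrow> c) at_ii" using p0 by (simp add: c_def)
  have K': "q_fps (\<lambda>\<tau>. (f (- 1 / (of_nat p * \<tau>)) - c) / qexp \<tau>) (fps_shift 1 (K - fps_const c))"
    by (intro q_fps_divide_qexp q_fps_diff K q_fps_const) (simp add: c_def)
  define u where "u \<tau> = (f \<tau> - c) ^ (p - 1) / Dquot p \<tau> - 1" for \<tau>
  have hol: "u holomorphic_on upper_half_plane"
    unfolding u_def using f p0 by (intro holomorphic_intros holomorphic_Dquot) (auto simp: haupt_def)
  have inv: "u (moebius A \<tau>) = u \<tau>" if "A \<in> Gamma0 p" "Im \<tau> > 0" for A \<tau>
    unfolding u_def using that haupt_inv[OF f] Dquot_inv[OF p0(1)] by simp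
  have F: "q_fps (\<lambda>\<tau>. qexp \<tau> * f \<tau> - c * qexp \<tau>) (F - fps_const c * fps_X)"
    using f unfolding haupt_def by (intro q_fps_diff q_fps_mult) auto
  have u1: "q_fps (\<lambda>\<tau>. (qexp \<tau> * f \<tau> - c * qexp \<tau>) ^ (p - 1) * (Delta (of_nat p * \<tau>) / qexp \<tau> ^ p) * inverse (Delta \<tau> / qexp \<tau>))
     ((F - fps_const c * fps_X) ^ (p - 1) * Delta_mult_fps p * inverse Delta_fps)"
    by (intro q_fps_mult q_fps_power F q_fps_Delta_mult q_fps_inverse q_fps_Delta p0) simp
  have eq: "(qexp \<tau> * f \<tau> - c * qexp \<tau>) ^ (p - 1) * (Delta (of_nat p * \<tau>) / qexp \<tau> ^ p) * inverse (Delta \<tau> / qexp \<tau>) = u \<tau> + 1" for \<tau>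
  proof -
    have "qexp \<tau> * f \<tau> - c * qexp \<tau> = qexp \<tau> * (f \<tau> - c)" by (simp add: algebra_simps)
    moreover have "qexp \<tau> ^ p = qexp \<tau> * qexp \<tau> ^ (p - 1)" using p0 by (simp flip: power_Suc)
    ultimately show ?thesis by (simp add: u_def Dquot_def power_mult_distrib)
  qed
  have "((\<lambda>\<tau>. u \<tau> + 1) \<longlongrightarrow> 1) at_ii"
    using q_fps_tendsto[OF u1] p0 f unfolding eq by (simp add: haupt_def fps_power_zeroth)
  then have lim0: "(u \<longlongrightarrow> 0) at_ii" using tendsto_diff[OF _ tendsto_const[of 1], of "\<lambda>\<tau>. u \<tau> + 1" 1] by simp
  \<comment> \<open>Up to the factor \<open>p ^ 12\<close>, \<open>w\<close> is \<open>u + 1\<close>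
    after the Fricke involution, with each factor normalised to a power series in q.\<close>
  define w where "w \<tau> = ((f (- 1 / (of_nat p * \<tau>)) - c) / qexp \<tau>) ^ (p - 1) * (Delta \<tau> / qexp \<tau>) * inverse (Delta (of_nat p * \<tau>) / qexp \<tau> ^ p)" for \<tau>
  have "q_fps w ((fps_shift 1 (K - fps_const c)) ^ (p - 1) * Delta_fps * inverse (Delta_mult_fps p))"
    unfolding w_def using p0 by (intro q_fps_mult q_fps_power K' q_fps_Delta_mult q_fps_inverse q_fps_Delta p0) simp
  from filterlim_compose[OF q_fps_tendsto[OF this] filterlim_at_ii_div[OF p0(1)]]
  obtain l where l: "((\<lambda>\<tau>. w (\<tau> / of_nat p)) \<longlongrightarrow> l) at_ii" by blast
  then have "((\<lambda>\<tau>. w (\<tau> / of_nat p) / of_nat p ^ 12 - 1) \<longlongrightarrow> l / of_nat p ^ 12 - 1) at_ii"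
    by (intro tendsto_intros) (use p0 in auto)
  moreover have "eventually (\<lambda>\<tau>. w (\<tau> / of_nat p) / of_nat p ^ 12 - 1 = u (- 1 / \<tau>)) at_ii"
    using eventually_at_ii_Im_gt[of 0]
  proof eventually_elim
    case (elim \<tau>)
    define \<sigma> where "\<sigma> = \<tau> / of_nat p"
    have \<sigma>: "\<tau> = of_nat p * \<sigma>" "Im \<sigma> > 0" using p0 elim by (auto simp: \<sigma>_def)
    have "qexp \<sigma> ^ p = qexp \<sigma> * qexp \<sigma> ^ (p - 1)" using p0 by (simp flip: power_Suc)
    then have "w \<sigma> = (f (- 1 / (of_nat p * \<sigma>)) - c) ^ (p - 1) * Dquot p \<sigma>"
      by (simp add: w_def Dquot_def power_divide)
    then show ?case unfolding \<sigma>_def[symmetric] u_def \<sigma>(1) Dquot_S[OF p0(1) \<sigma>(2)] using p0 by simp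
  qed
  ultimately have lim1: "((\<lambda>\<tau>. u (- 1 / \<tau>)) \<longlongrightarrow> l / of_nat p ^ 12 - 1) at_ii"
    by (rule Lim_transform_eventually)
  have u0: "u \<tau> = 0" if "Im \<tau> > 0" for \<tau>
    by (rule prime_liouville[OF p hol inv lim1 lim0 that])
  have "eventually (\<lambda>\<tau>. u \<tau> + 1 = 1) at_ii"
    using eventually_at_ii_Im_gt[of 0] by eventually_elim (simp add: u0)
  with u1 have "q_fps (\<lambda>\<tau>. 1) ((F - fps_const c * fps_X) ^ (p - 1) * Delta_mult_fps p * inverse Delta_fps)"
    unfolding eq by (rule q_fps_cong)
  moreover have "q_fps (\<lambda>\<tau>. 1) 1" using q_fps_const[of 1] by simp
  ultimately have "(F - fps_const c * fps_X) ^ (p - 1) * Delta_mult_fps p * inverse Delta_fps = 1" by (rule q_fps_unique)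
  then have "(F - fps_const c * fps_X) ^ (p - 1) * Delta_mult_fps p * (inverse Delta_fps * Delta_fps) = Delta_fps"
    by (simp flip: mult.assoc)
  then have "(F - fps_const c * fps_X) ^ (p - 1) * Delta_mult_fps p = Delta_fps"
    by (simp add: inverse_mult_eq_1)
  then show ?thesis using lim that by blast
qed

lemma fps_X_deriv_Delta_mult_fps:
  assumes "p > 0"
  shows "fps_X * fps_deriv (Delta_mult_fps p) = fps_const (- 24 * of_nat p) * (dsig_fps oo fps_X ^ p) * Delta_mult_fps p"
proof -
  have c0: "fps_nth ((fps_X :: complex fps) ^ p) 0 = 0" using assms by simp
  have "fps_X * fps_deriv (Delta_mult_fps p) = (fps_deriv Delta_fps oo fps_X ^ p) * (fps_const (of_nat p) * (fps_X * fps_X ^ (p - 1)))"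
    unfolding Delta_mult_fps_def by (subst fps_compose_deriv[OF c0]) (simp add: fps_deriv_power mult_ac)
  also have "fps_X * fps_X ^ (p - 1) = (fps_X :: complex fps) ^ p" using assms by (simp flip: power_Suc)
  also have "(fps_deriv Delta_fps oo fps_X ^ p) * (fps_const (of_nat p) * fps_X ^ p) =
      fps_const (of_nat p) * ((fps_X * fps_deriv Delta_fps) oo fps_X ^ p)"
    by (simp add: fps_compose_mult_distrib[OF c0] fps_X_fps_compose_startby0[OF c0] mult_ac)
  also have "\<dots> = fps_const (of_nat p) * (fps_const (- 24) * (dsig_fps oo fps_X ^ p) * Delta_mult_fps p)"
    unfolding fps_X_deriv_Delta_fps Delta_mult_fps_def by (simp add: fps_compose_mult_distrib[OF c0])
  finally show ?thesis by (simp add: mult_ac flip: fps_const_mult)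
qed

text \<open>The logarithmic derivative of \<open>\<Delta>(\<tau>) / \<Delta>(p \<tau>)\<close> is \<open>- 24\<close> times this series.\<close>

definition dsig_level_fps :: "nat \<Rightarrow> complex fps" where
  "dsig_level_fps p = dsig_fps - fps_const (of_nat p) * (dsig_fps oo fps_X ^ p)"

lemma dsig_level_fps_nth: "p > 0 \<Longrightarrow> fps_nth (dsig_level_fps p) n = of_nat (dsig n) - (if p dvd n then of_nat (p * dsig (n div p)) else 0)"
  by (simp add: dsig_level_fps_def dsig_fps_def fps_nth_compose_fps_X_power)

text \<open>Differentiating the product and cancelling \<open>Y ^ (p - 2) * Delta_mult_fps p\<close>
  gives the logarithmic derivative of a root of order \<open>p - 1\<close> without extracting
  it.\<close>

lemma prime_log_deriv:
  assumes p: "p \<ge> 2" and Y: "Y ^ (p - 1) * Delta_mult_fps p = Delta_fps"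
  shows "fps_X * fps_deriv Y = fps_const (- 24 / (of_nat p - 1)) * dsig_level_fps p * Y"
proof -
  define k where "k = p - 2"
  have k: "p - 1 = Suc k" "of_nat (Suc k) = (of_nat p - 1 :: complex)" using p by (auto simp: k_def of_nat_diff)
  have "Delta_fps \<noteq> 0" using Delta_fps_0 by (metis fps_zero_nth zero_neq_one)
  then have nz: "Y \<noteq> 0" "Delta_mult_fps p \<noteq> 0" using Y unfolding k(1) by auto
  have "fps_X * fps_deriv (Y ^ Suc k * Delta_mult_fps p) =
      fps_const (of_nat (Suc k)) * (fps_X * fps_deriv Y) * Y ^ k * Delta_mult_fps p + Y ^ Suc k * (fps_X * fps_deriv (Delta_mult_fps p))"
    by (simp only: fps_deriv_mult fps_deriv_power diff_Suc_1) (simp add: algebra_simps)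
  also have "fps_X * fps_deriv (Y ^ Suc k * Delta_mult_fps p) = fps_const (- 24) * dsig_fps * (Y ^ Suc k * Delta_mult_fps p)"
    using fps_X_deriv_Delta_fps Y k by simp
  finally have "(Y ^ k * Delta_mult_fps p) * (fps_const (of_nat (Suc k)) * (fps_X * fps_deriv Y)) =
      (Y ^ k * Delta_mult_fps p) * (Y * fps_const (- 24) * (dsig_fps - fps_const (of_nat p) * (dsig_fps oo fps_X ^ p)))"
    using p by (simp add: fps_X_deriv_Delta_mult_fps algebra_simps)
  then have "fps_const (of_nat (Suc k)) * (fps_X * fps_deriv Y) = Y * fps_const (- 24) * dsig_level_fps p"
    unfolding dsig_level_fps_def using nz by (subst (asm) mult_left_cancel) auto
  then have "fps_const (1 / of_nat (Suc k)) * (fps_const (of_nat (Suc k)) * (fps_X * fps_deriv Y)) = fps_const (1 / of_nat (Suc k)) * (Y * fps_const (- 24) * dsig_level_fps p)"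
    by simp
  then show ?thesis unfolding mult.assoc[symmetric] fps_const_mult
    by (simp add: k(2)[symmetric] mult_ac del: of_nat_Suc)
qed

lemma fps_log_deriv_rec:
  fixes Y :: "complex fps"
  assumes "fps_X * fps_deriv Y = fps_const c * S * Y" "fps_nth S 0 = 0"
  shows "of_nat (Suc n) * fps_nth Y (Suc n) = c * (\<Sum>k\<le>n. fps_nth S (Suc k) * fps_nth Y (n - k))"
proof -
  have "of_nat (Suc n) * fps_nth Y (Suc n) = fps_nth (fps_X * fps_deriv Y) (Suc n)" by simp
  also have "\<dots> = c * fps_nth (S * Y) (Suc n)"
    unfolding assms(1) by (simp add: mult.assoc)
  also have "fps_nth (S * Y) (Suc n) = (\<Sum>k\<le>Suc n. fps_nth S k * fps_nth Y (Suc n - k))"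
    by (simp only: fps_mult_nth atLeast0AtMost)
  also have "(\<Sum>k\<le>Suc n. fps_nth S k * fps_nth Y (Suc n - k)) = (\<Sum>k\<le>n. fps_nth S (Suc k) * fps_nth Y (n - k))"
    using assms(2) by (subst sum.atMost_Suc_shift) simp
  finally show ?thesis .
qed

section \<open>Coefficients at level one and at prime levels\<close>

lemma dsig_code: "n > 0 \<Longrightarrow> dsig n = sum_list (filter (\<lambda>d. d dvd n) [1..<Suc n])"
proof -
  assume "n > 0"
  then have "{d. d dvd n} = set (filter (\<lambda>d. d dvd n) [1..<Suc n])"
    using dvd_imp_le by (auto simp: Suc_le_eq intro!: Nat.gr0I)
  then show ?thesis unfolding dsig_def by (simp add: sum_list_distinct_conv_sum_set[of _ "\<lambda>x. x", simplified])
qed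

lemma dsig_values:
  "dsig (Suc 0) = 1"
  "dsig 2 = 3"
  "dsig 3 = 4"
  "dsig 4 = 7"
  "dsig 5 = 6"
  "dsig 6 = 12"
  "dsig 7 = 8"
  "dsig 8 = 15"
  "dsig 9 = 13"
  "dsig 10 = 18"
  by (subst dsig_code, simp, code_simp)+

lemma sum_atMost_numeral:
  fixes f :: "nat \<Rightarrow> 'a :: comm_monoid_add"
  shows
  "(\<Sum>k\<le>Suc 0. f k) = f 0 + f (Suc 0)"
  "(\<Sum>k\<le>2. f k) = f 0 + f (Suc 0) + f 2"
  "(\<Sum>k\<le>3. f k) = f 0 + f (Suc 0) + f 2 + f 3"
  "(\<Sum>k\<le>4. f k) = f 0 + f (Suc 0) + f 2 + f 3 + f 4"
  "(\<Sum>k\<le>5. f k) = f 0 + f (Suc 0) + f 2 + f 3 + f 4 + f 5"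
  "(\<Sum>k\<le>6. f k) = f 0 + f (Suc 0) + f 2 + f 3 + f 4 + f 5 + f 6"
  "(\<Sum>k\<le>7. f k) = f 0 + f (Suc 0) + f 2 + f 3 + f 4 + f 5 + f 6 + f 7"
  "(\<Sum>k\<le>8. f k) = f 0 + f (Suc 0) + f 2 + f 3 + f 4 + f 5 + f 6 + f 7 + f 8"
  "(\<Sum>k\<le>9. f k) = f 0 + f (Suc 0) + f 2 + f 3 + f 4 + f 5 + f 6 + f 7 + f 8 + f 9"
  by (simp_all add: eval_nat_numeral add.assoc)

text \<open>For \<open>p > 2\<close> the level does not affect the first two divisor sums, so both
  coefficients depend on \<open>p\<close> through \<open>c\<close> alone. This permits an argument
  uniform in \<open>p\<close>.\<close>

lemma log_deriv_coeff_1_2: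
  fixes Y :: "complex fps"
  assumes "fps_X * fps_deriv Y = fps_const c * dsig_level_fps p * Y" "p > 2" "fps_nth Y 0 = 1"
  shows "fps_nth Y (Suc 0) = c" "fps_nth Y 2 = c * (c + 3) / 2"
proof -
  have p: "p > 0" "\<not> p dvd Suc 0" "\<not> p dvd 2" using assms(2) by (auto dest: dvd_imp_le)
  note rec = fps_log_deriv_rec[OF assms(1)]
  have s: "fps_nth (dsig_level_fps p) 0 = 0" "fps_nth (dsig_level_fps p) (Suc 0) = 1" "fps_nth (dsig_level_fps p) 2 = 3"
    using p by (simp_all add: dsig_level_fps_nth dsig_values)
  show 1: "fps_nth Y (Suc 0) = c" using rec[OF s(1), of 0] assms(3) s by simp
  show "fps_nth Y 2 = c * (c + 3) / 2"
    using rec[OF s(1), of 1] assms(3) s 1 by (simp add: sum_atMost_numeral flip: numeral_2_eq_2) (simp add: field_simps)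
qed

text \<open>Each coefficient is fed into the recursion for the next. Index \<open>n\<close> belongs
  to \<open>q ^ (n - 1)\<close> of the Hauptmodul; the tables reach as far as the functionals used
  later.\<close>

lemma log_deriv_coeffs_2:
  fixes Y :: "complex fps"
  assumes "fps_X * fps_deriv Y = fps_const (- 24) * dsig_level_fps 2 * Y" "fps_nth Y 0 = 1"
  shows "fps_nth Y (Suc 0) = - 24" "fps_nth Y 2 = 276" "fps_nth Y 3 = - 2048" "fps_nth Y 4 = 11202" "fps_nth Y 5 = - 49152" "fps_nth Y 6 = 184024"
proof -
  have s: "fps_nth (dsig_level_fps 2) 0 = 0" "fps_nth (dsig_level_fps 2) (Suc 0) = 1" "fps_nth (dsig_level_fps 2) 2 = 1" "fps_nth (dsig_level_fps 2) 3 = 4" "fps_nth (dsig_level_fps 2) 4 = 1" "fps_nth (dsig_level_fps 2) 5 = 6" "fps_nth (dsig_level_fps 2) 6 = 4"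
    by (simp_all add: dsig_level_fps_nth dsig_values)
  note rec = fps_log_deriv_rec[OF assms(1) s(1)]
  show 1: "fps_nth Y (Suc 0) = - 24"
    using rec[of 0] by (simp add: sum_atMost_numeral s assms(2) flip: numeral_2_eq_2)
  show 2: "fps_nth Y 2 = 276"
    using rec[of 1] by (simp add: sum_atMost_numeral s assms(2) 1 flip: numeral_2_eq_2)
  show 3: "fps_nth Y 3 = - 2048"
    using rec[of 2] by (simp add: sum_atMost_numeral s assms(2) 1 2 flip: numeral_2_eq_2)
  show 4: "fps_nth Y 4 = 11202"
    using rec[of 3] by (simp add: sum_atMost_numeral s assms(2) 1 2 3 flip: numeral_2_eq_2)
  show 5: "fps_nth Y 5 = - 49152"
    using rec[of 4] by (simp add: sum_atMost_numeral s assms(2) 1 2 3 4 flip: numeral_2_eq_2)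
  show 6: "fps_nth Y 6 = 184024"
    using rec[of 5] by (simp add: sum_atMost_numeral s assms(2) 1 2 3 4 5 flip: numeral_2_eq_2)
qed

text \<open>This is for the reciprocal quotient \<open>Delta (2 \<tau>) / Delta \<tau>\<close>. The
  ninth coefficient is needed because that of \<open>q ^ 5\<close> in J refers to index
  \<open>2 * 5 - 1\<close>.\<close>

lemma log_deriv_coeffs_2_inverse:
  fixes Y :: "complex fps"
  assumes "fps_X * fps_deriv Y = fps_const 24 * dsig_level_fps 2 * Y" "fps_nth Y 0 = 1"
  shows "fps_nth Y (Suc 0) = 24" "fps_nth Y 2 = 300" "fps_nth Y 3 = 2624" "fps_nth Y 4 = 18126" "fps_nth Y 5 = 105504" "fps_nth Y 6 = 538296" "fps_nth Y 7 = 2471424" "fps_nth Y 8 = 10400997" "fps_nth Y 9 = 40674128"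
proof -
  have s: "fps_nth (dsig_level_fps 2) 0 = 0" "fps_nth (dsig_level_fps 2) (Suc 0) = 1" "fps_nth (dsig_level_fps 2) 2 = 1" "fps_nth (dsig_level_fps 2) 3 = 4" "fps_nth (dsig_level_fps 2) 4 = 1" "fps_nth (dsig_level_fps 2) 5 = 6" "fps_nth (dsig_level_fps 2) 6 = 4" "fps_nth (dsig_level_fps 2) 7 = 8" "fps_nth (dsig_level_fps 2) 8 = 1" "fps_nth (dsig_level_fps 2) 9 = 13"
    by (simp_all add: dsig_level_fps_nth dsig_values)
  note rec = fps_log_deriv_rec[OF assms(1) s(1)]
  show 1: "fps_nth Y (Suc 0) = 24"
    using rec[of 0] by (simp add: sum_atMost_numeral s assms(2) flip: numeral_2_eq_2)
  show 2: "fps_nth Y 2 = 300"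
    using rec[of 1] by (simp add: sum_atMost_numeral s assms(2) 1 flip: numeral_2_eq_2)
  show 3: "fps_nth Y 3 = 2624"
    using rec[of 2] by (simp add: sum_atMost_numeral s assms(2) 1 2 flip: numeral_2_eq_2)
  show 4: "fps_nth Y 4 = 18126"
    using rec[of 3] by (simp add: sum_atMost_numeral s assms(2) 1 2 3 flip: numeral_2_eq_2)
  show 5: "fps_nth Y 5 = 105504"
    using rec[of 4] by (simp add: sum_atMost_numeral s assms(2) 1 2 3 4 flip: numeral_2_eq_2)
  show 6: "fps_nth Y 6 = 538296"
    using rec[of 5] by (simp add: sum_atMost_numeral s assms(2) 1 2 3 4 5 flip: numeral_2_eq_2)
  show 7: "fps_nth Y 7 = 2471424"
    using rec[of 6] by (simp add: sum_atMost_numeral s assms(2) 1 2 3 4 5 6 flip: numeral_2_eq_2)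
  show 8: "fps_nth Y 8 = 10400997"
    using rec[of 7] by (simp add: sum_atMost_numeral s assms(2) 1 2 3 4 5 6 7 flip: numeral_2_eq_2)
  show 9: "fps_nth Y 9 = 40674128"
    using rec[of 8] by (simp add: sum_atMost_numeral s assms(2) 1 2 3 4 5 6 7 8 flip: numeral_2_eq_2)
qed

lemma log_deriv_coeffs_3:
  fixes Y :: "complex fps"
  assumes "fps_X * fps_deriv Y = fps_const (- 12) * dsig_level_fps 3 * Y" "fps_nth Y 0 = 1"
  shows "fps_nth Y (Suc 0) = - 12" "fps_nth Y 2 = 54" "fps_nth Y 3 = - 76" "fps_nth Y 4 = - 243"
proof -
  have s: "fps_nth (dsig_level_fps 3) 0 = 0" "fps_nth (dsig_level_fps 3) (Suc 0) = 1" "fps_nth (dsig_level_fps 3) 2 = 3" "fps_nth (dsig_level_fps 3) 3 = 1" "fps_nth (dsig_level_fps 3) 4 = 7"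
    by (simp_all add: dsig_level_fps_nth dsig_values)
  note rec = fps_log_deriv_rec[OF assms(1) s(1)]
  show 1: "fps_nth Y (Suc 0) = - 12"
    using rec[of 0] by (simp add: sum_atMost_numeral s assms(2) flip: numeral_2_eq_2)
  show 2: "fps_nth Y 2 = 54"
    using rec[of 1] by (simp add: sum_atMost_numeral s assms(2) 1 flip: numeral_2_eq_2)
  show 3: "fps_nth Y 3 = - 76"
    using rec[of 2] by (simp add: sum_atMost_numeral s assms(2) 1 2 flip: numeral_2_eq_2)
  show 4: "fps_nth Y 4 = - 243"
    using rec[of 3] by (simp add: sum_atMost_numeral s assms(2) 1 2 3 flip: numeral_2_eq_2)
qed

lemma log_deriv_coeffs_5:
  fixes Y :: "complex fps"
  assumes "fps_X * fps_deriv Y = fps_const (- 6) * dsig_level_fps 5 * Y" "fps_nth Y 0 = 1"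
  shows "fps_nth Y (Suc 0) = - 6" "fps_nth Y 2 = 9" "fps_nth Y 3 = 10" "fps_nth Y 4 = - 30"
proof -
  have s: "fps_nth (dsig_level_fps 5) 0 = 0" "fps_nth (dsig_level_fps 5) (Suc 0) = 1" "fps_nth (dsig_level_fps 5) 2 = 3" "fps_nth (dsig_level_fps 5) 3 = 4" "fps_nth (dsig_level_fps 5) 4 = 7"
    by (simp_all add: dsig_level_fps_nth dsig_values)
  note rec = fps_log_deriv_rec[OF assms(1) s(1)]
  show 1: "fps_nth Y (Suc 0) = - 6"
    using rec[of 0] by (simp add: sum_atMost_numeral s assms(2) flip: numeral_2_eq_2)
  show 2: "fps_nth Y 2 = 9"
    using rec[of 1] by (simp add: sum_atMost_numeral s assms(2) 1 flip: numeral_2_eq_2)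
  show 3: "fps_nth Y 3 = 10"
    using rec[of 2] by (simp add: sum_atMost_numeral s assms(2) 1 2 flip: numeral_2_eq_2)
  show 4: "fps_nth Y 4 = - 30"
    using rec[of 3] by (simp add: sum_atMost_numeral s assms(2) 1 2 3 flip: numeral_2_eq_2)
qed

lemma log_deriv_coeffs_7:
  fixes Y :: "complex fps"
  assumes "fps_X * fps_deriv Y = fps_const (- 4) * dsig_level_fps 7 * Y" "fps_nth Y 0 = 1"
  shows "fps_nth Y (Suc 0) = - 4" "fps_nth Y 2 = 2"
proof -
  have s: "fps_nth (dsig_level_fps 7) 0 = 0" "fps_nth (dsig_level_fps 7) (Suc 0) = 1" "fps_nth (dsig_level_fps 7) 2 = 3"
    by (simp_all add: dsig_level_fps_nth dsig_values)
  note rec = fps_log_deriv_rec[OF assms(1) s(1)]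
  show 1: "fps_nth Y (Suc 0) = - 4"
    using rec[of 0] by (simp add: sum_atMost_numeral s assms(2) flip: numeral_2_eq_2)
  show 2: "fps_nth Y 2 = 2"
    using rec[of 1] by (simp add: sum_atMost_numeral s assms(2) 1 flip: numeral_2_eq_2)
qed

lemma log_deriv_coeffs_13:
  fixes Y :: "complex fps"
  assumes "fps_X * fps_deriv Y = fps_const (- 2) * dsig_level_fps 13 * Y" "fps_nth Y 0 = 1"
  shows "fps_nth Y (Suc 0) = - 2" "fps_nth Y 2 = - 1" "fps_nth Y 3 = 2" "fps_nth Y 4 = 1" "fps_nth Y 5 = 2" "fps_nth Y 6 = - 2"
proof -
  have s: "fps_nth (dsig_level_fps 13) 0 = 0" "fps_nth (dsig_level_fps 13) (Suc 0) = 1" "fps_nth (dsig_level_fps 13) 2 = 3" "fps_nth (dsig_level_fps 13) 3 = 4" "fps_nth (dsig_level_fps 13) 4 = 7" "fps_nth (dsig_level_fps 13) 5 = 6" "fps_nth (dsig_level_fps 13) 6 = 12"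
    by (simp_all add: dsig_level_fps_nth dsig_values)
  note rec = fps_log_deriv_rec[OF assms(1) s(1)]
  show 1: "fps_nth Y (Suc 0) = - 2"
    using rec[of 0] by (simp add: sum_atMost_numeral s assms(2) flip: numeral_2_eq_2)
  show 2: "fps_nth Y 2 = - 1"
    using rec[of 1] by (simp add: sum_atMost_numeral s assms(2) 1 flip: numeral_2_eq_2)
  show 3: "fps_nth Y 3 = 2"
    using rec[of 2] by (simp add: sum_atMost_numeral s assms(2) 1 2 flip: numeral_2_eq_2)
  show 4: "fps_nth Y 4 = 1"
    using rec[of 3] by (simp add: sum_atMost_numeral s assms(2) 1 2 3 flip: numeral_2_eq_2)
  show 5: "fps_nth Y 5 = 2"
    using rec[of 4] by (simp add: sum_atMost_numeral s assms(2) 1 2 3 4 flip: numeral_2_eq_2)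
  show 6: "fps_nth Y 6 = - 2"
    using rec[of 5] by (simp add: sum_atMost_numeral s assms(2) 1 2 3 4 5 flip: numeral_2_eq_2)
qed


section \<open>The expansion of J obtained from level two\<close>

definition Dquot_2_fps :: "complex fps" where "Dquot_2_fps = Delta_fps * inverse (Delta_mult_fps 2)"

lemma Dquot_2_fps_0 [simp]: "fps_nth Dquot_2_fps 0 = 1" by (simp add: Dquot_2_fps_def)

lemma q_fps_Dquot_2: "q_fps (\<lambda>\<tau>. qexp \<tau> * Dquot 2 \<tau>) Dquot_2_fps"
proof -
  have "q_fps (\<lambda>\<tau>. Delta \<tau> / qexp \<tau> * inverse (Delta (of_nat 2 * \<tau>) / qexp \<tau> ^ 2)) Dquot_2_fps"
    unfolding Dquot_2_fps_def by (intro q_fps_mult q_fps_Delta q_fps_inverse q_fps_Delta_mult) auto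
  then show ?thesis
    by (rule q_fps_cong) (simp add: Dquot_def power2_eq_square)
qed

lemma Dquot_2_fps_log_deriv: "fps_X * fps_deriv Dquot_2_fps = fps_const (- 24) * dsig_level_fps 2 * Dquot_2_fps"
proof -
  have "Dquot_2_fps ^ (2 - 1) * Delta_mult_fps 2 = Delta_fps" by (simp add: Dquot_2_fps_def mult.assoc inverse_mult_eq_1)
  from prime_log_deriv[OF _ this] show ?thesis by simp
qed

lemma inverse_Dquot_2_fps_log_deriv: "fps_X * fps_deriv (inverse Dquot_2_fps) = fps_const 24 * dsig_level_fps 2 * inverse Dquot_2_fps"
proof -
  have "fps_X * fps_deriv (inverse Dquot_2_fps) = - (fps_X * fps_deriv Dquot_2_fps) * (inverse Dquot_2_fps)\<^sup>2"
    by (subst fps_inverse_deriv) (auto simp: mult_ac)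
  also have "\<dots> = fps_const 24 * dsig_level_fps 2 * inverse Dquot_2_fps * (inverse Dquot_2_fps * Dquot_2_fps)"
    unfolding Dquot_2_fps_log_deriv by (simp add: power2_eq_square mult_ac) (simp flip: fps_const_neg)
  also have "inverse Dquot_2_fps * Dquot_2_fps = 1" by (rule inverse_mult_eq_1) simp
  finally show ?thesis by simp
qed

lemma q_fps_inverse_Dquot_2: "q_fps (\<lambda>\<tau>. 1 / Dquot 2 \<tau>) (fps_X * inverse Dquot_2_fps)"
proof -
  have "q_fps (\<lambda>\<tau>. qexp \<tau> * inverse (qexp \<tau> * Dquot 2 \<tau>)) (fps_X * inverse Dquot_2_fps)"
    by (intro q_fps_mult q_fps_qexp q_fps_inverse q_fps_Dquot_2) simp
  then show ?thesis by (simp add: inverse_eq_divide)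
qed

lemma qexp_half: "qexp (1 / 2) = - 1"
  by (simp add: qexp_def)

text \<open>\<open>Gamma0 2\<close> has index 3, and the two generators of the modular group permute
  the three summands. Only the first has a pole at \<infinity>; its constant term - 24 explains the
  correction.\<close>

theorem level_one_identity:
  assumes f: "haupt 1 f F" and \<tau>: "Im \<tau> > 0"
  shows "f \<tau> = Dquot 2 \<tau> + Dquot 2 (- 1 / \<tau>) + Dquot 2 (- 1 / (\<tau> + 1)) + 24"
proof -
  define t where "t = Dquot 2"
  define g where "g \<tau> = t \<tau> + t (- 1 / \<tau>) + t (- 1 / (\<tau> + 1))" for \<tau>
  have tinv: "t ((of_int a * \<tau> + of_int b) / (of_int c * \<tau> + of_int d)) = t \<tau>"
    if "a * d - b * c = 1" "even c" "Im \<tau> > 0" for a b c d \<tau>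
    using Dquot_inv[of 2 "mat2 a b c d" \<tau>] that by (simp add: t_def mat2_in_Gamma0 moebius_mat2)
  have nz: "\<tau> \<noteq> 0" "\<tau> + 1 \<noteq> 0" "\<tau> + 2 \<noteq> 0" "\<tau> - 1 \<noteq> 0" if "Im \<tau> > 0" for \<tau> :: complex
    using that by (auto simp: complex_eq_iff)
  have gT: "g (\<tau> + 1) = g \<tau>" if \<tau>: "Im \<tau> > 0" for \<tau>
  proof -
    have "t (\<tau> + 1) = t \<tau>" using tinv[of 1 1 1 0 \<tau>] \<tau> by simp
    moreover have "t ((of_int 1 * (- 1 / \<tau>) + of_int 0) / (of_int (- 2) * (- 1 / \<tau>) + of_int 1)) = t (- 1 / \<tau>)"
      using Im_S[OF \<tau>] by (intro tinv) auto
    moreover have "(of_int 1 * (- 1 / \<tau>) + of_int 0) / (of_int (- 2) * (- 1 / \<tau>) + of_int 1) = - 1 / (\<tau> + 1 + 1)"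
      using nz[OF \<tau>] by (simp add: field_simps)
    ultimately show ?thesis by (simp add: g_def)
  qed
  have gS: "g (- 1 / \<tau>) = g \<tau>" if \<tau>: "Im \<tau> > 0" for \<tau>
  proof -
    define \<sigma> where "\<sigma> = - 1 / (\<tau> + 1)"
    have "Im \<sigma> > 0" unfolding \<sigma>_def using \<tau> by (intro Im_S) simp
    then have "t ((of_int (- 1) * \<sigma> + of_int (- 1)) / (of_int 2 * \<sigma> + of_int 1)) = t \<sigma>"
      by (intro tinv) auto
    moreover have "(of_int (- 1) * \<sigma> + of_int (- 1)) / (of_int 2 * \<sigma> + of_int 1) = - 1 / (- 1 / \<tau> + 1)"
    proof -
      have a: "of_int (- 1) * \<sigma> + of_int (- 1) = - \<tau> / (\<tau> + 1)" "of_int 2 * \<sigma> + of_int 1 = (\<tau> - 1) / (\<tau> + 1)"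
        using nz[OF \<tau>] unfolding \<sigma>_def by (simp_all add: field_simps)
      have "- 1 / \<tau> + 1 = (\<tau> - 1) / \<tau>" using nz[OF \<tau>] by (simp add: field_simps)
      then show ?thesis unfolding a using nz[OF \<tau>] by simp
    qed
    ultimately show ?thesis using nz[OF \<tau>] by (simp add: g_def \<sigma>_def)
  qed
  have hol_t: "t holomorphic_on upper_half_plane" unfolding t_def by (intro holomorphic_Dquot) simp
  have hol_g: "g holomorphic_on upper_half_plane"
  proof -
    have "(t \<circ> (\<lambda>\<tau>. - 1 / \<tau>)) holomorphic_on upper_half_plane"
      by (rule holomorphic_on_compose_gen[OF _ hol_t]) (use Im_S in \<open>auto intro!: holomorphic_intros\<close>)
    moreover have "(t \<circ> (\<lambda>\<tau>. - 1 / (\<tau> + 1))) holomorphic_on upper_half_plane"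
      by (rule holomorphic_on_compose_gen[OF _ hol_t]) (use Im_S nz in \<open>auto intro!: holomorphic_intros\<close>)
    ultimately show ?thesis unfolding g_def using hol_t by (intro holomorphic_intros) (simp_all add: o_def)
  qed
  have lim_t: "((\<lambda>\<tau>. t \<tau> - 1 / qexp \<tau>) \<longlongrightarrow> - 24) at_ii"
  proof -
    have "q_fps (\<lambda>\<tau>. (qexp \<tau> * t \<tau> - 1) / qexp \<tau>) (fps_shift 1 (Dquot_2_fps - 1))"
      unfolding t_def using q_fps_diff[OF q_fps_Dquot_2 q_fps_const[of 1]]
      by (intro q_fps_divide_qexp) auto
    from q_fps_tendsto[OF this] show ?thesis
      using log_deriv_coeffs_2(1)[OF Dquot_2_fps_log_deriv] by (simp add: diff_divide_distrib)
  qed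
  \<comment> \<open>By the Fricke involution \<open>t (- 1 / \<tau>)\<close> is
    \<open>2 ^ 12 / t (\<tau> / 2)\<close>, and \<open>1 / t\<close> vanishes at
    \<infinity>.\<close>
  have lim_S: "((\<lambda>\<tau>. t (- 1 / \<tau>)) \<longlongrightarrow> 0) at_ii"
  proof -
    have "((\<lambda>\<tau>. 2 ^ 12 * (1 / t (\<tau> / of_nat 2))) \<longlongrightarrow> 2 ^ 12 * fps_nth (fps_X * inverse Dquot_2_fps) 0) at_ii"
      unfolding t_def
      by (intro tendsto_intros filterlim_compose[OF q_fps_tendsto[OF q_fps_inverse_Dquot_2] filterlim_at_ii_div]) simp
    moreover have "eventually (\<lambda>\<tau>. 2 ^ 12 * (1 / t (\<tau> / of_nat 2)) = t (- 1 / \<tau>)) at_ii"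
      using eventually_at_ii_Im_gt[of 0]
      by eventually_elim (use Dquot_S[of 2 "_ / 2"] in \<open>simp add: t_def\<close>)
    ultimately show ?thesis using Lim_transform_eventually by fastforce
  qed
  have lim_S1: "((\<lambda>\<tau>. t (- 1 / (\<tau> + 1))) \<longlongrightarrow> 0) at_ii"
    using filterlim_compose[OF lim_S filterlim_at_ii_add] .
  define h where "h \<tau> = f \<tau> - g \<tau> - 24" for \<tau>
  have G1: "Gamma0 1 = SL2Z" by (auto simp: Gamma0_def)
  have "((\<lambda>\<tau>. (f \<tau> - 1 / qexp \<tau>) - (t \<tau> - 1 / qexp \<tau>) - t (- 1 / \<tau>) - t (- 1 / (\<tau> + 1)) - 24) \<longlongrightarrow> 0 - (- 24) - 0 - 0 - 24) at_ii"
    by (intro tendsto_diff haupt_pole[OF f] lim_t lim_S lim_S1 tendsto_const)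
  then have lim_h: "(h \<longlongrightarrow> 0) at_ii" by (simp add: h_def[abs_def] g_def algebra_simps)
  have "h \<tau> = 0"
  proof (rule Gamma0_liouville[OF _ _ _ _ lim_h \<tau>, of 1])
    show "h holomorphic_on upper_half_plane"
      unfolding h_def using hol_g f by (intro holomorphic_intros) (auto simp: haupt_def)
    fix A \<tau> assume A: "A \<in> Gamma0 1" "Im \<tau> > 0"
    obtain a b c d where A': "A = mat2 a b c d" "a * d - b * c = 1" using A(1) unfolding G1 by (rule SL2Z_cases)
    have "g (moebius A \<tau>) = g \<tau>"
      unfolding A'(1) using SL2Z_weight[of 0 g, OF _ gT _ A'(2) A(2)] gS by simp
    then show "h (moebius A \<tau>) = h \<tau>" using haupt_inv[OF f A] by (simp add: h_def)
  qed (auto simp: G1 G1[unfolded One_nat_def])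
  then show ?thesis by (simp add: h_def g_def t_def algebra_simps)
qed

text \<open>Passing to \<open>2 \<tau>\<close> removes fractional powers of q. The two conjugates
  become \<open>4096 / Dquot 2\<close> at \<tau> and at \<tau> + 1/2; their sum kills odd powers and
  doubles even ones, whence 8192.\<close>

theorem level_one_coeffs:
  assumes f: "haupt 1 f F" and m: "m > 0"
  shows "fps_nth F (Suc m) = fps_nth Dquot_2_fps (Suc m) + 8192 * fps_nth (inverse Dquot_2_fps) (2 * m - 1)"
proof -
  define Z where "Z = fps_X * inverse Dquot_2_fps"
  define c where "c = qexp (1 / 2)"
  have L: "q_fps (\<lambda>\<tau>. qexp (of_nat 2 * \<tau>) * f (of_nat 2 * \<tau>)) (F oo fps_X ^ 2)"
    using q_fps_compose_mult[of "\<lambda>\<tau>. qexp \<tau> * f \<tau>" F 2] f by (simp add: haupt_def)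
  have R: "q_fps (\<lambda>\<tau>. qexp (of_nat 2 * \<tau>) * Dquot 2 (of_nat 2 * \<tau>) +
        qexp \<tau> ^ 2 * (4096 * (1 / Dquot 2 \<tau>) + 4096 * (1 / Dquot 2 (\<tau> + 1 / 2)) + 24))
      ((Dquot_2_fps oo fps_X ^ 2) + fps_X ^ 2 * (fps_const 4096 * Z + fps_const 4096 * (Z oo (fps_const c * fps_X)) + fps_const 24))"
    unfolding Z_def c_def
    by (intro q_fps_add q_fps_mult q_fps_power q_fps_qexp q_fps_const q_fps_inverse_Dquot_2
        q_fps_translate[OF q_fps_inverse_Dquot_2] q_fps_compose_mult[OF q_fps_Dquot_2]) simp
  have "eventually (\<lambda>\<tau>. qexp (of_nat 2 * \<tau>) * f (of_nat 2 * \<tau>) = qexp (of_nat 2 * \<tau>) * Dquot 2 (of_nat 2 * \<tau>) +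
        qexp \<tau> ^ 2 * (4096 * (1 / Dquot 2 \<tau>) + 4096 * (1 / Dquot 2 (\<tau> + 1 / 2)) + 24)) at_ii"
    using eventually_at_ii_Im_gt[of 0]
  proof eventually_elim
    case (elim \<tau>)
    have "Dquot 2 (- 1 / (of_nat 2 * \<tau>)) = 4096 * (1 / Dquot 2 \<tau>)" using Dquot_S[of 2 \<tau>] elim by simp
    moreover have "Dquot 2 (- 1 / (of_nat 2 * \<tau> + 1)) = 4096 * (1 / Dquot 2 (\<tau> + 1 / 2))"
      using Dquot_S[of 2 "\<tau> + 1 / 2"] elim by (simp add: distrib_left)
    moreover have "f (of_nat 2 * \<tau>) = Dquot 2 (of_nat 2 * \<tau>) + Dquot 2 (- 1 / (of_nat 2 * \<tau>)) + Dquot 2 (- 1 / (of_nat 2 * \<tau> + 1)) + 24"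
      using elim by (intro level_one_identity[OF f]) simp
    moreover have "qexp (of_nat 2 * \<tau>) = qexp \<tau> ^ 2" by (rule qexp_mult_of_nat)
    ultimately show ?case by (simp add: algebra_simps)
  qed
  from q_fps_unique[OF q_fps_cong[OF L this] R]
  have "fps_nth (F oo fps_X ^ 2) (2 * Suc m) = fps_nth (Dquot_2_fps oo fps_X ^ 2) (2 * Suc m) +
     fps_nth (fps_const 4096 * Z + fps_const 4096 * (Z oo (fps_const c * fps_X)) + fps_const 24) (2 * m)"
    by (simp add: fps_X_power_mult_nth)
  then have "fps_nth F (Suc m) = fps_nth Dquot_2_fps (Suc m) + (4096 * fps_nth Z (2 * m) + 4096 * (c ^ (2 * m) * fps_nth Z (2 * m)))"
    using m by (simp add: fps_nth_compose_fps_X_power del: mult_Suc_right)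
  moreover have "c ^ (2 * m) = 1" unfolding c_def qexp_half by simp
  moreover have "fps_nth Z (2 * m) = fps_nth (inverse Dquot_2_fps) (2 * m - 1)" using m by (simp add: Z_def)
  ultimately show ?thesis by simp
qed

corollary level_one_values:
  assumes f: "haupt 1 f F"
  shows "fps_nth F 2 = 196884" "fps_nth F 3 = 21493760" "fps_nth F 4 = 864299970" "fps_nth F 6 = 333202640600"
  using level_one_coeffs[OF f, of 1] level_one_coeffs[OF f, of 2] level_one_coeffs[OF f, of 3] level_one_coeffs[OF f, of 5]
    log_deriv_coeffs_2[OF Dquot_2_fps_log_deriv] log_deriv_coeffs_2_inverse[OF inverse_Dquot_2_fps_log_deriv]
  by (simp_all flip: numeral_2_eq_2)

text \<open>The recursion gives \<open>- 24 / (p - 1)\<close> as the constant term of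
  \<open>f - c\<close>. As \<open>f\<close> has none, this determines the value \<open>c\<close> at
  the cusp 0.\<close>

theorem haupt_prime_log_deriv:
  assumes p: "prime p" and f: "haupt p f F"
  obtains Y where "fps_X * fps_deriv Y = fps_const (- 24 / (of_nat p - 1)) * dsig_level_fps p * Y" "fps_nth Y 0 = 1"
    "\<And>n. n \<noteq> 1 \<Longrightarrow> fps_nth F n = fps_nth Y n"
    "((\<lambda>\<tau>. f (- 1 / \<tau>)) \<longlongrightarrow> 24 / (of_nat p - 1)) at_ii"
proof -
  obtain c where c: "((\<lambda>\<tau>. f (- 1 / \<tau>)) \<longlongrightarrow> c) at_ii"
    "(F - fps_const c * fps_X) ^ (p - 1) * Delta_mult_fps p = Delta_fps"
    using haupt_prime_identity[OF p f] .
  define Y where "Y = F - fps_const c * fps_X"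
  have p2: "p \<ge> 2" using p prime_ge_2_nat by blast
  have Y: "fps_X * fps_deriv Y = fps_const (- 24 / (of_nat p - 1)) * dsig_level_fps p * Y"
    using prime_log_deriv[OF p2] c(2) unfolding Y_def .
  have Y0: "fps_nth Y 0 = 1" using f by (simp add: Y_def haupt_def)
  have "\<not> p dvd Suc 0" using p2 by auto
  then have s: "fps_nth (dsig_level_fps p) 0 = 0" "fps_nth (dsig_level_fps p) (Suc 0) = 1" using p2 by (simp_all add: dsig_level_fps_nth dsig_values)
  have "fps_nth Y 1 = - 24 / (of_nat p - 1)" using fps_log_deriv_rec[OF Y s(1), of 0] s Y0 by simp
  moreover have "fps_nth Y 1 = - c" using f by (simp add: Y_def haupt_def)
  ultimately have "c = 24 / (of_nat p - 1)" by (simp add: minus_equation_iff)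
  moreover have "fps_nth F n = fps_nth Y n" if "n \<noteq> 1" for n using that by (simp add: Y_def)
  ultimately show ?thesis using that Y Y0 c(1) by blast
qed

lemma haupt_prime_coeff_2:
  assumes "prime p" "p > 2" "haupt p f F"
  shows "fps_nth F 2 = 12 * (24 / (of_nat p - 1) - 3) / (of_nat p - 1)"
proof -
  obtain Y where Y: "fps_X * fps_deriv Y = fps_const (- 24 / (of_nat p - 1)) * dsig_level_fps p * Y" "fps_nth Y 0 = 1"
    "\<And>n. n \<noteq> 1 \<Longrightarrow> fps_nth F n = fps_nth Y n" using haupt_prime_log_deriv[OF assms(1,3)] by metis
  define m :: complex where "m = of_nat p - 1"
  have nz: "m \<noteq> 0" unfolding m_def using assms(2) by (metis of_nat_1 of_nat_eq_iff eq_iff_diff_eq_0 less_numeral_extra(4) one_less_numeral_iff order_less_trans semiring_norm(76))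
  have "(- 24 / m) * (- 24 / m + 3) / 2 = 12 * (24 / m - 3) / m" using nz by (simp add: field_simps)
  then show ?thesis using log_deriv_coeff_1_2(2)[OF Y(1) assms(2) Y(2)] Y(3)[of 2]
    unfolding m_def[symmetric] by simp
qed

lemma haupt_2_values:
  assumes "haupt 2 f F"
  shows "fps_nth F 2 = 276" "fps_nth F 3 = - 2048" "fps_nth F 4 = 11202" "fps_nth F 6 = 184024"
proof -
  have "prime (2 :: nat)" by simp
  then obtain Y where "fps_X * fps_deriv Y = fps_const (- 24 / (of_nat 2 - 1)) * dsig_level_fps 2 * Y" "fps_nth Y 0 = 1"
    and F: "\<And>n. n \<noteq> 1 \<Longrightarrow> fps_nth F n = fps_nth Y n" using haupt_prime_log_deriv[OF _ assms] by metis
  then have Y: "fps_X * fps_deriv Y = fps_const (- 24) * dsig_level_fps 2 * Y" "fps_nth Y 0 = 1" by simp_all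
  show "fps_nth F 2 = 276" "fps_nth F 3 = - 2048" "fps_nth F 4 = 11202" "fps_nth F 6 = 184024"
    using log_deriv_coeffs_2[OF Y(1,2)] by (simp_all add: F)
qed

lemma haupt_3_values:
  assumes "haupt 3 f F"
  shows "fps_nth F 2 = 54" "fps_nth F 4 = - 243"
proof -
  have "prime (3 :: nat)" by simp
  then obtain Y where "fps_X * fps_deriv Y = fps_const (- 24 / (of_nat 3 - 1)) * dsig_level_fps 3 * Y" "fps_nth Y 0 = 1"
    and F: "\<And>n. n \<noteq> 1 \<Longrightarrow> fps_nth F n = fps_nth Y n" using haupt_prime_log_deriv[OF _ assms] by metis
  then have Y: "fps_X * fps_deriv Y = fps_const (- 12) * dsig_level_fps 3 * Y" "fps_nth Y 0 = 1" by simp_all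
  show "fps_nth F 2 = 54" "fps_nth F 4 = - 243"
    using log_deriv_coeffs_3[OF Y(1,2)] by (simp_all add: F)
qed

lemma haupt_5_values:
  assumes "haupt 5 f F"
  shows "fps_nth F 3 = 10" "fps_nth F 4 = - 30"
proof -
  have "prime (5 :: nat)" by simp
  then obtain Y where "fps_X * fps_deriv Y = fps_const (- 24 / (of_nat 5 - 1)) * dsig_level_fps 5 * Y" "fps_nth Y 0 = 1"
    and F: "\<And>n. n \<noteq> 1 \<Longrightarrow> fps_nth F n = fps_nth Y n" using haupt_prime_log_deriv[OF _ assms] by metis
  then have Y: "fps_X * fps_deriv Y = fps_const (- 6) * dsig_level_fps 5 * Y" "fps_nth Y 0 = 1" by simp_all
  show "fps_nth F 3 = 10" "fps_nth F 4 = - 30"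
    using log_deriv_coeffs_5[OF Y(1,2)] by (simp_all add: F)
qed

lemma haupt_7_values:
  assumes "haupt 7 f F"
  shows "fps_nth F 2 = 2"
proof -
  have "prime (7 :: nat)" by simp
  then obtain Y where "fps_X * fps_deriv Y = fps_const (- 24 / (of_nat 7 - 1)) * dsig_level_fps 7 * Y" "fps_nth Y 0 = 1"
    and F: "\<And>n. n \<noteq> 1 \<Longrightarrow> fps_nth F n = fps_nth Y n" using haupt_prime_log_deriv[OF _ assms] by metis
  then have Y: "fps_X * fps_deriv Y = fps_const (- 4) * dsig_level_fps 7 * Y" "fps_nth Y 0 = 1" by simp_all
  show "fps_nth F 2 = 2"
    using log_deriv_coeffs_7[OF Y(1,2)] by (simp_all add: F)
qed

lemma haupt_13_values:
  assumes "haupt 13 f F"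
  shows "fps_nth F 3 = 2" "fps_nth F 6 = - 2"
proof -
  have "prime (13 :: nat)" by simp
  then obtain Y where "fps_X * fps_deriv Y = fps_const (- 24 / (of_nat 13 - 1)) * dsig_level_fps 13 * Y" "fps_nth Y 0 = 1"
    and F: "\<And>n. n \<noteq> 1 \<Longrightarrow> fps_nth F n = fps_nth Y n" using haupt_prime_log_deriv[OF _ assms] by metis
  then have Y: "fps_X * fps_deriv Y = fps_const (- 2) * dsig_level_fps 13 * Y" "fps_nth Y 0 = 1" by simp_all
  show "fps_nth F 3 = 2" "fps_nth F 6 = - 2"
    using log_deriv_coeffs_13[OF Y(1,2)] by (simp_all add: F)
qed

section \<open>Averages over translations\<close>

text \<open>The matrix is \<open>B\<close> in \<open>SL2Z\<close> times an upper triangular one with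
  positive diagonal \<open>g\<close>, \<open>D'\<close>, which preserves the approach to
  \<infinity>. The first column of \<open>B\<close> is the cusp \<open>a / c\<close> in lowest
  terms.\<close>

lemma haupt_cusp_limit:
  assumes f: "haupt N f F" and D: "a * d - b * c > 0" and nd: "\<not> int N dvd c div gcd a c"
  obtains l where "((\<lambda>\<tau>. f ((of_int a * \<tau> + of_int b) / (of_int c * \<tau> + of_int d))) \<longlongrightarrow> l) at_ii"
proof -
  define g where "g = gcd a c"
  have g: "g > 0" using D by (auto simp: g_def)
  define a' c' where "a' = a div g" and "c' = c div g"
  have ac: "a = g * a'" "c = g * c'" by (simp_all add: a'_def c'_def g_def)
  have "coprime a' c'" using g unfolding a'_def c'_def g_def by (intro div_gcd_coprime) auto
  then obtain u v where uv: "u * a' + v * c' = 1" using bezout_int[of a' c'] by (auto simp: coprime_iff_gcd_eq_1)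
  define D' where "D' = a' * d - c' * b"
  have "g * D' = a * d - b * c" by (simp add: D'_def ac algebra_simps)
  then have D': "D' > 0" using D g zero_less_mult_pos[of g D'] by simp
  define B where "B = mat2 a' (- v) c' u"
  have B: "B \<in> SL2Z" unfolding B_def mat2_in_SL2Z using uv by (simp add: algebra_simps)
  have "B \<notin> Gamma0 N" using nd by (simp add: B_def mat2_in_Gamma0 c'_def g_def)
  with f B obtain l where l: "((\<lambda>\<tau>. f (moebius B \<tau>)) \<longlongrightarrow> l) at_ii" by (rule haupt_tendsto_cusp)
  \<comment> \<open>The upper right entry of the triangular factor.\<close>
  define e where "e = u * b + v * d"
  have "filterlim (\<lambda>\<tau>. of_real (of_int g / of_int D') * \<tau> + of_int e / of_int D') at_ii at_ii"
    by (intro filterlim_at_ii_affine) (use g D' in simp)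
  from filterlim_compose[OF l this]
  have "((\<lambda>\<tau>. f (moebius B (of_real (of_int g / of_int D') * \<tau> + of_int e / of_int D'))) \<longlongrightarrow> l) at_ii" .
  moreover have "moebius B (of_real (of_int g / of_int D') * \<tau> + of_int e / of_int D') =
      (of_int a * \<tau> + of_int b) / (of_int c * \<tau> + of_int d)" for \<tau>
  proof -
    have nz: "of_int D' \<noteq> (0 :: complex)" using D' by simp
    have b: "a' * e - v * D' = b" "c' * e + u * D' = d"
    proof -
      have "a' * e - v * D' = b * (u * a' + v * c')" by (simp add: e_def D'_def algebra_simps)
      then show "a' * e - v * D' = b" using uv by simp
      have "c' * e + u * D' = d * (u * a' + v * c')" by (simp add: e_def D'_def algebra_simps)
      then show "c' * e + u * D' = d" using uv by simp
    qed
    have 1: "of_int a' * (of_real (of_int g / of_int D') * \<tau> + of_int e / of_int D') + of_int (- v) = (of_int a * \<tau> + of_int b) / of_int D'"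
      unfolding b(1)[symmetric] ac using nz by (simp add: field_simps)
    have 2: "of_int c' * (of_real (of_int g / of_int D') * \<tau> + of_int e / of_int D') + of_int u = (of_int c * \<tau> + of_int d) / of_int D'"
      unfolding b(2)[symmetric] ac using nz by (simp add: field_simps)
    show ?thesis unfolding B_def moebius_mat2 1 2 using nz by simp
  qed
  ultimately show ?thesis using that by simp
qed

text \<open>Translation of a cusp by \<open>s / h\<close> cannot create a denominator divisible by
  \<open>N\<close>: otherwise the reduced numerator \<open>a1\<close> is prime to \<open>h\<close>,
  so \<open>h\<close> divides the gcd \<open>g\<close>, and this is the factor that \<open>c\<close>
  needs.\<close>

lemma translate_denominator:
  assumes "h > 0" and N: "int h * int h dvd int N" and ac: "coprime a c"
    and dvd: "int N dvd int h * c div gcd (int h * a + s * c) (int h * c)"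
  shows "int N dvd c"
proof (cases "c = 0")
  case False
  define h' where "h' = int h"
  have h: "h' > 0" using assms by (simp add: h'_def)
  define g where "g = gcd (h' * a + s * c) (h' * c)"
  have g: "g > 0" using False h by (auto simp: g_def)
  obtain a1 c1 where a1: "h' * a + s * c = g * a1" and c1: "h' * c = g * c1" and cop: "coprime a1 c1"
    using gcd_coprime_exists[of "h' * a + s * c" "h' * c"] g unfolding g_def by (auto simp: mult.commute)
  have "h' * c div g = c1" using c1 g by simp
  then have "int h * c div gcd (int h * a + s * c) (int h * c) = c1" unfolding h'_def g_def .
  then have "int N dvd c1" using dvd by simp
  then obtain j where j: "c1 = int N * j" by (elim dvdE)
  obtain n0 where n0: "int N = h' * h' * n0" using N by (auto simp: h'_def elim: dvdE)
  have c: "c = h' * n0 * j * g" using c1 h unfolding j n0 by (simp add: mult_ac)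
  have "h' * a = g * (a1 - s * h' * n0 * j)" using a1 unfolding c by (simp add: algebra_simps)
  then have "h' dvd g * (a1 - s * h' * n0 * j)" by (metis dvd_triv_left)
  moreover have "coprime h' (a1 - s * h' * n0 * j)"
  proof -
    have "coprime a1 h'" using cop unfolding j n0 by (simp add: mult.assoc)
    moreover have "gcd h' (a1 - s * h' * n0 * j) = gcd h' a1"
      using gcd_add_mult[of h' "- s * n0 * j" a1] by (simp add: algebra_simps)
    ultimately show ?thesis by (simp add: coprime_iff_gcd_eq_1 gcd.commute)
  qed
  ultimately have "h' dvd g" using coprime_dvd_mult_left_iff by blast
  then obtain g' where "g = h' * g'" by (elim dvdE)
  then have "c = int N * (j * g')" unfolding c n0 by (simp add: mult_ac)
  then show ?thesis by simp
qed simp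

text \<open>\<open>A\<close> in \<^term>\<open>Gamma0 N\<close> with lower right entry \<open>d\<close> carries the translate by \<open>s / h\<close> to the one by
  \<open>s d\<^sup>2 / h\<close>, so the sum over a set \<open>S\<close> stable under unit squares is invariant; its only pole is at \<open>\<infinity>\<close>.\<close>

theorem haupt_translations:
  assumes f: "haupt N f F" and h: "h > 0" "h\<^sup>2 dvd N" and S: "S \<subseteq> {..<h}"
    and closed: "\<And>s d. s \<in> S \<Longrightarrow> coprime d (int h) \<Longrightarrow> nat ((int s * d * d) mod int h) \<in> S"
    and \<tau>: "Im \<tau> > 0"
  shows "(\<Sum>s\<in>S. f (\<tau> + of_nat s / of_nat h)) = (\<Sum>s\<in>S. qexp (- of_nat s / of_nat h)) * f \<tau>"
proof -
  have N: "N > 0" using f by (simp add: haupt_def)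
  have hN: "int h * int h dvd int N" using h(2) by (metis int_dvd_int_iff of_nat_mult power2_eq_square)
  have finS: "finite S" using S finite_subset by blast
  define \<kappa> where "\<kappa> = (\<Sum>s\<in>S. qexp (- of_nat s / of_nat h))"
  define G where "G \<tau> = (\<Sum>s\<in>S. f (\<tau> + of_nat s / of_nat h)) - \<kappa> * f \<tau>" for \<tau>
  have hol_f: "f holomorphic_on upper_half_plane" using f by (simp add: haupt_def)
  have hol: "G holomorphic_on upper_half_plane"
  proof -
    have "(\<lambda>\<tau>. f (\<tau> + of_nat s / of_nat h)) holomorphic_on upper_half_plane" for s
      using holomorphic_on_compose_gen[OF _ hol_f, of "\<lambda>\<tau>. \<tau> + of_nat s / of_nat h" upper_half_plane]
      by (simp add: o_def image_subset_iff holomorphic_intros)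
    then show ?thesis unfolding G_def by (intro holomorphic_intros hol_f)
  qed
  have inv: "G (moebius A \<tau>) = G \<tau>" if A: "A \<in> Gamma0 N" "Im \<tau> > 0" for A \<tau>
  proof -
    obtain a b c d where A': "A = mat2 a b c d" "a * d - b * c = 1" "int N dvd c" using A(1) by (rule Gamma0_cases)
    obtain e where e: "c = int h * int h * e" using hN A'(3) by (metis dvdE dvd_trans)
    have cop: "coprime d (int h)"
    proof (rule coprimeI)
      fix k assume "k dvd d" "k dvd int h"
      then have "k dvd a * d - b * c" unfolding e by (intro dvd_diff dvd_mult dvd_mult2) auto
      then show "is_unit k" using A'(2) by simp
    qed
    \<comment> \<open>The class \<open>s'\<close> with \<open>s' * a\<close> congruent to
      \<open>s * d\<close>, because \<open>a\<close> and \<open>d\<close> are inverse modulo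
      \<open>h\<close>.\<close>
    define \<pi> where "\<pi> s = nat ((int s * d * d) mod int h)" for s
    have nz: "of_int c * \<tau> + of_int d \<noteq> 0" using A A' by (intro denom_nonzero) auto
    have step: "f (moebius A \<tau> + of_nat s / of_nat h) = f (\<tau> + of_nat (\<pi> s) / of_nat h)" for s
    proof -
      define s' where "s' = int (\<pi> s)"
      have s': "s' = (int s * d * d) mod int h" using h by (simp add: s'_def \<pi>_def)
      have "[s' * a = int s * d * d * a] (mod int h)" unfolding s' by (intro cong_mult cong_refl) (simp add: cong_def)
      moreover have "int s * d * d * a = int s * d * 1 + int h * (int h * e * b * int s * d)"
      proof -
        have "a * d = 1 + b * (int h * int h * e)" using A'(2) unfolding e by simp
        then have "int s * d * (a * d) = int s * d * (1 + b * (int h * int h * e))" by simp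
        then show ?thesis by (simp add: algebra_simps)
      qed
      ultimately have "[s' * a = int s * d] (mod int h)"
        by (simp add: cong_def)
      then obtain k where k: "int s * d - s' * a = int h * k"
        unfolding cong_iff_dvd_diff[of "int s * d"] cong_sym_eq[of "s' * a"] by (elim dvdE)
      \<comment> \<open>\<open>A1\<close> is translation by \<open>s / h\<close> after
        \<open>A\<close> after translation by \<open>- s' / h\<close>. It is integral since
        \<open>h * h\<close> divides \<open>c\<close> and \<open>h\<close> divides
        \<open>s * d - s' * a\<close>.\<close>
      define b' where "b' = b + k - int s * s' * e"
      define A1 where "A1 = mat2 (a + int s * int h * e) b' c (d - int h * e * s')"
      have "(a + int s * int h * e) * (d - int h * e * s') - b' * c =
          (a * d - b * c) + int h * e * (int s * d - s' * a) - int h * int h * e * k"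
        unfolding b'_def e by (simp add: algebra_simps)
      also have "\<dots> = 1" unfolding A'(2) k by simp
      finally have "(a + int s * int h * e) * (d - int h * e * s') - b' * c = 1" .
      then have A1: "A1 \<in> Gamma0 N" unfolding A1_def mat2_in_Gamma0 using A'(3) by simp
      define \<sigma> where "\<sigma> = \<tau> + of_nat (\<pi> s) / of_nat h"
      have \<sigma>: "\<sigma> = \<tau> + of_int s' / of_nat h" "Im \<sigma> > 0" using A(2) by (simp_all add: \<sigma>_def s'_def)
      have h0: "(of_nat h :: complex) \<noteq> 0" using h by simp
      have k': "(of_int k :: complex) = (of_nat s * of_int d - of_int s' * of_int a) / of_nat h"
        using arg_cong[OF k, of "of_int :: int \<Rightarrow> complex"] h0 by (simp add: field_simps)
      have 1: "of_int c * \<sigma> + of_int (d - int h * e * s') = of_int c * \<tau> + of_int d"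
        unfolding \<sigma> e using h0 by (simp add: field_simps)
      have 2: "of_int (a + int s * int h * e) * \<sigma> + of_int b' = (of_int a * \<tau> + of_int b) + of_nat s / of_nat h * (of_int c * \<tau> + of_int d)"
        unfolding \<sigma> b'_def e using h0 by (simp add: k' field_simps)
      have "moebius A1 \<sigma> = moebius A \<tau> + of_nat s / of_nat h"
        unfolding A1_def A' moebius_mat2 1 2 using nz by (simp add: add_divide_distrib)
      then show ?thesis using haupt_inv[OF f A1 \<sigma>(2)] by (simp add: \<sigma>_def)
    qed
    have inj: "inj_on \<pi> S"
    proof (rule inj_onI)
      fix s t assume st: "s \<in> S" "t \<in> S" "\<pi> s = \<pi> t"
      then have "[int s * d * d = int t * d * d] (mod int h)"
        using h by (simp add: \<pi>_def cong_def nat_eq_iff)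
      then have "[int s = int t] (mod int h)" using cop by (simp add: cong_mult_rcancel)
      then have "[s = t] (mod h)" by (simp add: cong_int_iff)
      moreover have "s < h" "t < h" using st S by auto
      ultimately show "s = t" by (simp add: cong_def)
    qed
    have img: "\<pi> ` S = S" using closed cop inj finS unfolding \<pi>_def by (intro endo_inj_surj) auto
    have "(\<Sum>s\<in>S. f (moebius A \<tau> + of_nat s / of_nat h)) = (\<Sum>s\<in>S. f (\<tau> + of_nat (\<pi> s) / of_nat h))"
      by (simp add: step)
    also have "\<dots> = (\<Sum>s\<in>\<pi> ` S. f (\<tau> + of_nat s / of_nat h))" using inj by (simp add: sum.reindex)
    finally show ?thesis using haupt_inv[OF f A] by (simp add: G_def img)
  qed
  have bdd: "bdd_ii (\<lambda>\<tau>. G (moebius A \<tau>))" if A: "A \<in> SL2Z" "A \<notin> Gamma0 N" for A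
  proof -
    obtain a b c d where A': "A = mat2 a b c d" "a * d - b * c = 1" using A(1) by (rule SL2Z_cases)
    have ndvd: "\<not> int N dvd c" using A A' by (simp add: mat2_in_Gamma0)
    have cop: "coprime a c"
    proof (rule coprimeI)
      fix k assume "k dvd a" "k dvd c"
      then have "k dvd a * d - b * c" by (intro dvd_diff dvd_mult dvd_mult2) auto
      then show "is_unit k" using A'(2) by simp
    qed
    have ex: "\<exists>l. ((\<lambda>\<tau>. f (moebius A \<tau> + of_nat s / of_nat h)) \<longlongrightarrow> l) at_ii" for s
    proof -
      have "(int h * a + int s * c) * (int h * d) - (int h * b + int s * d) * (int h * c) = int h * int h * (a * d - b * c)"
        by (simp add: algebra_simps)
      then have D: "(int h * a + int s * c) * (int h * d) - (int h * b + int s * d) * (int h * c) > 0"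
        using A'(2) h by simp
      obtain l where l: "((\<lambda>\<tau>. f ((of_int (int h * a + int s * c) * \<tau> + of_int (int h * b + int s * d)) /
          (of_int (int h * c) * \<tau> + of_int (int h * d)))) \<longlongrightarrow> l) at_ii"
        using haupt_cusp_limit[OF f D] translate_denominator[OF h(1) hN cop] ndvd by blast
      have "eventually (\<lambda>\<tau>. f ((of_int (int h * a + int s * c) * \<tau> + of_int (int h * b + int s * d)) /
          (of_int (int h * c) * \<tau> + of_int (int h * d))) = f (moebius A \<tau> + of_nat s / of_nat h)) at_ii"
        using eventually_at_ii_Im_gt[of 0]
      proof eventually_elim
        case (elim \<tau>)
        have nz: "of_int c * \<tau> + of_int d \<noteq> 0" using elim A' by (intro denom_nonzero) auto
        have h0: "(of_nat h :: complex) \<noteq> 0" using h by simp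
        have 1: "of_int (int h * c) * \<tau> + of_int (int h * d) = of_nat h * (of_int c * \<tau> + of_int d)"
          by (simp add: algebra_simps)
        have 2: "of_int (int h * a + int s * c) * \<tau> + of_int (int h * b + int s * d) =
            of_nat h * (of_int a * \<tau> + of_int b) + of_nat s * (of_int c * \<tau> + of_int d)"
          by (simp add: algebra_simps)
        show ?case unfolding A' moebius_mat2 1 2 using nz h0 by (simp add: add_divide_distrib)
      qed
      from Lim_transform_eventually[OF l this] show ?thesis by (rule exI)
    qed
    have "\<forall>s. \<exists>l. ((\<lambda>\<tau>. f (moebius A \<tau> + of_nat s / of_nat h)) \<longlongrightarrow> l) at_ii" by (intro allI ex)
    then have "\<exists>l. \<forall>s. ((\<lambda>\<tau>. f (moebius A \<tau> + of_nat s / of_nat h)) \<longlongrightarrow> l s) at_ii" by (rule choice)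
    then obtain l where l: "\<forall>s. ((\<lambda>\<tau>. f (moebius A \<tau> + of_nat s / of_nat h)) \<longlongrightarrow> l s) at_ii" ..
    obtain l' where l': "((\<lambda>\<tau>. f (moebius A \<tau>)) \<longlongrightarrow> l') at_ii" using haupt_tendsto_cusp[OF f A] .
    have "((\<lambda>\<tau>. G (moebius A \<tau>)) \<longlongrightarrow> (\<Sum>s\<in>S. l s) - \<kappa> * l') at_ii"
      unfolding G_def by (intro tendsto_intros l[rule_format] l')
    then show ?thesis by (rule bdd_ii_tendsto)
  qed
  \<comment> \<open>The poles of the translates add up to \<open>\<kappa> / q\<close>, which
    dictates the factor \<kappa>.\<close>
  have lim: "(G \<longlongrightarrow> 0) at_ii"
  proof -
    have "((\<lambda>\<tau>. f (\<tau> + of_nat s / of_nat h) - 1 / qexp (\<tau> + of_nat s / of_nat h)) \<longlongrightarrow> 0) at_ii" for s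
      by (rule filterlim_compose[OF haupt_pole[OF f] filterlim_at_ii_add])
    then have "((\<lambda>\<tau>. (\<Sum>s\<in>S. f (\<tau> + of_nat s / of_nat h) - 1 / qexp (\<tau> + of_nat s / of_nat h)) - \<kappa> * (f \<tau> - 1 / qexp \<tau>)) \<longlongrightarrow> (\<Sum>s\<in>S. 0) - \<kappa> * 0) at_ii"
      by (intro tendsto_intros haupt_pole[OF f])
    moreover have "(\<Sum>s\<in>S. f (\<tau> + of_nat s / of_nat h) - 1 / qexp (\<tau> + of_nat s / of_nat h)) - \<kappa> * (f \<tau> - 1 / qexp \<tau>) = G \<tau>" for \<tau>
    proof -
      have "1 / qexp (\<tau> + of_nat s / of_nat h) = qexp (- of_nat s / of_nat h) * (1 / qexp \<tau>)" for s
        using qexp_diff[of 0 "of_nat s / of_nat h"] by (simp add: qexp_add)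
      then have "(\<Sum>s\<in>S. 1 / qexp (\<tau> + of_nat s / of_nat h)) = \<kappa> * (1 / qexp \<tau>)"
        unfolding \<kappa>_def sum_distrib_right by simp
      then show ?thesis by (simp add: G_def sum_subtractf right_diff_distrib)
    qed
    ultimately show ?thesis by simp
  qed
  have "G \<tau> = 0" by (rule Gamma0_liouville[OF N hol inv bdd lim \<tau>])
  then show ?thesis by (simp add: G_def \<kappa>_def)
qed

text \<open>The translates multiply the coefficient of \<open>q ^ n\<close> by one sum of roots of
  unity and the pole by the other. A coefficient survives only where the two sums agree.\<close>

corollary haupt_translations_coeff:
  assumes f: "haupt N f F" and h: "h > 0" "h\<^sup>2 dvd N" and S: "S \<subseteq> {..<h}"
    and closed: "\<And>s d. s \<in> S \<Longrightarrow> coprime d (int h) \<Longrightarrow> nat ((int s * d * d) mod int h) \<in> S"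
    and neq: "(\<Sum>s\<in>S. qexp (of_nat (s * n) / of_nat h)) \<noteq> (\<Sum>s\<in>S. qexp (- of_nat s / of_nat h))"
  shows "fps_nth F (Suc n) = 0"
proof -
  define \<kappa> where "\<kappa> = (\<Sum>s\<in>S. qexp (- of_nat s / of_nat h))"
  have fF: "q_fps (\<lambda>\<tau>. qexp \<tau> * f \<tau>) F" using f by (simp add: haupt_def)
  have L: "q_fps (\<lambda>\<tau>. \<Sum>s\<in>S. qexp (- of_nat s / of_nat h) * (qexp (\<tau> + of_nat s / of_nat h) * f (\<tau> + of_nat s / of_nat h)))
     (\<Sum>s\<in>S. fps_const (qexp (- of_nat s / of_nat h)) * (F oo (fps_const (qexp (of_nat s / of_nat h)) * fps_X)))"
    by (intro q_fps_sum q_fps_mult q_fps_const q_fps_translate[OF fF])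
  have R: "q_fps (\<lambda>\<tau>. \<kappa> * (qexp \<tau> * f \<tau>)) (fps_const \<kappa> * F)"
    by (intro q_fps_mult q_fps_const fF)
  have "eventually (\<lambda>\<tau>. (\<Sum>s\<in>S. qexp (- of_nat s / of_nat h) * (qexp (\<tau> + of_nat s / of_nat h) * f (\<tau> + of_nat s / of_nat h))) = \<kappa> * (qexp \<tau> * f \<tau>)) at_ii"
    using eventually_at_ii_Im_gt[of 0]
  proof eventually_elim
    case (elim \<tau>)
    have *: "qexp (- of_nat s / of_nat h) * (qexp (\<tau> + of_nat s / of_nat h) * z) = qexp \<tau> * z" for s z
      by (simp add: mult.assoc[symmetric] flip: qexp_add)
    show ?case unfolding * sum_distrib_left[symmetric] \<kappa>_def
      using haupt_translations[OF f h S closed elim] by (simp only: mult_ac)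
  qed
  from q_fps_unique[OF q_fps_cong[OF L this] R]
  have "fps_nth (\<Sum>s\<in>S. fps_const (qexp (- of_nat s / of_nat h)) * (F oo (fps_const (qexp (of_nat s / of_nat h)) * fps_X))) (Suc n) = \<kappa> * fps_nth F (Suc n)"
    by simp
  moreover have "fps_nth (fps_const x * (F oo (fps_const y * fps_X))) (Suc n) = x * y ^ Suc n * fps_nth F (Suc n)" for x y
    by (simp del: power_Suc)
  ultimately have "(\<Sum>s\<in>S. qexp (- of_nat s / of_nat h) * qexp (of_nat s / of_nat h) ^ Suc n) * fps_nth F (Suc n) = \<kappa> * fps_nth F (Suc n)"
    unfolding fps_sum_nth by (simp only: sum_distrib_right)
  moreover have "qexp (- of_nat s / of_nat h) * qexp (of_nat s / of_nat h) ^ Suc n = qexp (of_nat (s * n) / of_nat h)" for s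
  proof -
    have "qexp (of_nat s / of_nat h) ^ n = qexp (of_nat n * (of_nat s / of_nat h))" by (rule qexp_mult_of_nat[symmetric])
    moreover have "qexp (- of_nat s / of_nat h) * qexp (of_nat s / of_nat h) = 1" by (simp flip: qexp_add)
    ultimately show ?thesis by (simp add: mult.assoc[symmetric]) (simp add: mult.commute)
  qed
  ultimately have "(\<Sum>s\<in>S. qexp (of_nat (s * n) / of_nat h)) * fps_nth F (Suc n) = \<kappa> * fps_nth F (Suc n)"
    by (simp only:)
  then show ?thesis using neq unfolding \<kappa>_def mult_cancel_right by (elim disjE) (assumption, erule (1) notE)
qed

section \<open>Levels divisible by four\<close>

lemma qexp_minus_half: "qexp (- 1 / 2) = - 1"
  using qexp_diff[of 0 "1 / 2"] qexp_half by simp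

lemma odd_square_closed:
  assumes "s \<in> {1 :: nat}" "coprime d (int 2)"
  shows "nat ((int s * d * d) mod int 2) \<in> {1}"
proof -
  have "odd d" using assms(2) by (metis coprime_right_2_iff_odd of_nat_numeral)
  then have "(d * d) mod 2 = 1" by (simp add: odd_iff_mod_2_eq_one[symmetric])
  then show ?thesis using assms(1) by simp
qed

lemma haupt_half_translate:
  assumes "haupt N f F" "4 dvd N" "Im \<tau> > 0"
  shows "f (\<tau> + 1 / 2) = - f \<tau>"
proof -
  have "(\<Sum>s\<in>{1 :: nat}. f (\<tau> + of_nat s / of_nat 2)) = (\<Sum>s\<in>{1}. qexp (- of_nat s / of_nat 2)) * f \<tau>"
    by (rule haupt_translations[OF assms(1) _ _ _ odd_square_closed assms(3)]) (use assms(2) in auto)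
  then show ?thesis using qexp_minus_half by simp
qed

text \<open>An odd index belongs to an even power of q, which does not change sign under translation
  by 1/2.\<close>

lemma haupt_odd_coeff:
  assumes "haupt N f F" "4 dvd N" "odd n"
  shows "fps_nth F n = 0"
proof -
  obtain m where n: "n = Suc (2 * m)" using assms(3) by (auto elim: oddE)
  have "qexp (of_nat (2 * m) / of_nat 2) = 1" using qexp_of_nat[of m] by simp
  then show ?thesis unfolding n using qexp_minus_half assms(2)
    by (intro haupt_translations_coeff[OF assms(1) _ _ _ odd_square_closed]) auto
qed

text \<open>For \<open>4 dvd N\<close> the square of \<open>f\<close> is invariant under \<open>\<tau> \<mapsto> \<tau> + 1/2\<close>, so \<open>f(\<tau>/2)\<^sup>2\<close> lives on \<open>Gamma0 (N/2)\<close>.\<close>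

theorem haupt_square:
  assumes f: "haupt N f F" and f': "haupt M f' F'" and NM: "N = 2 * M" "even M"
  shows "Im \<tau> > 0 \<Longrightarrow> (f \<tau>)\<^sup>2 = f' (2 * \<tau>) + 2 * fps_nth F 2"
    and "F ^ 2 = (F' oo fps_X ^ 2) + fps_const (2 * fps_nth F 2) * fps_X ^ 2"
proof -
  \<comment> \<open>\<open>2 * x\<close> is the constant term of the square of
    \<open>1 / q + x * q + ...\<close>, while \<open>f'\<close> has none.\<close>
  define x where "x = fps_nth F 2"
  define g where "g \<tau> = (f (\<tau> / 2))\<^sup>2 - f' \<tau> - 2 * x" for \<tau>
  have N4: "4 dvd N" using NM by (auto elim!: evenE)
  have M: "M > 0" using f' by (simp add: haupt_def)
  have hol_f: "f holomorphic_on upper_half_plane" using f by (simp add: haupt_def)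
  have "(f \<circ> (\<lambda>\<tau>. \<tau> / 2)) holomorphic_on upper_half_plane"
    by (rule holomorphic_on_compose_gen[OF _ hol_f]) (auto intro!: holomorphic_intros)
  then have hol: "g holomorphic_on upper_half_plane"
    unfolding g_def using f' by (intro holomorphic_intros) (auto simp: haupt_def o_def)
  have even_case: "f (moebius (mat2 a b c d) \<tau> / 2) = f (\<tau> / 2)"
    if ev: "a * d - b * c = 1" "int M dvd c" "even b" "Im \<tau> > 0" for a b c d \<tau>
  proof -
    obtain b' where b': "b = 2 * b'" using ev(3) by (elim evenE)
    have "mat2 a b' (2 * c) d \<in> Gamma0 N"
      unfolding mat2_in_Gamma0 NM using ev b' by auto
    then have inv: "f (moebius (mat2 a b' (2 * c) d) (\<tau> / 2)) = f (\<tau> / 2)" by (rule haupt_inv[OF f]) (use ev in simp)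
    have eq: "of_int a * (\<tau> / 2) + of_int b' = (of_int a * \<tau> + of_int b) / 2"
      "of_int (2 * c) * (\<tau> / 2) + of_int d = of_int c * \<tau> + of_int d" by (simp_all add: b' add_divide_distrib)
    show ?thesis using inv unfolding moebius_mat2 eq by (simp only: divide_divide_eq_left mult.commute)
  qed
  have inv: "g (moebius A \<tau>) = g \<tau>" if A: "A \<in> Gamma0 M" "Im \<tau> > 0" for A \<tau>
  proof -
    obtain a b c d where A': "A = mat2 a b c d" "a * d - b * c = 1" "int M dvd c" using A(1) by (rule Gamma0_cases)
    \<comment> \<open>For even \<open>b\<close>, conjugation by \<tau> \<mapsto> \<tau>/2 lands in
      \<open>Gamma0 N\<close>. For odd \<open>b\<close> a further unit translation makes that entry
      even; on \<tau>/2 it is translation by 1/2 and costs a sign, which the square removes.\<close>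
    have "(f (moebius A \<tau> / 2))\<^sup>2 = (f (\<tau> / 2))\<^sup>2"
    proof (cases "even b")
      case True
      then show ?thesis using even_case[OF A'(2,3) _ A(2)] A' by simp
    next
      case False
      have "even c" using A'(3) NM(2) by (metis even_of_nat dvd_trans)
      moreover have "a * d = 1 + b * c" using A'(2) by simp
      ultimately have "odd (a * d)" by simp
      then have "odd d" by simp
      have nz: "of_int c * \<tau> + of_int d \<noteq> 0" using A A' by (intro denom_nonzero) auto
      have Im: "Im (moebius A \<tau>) > 0" using A(1) Gamma0_subset A(2) Im_moebius_pos by blast
      have "moebius (mat2 (a + c) (b + d) c d) \<tau> = moebius A \<tau> + 1"
        unfolding A' moebius_mat2 using nz by (simp add: field_simps)
      moreover have "f (moebius (mat2 (a + c) (b + d) c d) \<tau> / 2) = f (\<tau> / 2)"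
        using A'(2,3) False \<open>odd d\<close> A(2) by (intro even_case) (auto simp: algebra_simps)
      ultimately have "f (moebius A \<tau> / 2 + 1 / 2) = f (\<tau> / 2)" by (simp add: add_divide_distrib)
      moreover have "f (moebius A \<tau> / 2 + 1 / 2) = - f (moebius A \<tau> / 2)"
        using Im by (intro haupt_half_translate[OF f N4]) simp
      ultimately show ?thesis by (metis power2_minus)
    qed
    then show ?thesis using haupt_inv[OF f' A] by (simp add: g_def)
  qed
  have bdd: "bdd_ii (\<lambda>\<tau>. g (moebius A \<tau>))" if A: "A \<in> SL2Z" "A \<notin> Gamma0 M" for A
  proof -
    obtain a b c d where A': "A = mat2 a b c d" "a * d - b * c = 1" using A(1) by (rule SL2Z_cases)
    have ndvd: "\<not> int M dvd c" using A A' by (simp add: mat2_in_Gamma0)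
    have cop: "coprime a c"
    proof (rule coprimeI)
      fix k assume "k dvd a" "k dvd c"
      then have "k dvd a * d - b * c" by (intro dvd_diff dvd_mult dvd_mult2) auto
      then show "is_unit k" using A'(2) by simp
    qed
    \<comment> \<open>The reduced denominator of \<open>a / (2 * c)\<close> is \<open>c\<close>,
      then odd, or \<open>2 * c\<close>.\<close>
    have "\<not> int N dvd (2 * c) div gcd a (2 * c)"
    proof (cases "even a")
      case True
      then have "odd c" using cop coprime_common_divisor[of a c 2] by auto
      obtain a' where a': "a = 2 * a'" using True by (elim evenE)
      have "coprime a' c" using cop unfolding a' by simp
      then have "gcd a (2 * c) = 2" unfolding a' by (simp add: gcd_mult_left coprime_iff_gcd_eq_1)
      then have "(2 * c) div gcd a (2 * c) = c" by simp
      moreover have "even (int N)" using NM by simp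
      ultimately show ?thesis using \<open>odd c\<close> dvd_trans[of 2 "int N" c] by auto
    next
      case False
      then have "coprime a (2 * c)" using cop by simp
      then have "gcd a (2 * c) = 1" by (simp add: coprime_iff_gcd_eq_1)
      then show ?thesis using ndvd NM by simp
    qed
    moreover have "a * (2 * d) - b * (2 * c) > 0" using A'(2) by (simp add: algebra_simps)
    ultimately obtain l where L: "((\<lambda>\<tau>. f ((of_int a * \<tau> + of_int b) / (of_int (2 * c) * \<tau> + of_int (2 * d)))) \<longlongrightarrow> l) at_ii"
      using haupt_cusp_limit[OF f, of a "2 * d" b "2 * c"] by blast
    have E: "(of_int a * \<tau> + of_int b) / (of_int (2 * c) * \<tau> + of_int (2 * d)) = moebius A \<tau> / 2" for \<tau>
    proof -
      have "of_int (2 * c) * \<tau> + of_int (2 * d) = 2 * (of_int c * \<tau> + of_int d)" by (simp add: algebra_simps)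
      then show ?thesis unfolding A' moebius_mat2 by (simp only:) simp
    qed
    have l: "((\<lambda>\<tau>. f (moebius A \<tau> / 2)) \<longlongrightarrow> l) at_ii" using L unfolding E .
    obtain l' where l': "((\<lambda>\<tau>. f' (moebius A \<tau>)) \<longlongrightarrow> l') at_ii" using haupt_tendsto_cusp[OF f' A] .
    have "((\<lambda>\<tau>. g (moebius A \<tau>)) \<longlongrightarrow> l\<^sup>2 - l' - 2 * x) at_ii"
      unfolding g_def by (intro tendsto_intros l l')
    then show ?thesis by (rule bdd_ii_tendsto)
  qed
  define P where "P = F ^ 2 - (F' oo fps_X ^ 2) - fps_const (2 * x) * fps_X ^ 2"
  have P: "q_fps (\<lambda>\<tau>. (qexp \<tau> * f \<tau>) ^ 2 - qexp (of_nat 2 * \<tau>) * f' (of_nat 2 * \<tau>) - 2 * x * qexp \<tau> ^ 2) P"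
    unfolding P_def using f f' q_fps_compose_mult[of "\<lambda>\<tau>. qexp \<tau> * f' \<tau>" F' 2]
    by (intro q_fps_diff q_fps_power q_fps_mult q_fps_const q_fps_qexp) (auto simp: haupt_def)
  have Pg: "(qexp \<tau> * f \<tau>) ^ 2 - qexp (of_nat 2 * \<tau>) * f' (of_nat 2 * \<tau>) - 2 * x * qexp \<tau> ^ 2 = qexp \<tau> * (qexp \<tau> * g (2 * \<tau>))" for \<tau>
    unfolding qexp_mult_of_nat by (simp add: g_def power2_eq_square algebra_simps)
  have F01: "fps_nth F 0 = 1" "fps_nth F (Suc 0) = 0" "fps_nth F' 0 = 1" "fps_nth F' (Suc 0) = 0"
    using f f' by (simp_all add: haupt_def)
  have sq: "fps_nth (F ^ 2) n = (\<Sum>k\<le>n. fps_nth F k * fps_nth F (n - k))" for n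
    by (simp only: power2_eq_square fps_mult_nth atLeast0AtMost)
  have "fps_nth (F ^ 2) 0 = 1" "fps_nth (F ^ 2) (Suc 0) = 0" "fps_nth (F ^ 2) 2 = 2 * x"
    unfolding sq by (simp_all add: sum_atMost_numeral F01 x_def)
  \<comment> \<open>With these three zeros q can be divided out twice and the limit is still
    0.\<close>
  then have P012: "fps_nth P 0 = 0" "fps_nth P (Suc 0) = 0" "fps_nth P 2 = 0"
    by (simp_all add: P_def fps_nth_compose_fps_X_power F01)
  have "q_fps (\<lambda>\<tau>. qexp \<tau> * (qexp \<tau> * g (2 * \<tau>)) / qexp \<tau>) (fps_shift 1 P)"
    using P P012 unfolding Pg by (intro q_fps_divide_qexp) auto
  then have "q_fps (\<lambda>\<tau>. qexp \<tau> * g (2 * \<tau>)) (fps_shift 1 P)" by simp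
  then have "q_fps (\<lambda>\<tau>. qexp \<tau> * g (2 * \<tau>) / qexp \<tau>) (fps_shift 1 (fps_shift 1 P))"
    using P012 by (intro q_fps_divide_qexp) auto
  then have "((\<lambda>\<tau>. g (2 * \<tau>)) \<longlongrightarrow> 0) at_ii"
    using q_fps_tendsto P012(3) by (fastforce simp: numeral_2_eq_2)
  from filterlim_compose[OF this filterlim_at_ii_div[of 2]] have lim: "(g \<longlongrightarrow> 0) at_ii" by simp
  have g0: "g \<tau> = 0" if "Im \<tau> > 0" for \<tau> by (rule Gamma0_liouville[OF M hol inv bdd lim that])
  show "(f \<tau>)\<^sup>2 = f' (2 * \<tau>) + 2 * fps_nth F 2" if "Im \<tau> > 0"
    using g0[of "2 * \<tau>"] that by (simp add: g_def x_def algebra_simps)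
  have "eventually (\<lambda>\<tau>. qexp \<tau> * (qexp \<tau> * g (2 * \<tau>)) = 0) at_ii"
    using eventually_at_ii_Im_gt[of 0] by eventually_elim (simp add: g0)
  from q_fps_unique[OF q_fps_cong[OF P[unfolded Pg] this], of 0] have "P = 0"
    using q_fps_const[of 0] by simp
  then show "F ^ 2 = (F' oo fps_X ^ 2) + fps_const (2 * fps_nth F 2) * fps_X ^ 2"
    by (simp add: P_def x_def algebra_simps)
qed

lemma square_coeffs:
  assumes F: "F ^ 2 = (F' oo fps_X ^ 2) + fps_const (2 * fps_nth F 2) * (fps_X :: complex fps) ^ 2"
    and "fps_nth F 0 = 1" "\<And>n. odd n \<Longrightarrow> fps_nth F n = 0"
  shows "2 * fps_nth F 4 + (fps_nth F 2)\<^sup>2 = fps_nth F' 2"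
    "2 * fps_nth F 6 + 2 * fps_nth F 2 * fps_nth F 4 = fps_nth F' 3"
proof -
  have o: "fps_nth F (Suc 0) = 0" "fps_nth F 3 = 0" "fps_nth F 5 = 0" using assms(3) by simp_all
  have sq: "fps_nth (F ^ 2) n = (\<Sum>k\<le>n. fps_nth F k * fps_nth F (n - k))" for n
    by (simp only: power2_eq_square fps_mult_nth atLeast0AtMost)
  have "fps_nth (F ^ 2) 4 = fps_nth F' 2" "fps_nth (F ^ 2) 6 = fps_nth F' 3"
    unfolding F by (simp_all add: fps_nth_compose_fps_X_power)
  then show "2 * fps_nth F 4 + (fps_nth F 2)\<^sup>2 = fps_nth F' 2"
    "2 * fps_nth F 6 + 2 * fps_nth F 2 * fps_nth F 4 = fps_nth F' 3"
    unfolding sq by (simp_all add: sum_atMost_numeral assms(2) o power2_eq_square algebra_simps)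
qed

text \<open>For even \<open>M\<close> the group \<open>Gamma0 N\<close> has index 2 in
  \<open>Gamma0 M\<close>, and the matrix shown represents the other coset. The sum over both
  descends to level \<open>M\<close>, with the pole of \<open>f'\<close> and constant term
  \<beta>.\<close>

theorem haupt_trace:
  assumes f: "haupt N f F" and f': "haupt M f' F'" and NM: "N = 2 * M" "even M"
    and \<beta>: "((\<lambda>\<tau>. f (moebius (mat2 1 0 (int M) 1) \<tau>)) \<longlongrightarrow> \<beta>) at_ii" and \<tau>: "Im \<tau> > 0"
  shows "f \<tau> + f (moebius (mat2 1 0 (int M) 1) \<tau>) = f' \<tau> + \<beta>"
proof -
  define R where "R = mat2 1 0 (int M) 1"
  have R: "R \<in> SL2Z" by (simp add: R_def mat2_in_SL2Z)
  have M: "M > 0" using f' by (simp add: haupt_def)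
  have hol_f: "f holomorphic_on upper_half_plane" using f by (simp add: haupt_def)
  define g where "g \<tau> = f \<tau> + f (moebius R \<tau>) - f' \<tau> - \<beta>" for \<tau>
  have "(f \<circ> moebius R) holomorphic_on upper_half_plane"
    by (rule holomorphic_on_compose_gen[OF holomorphic_on_moebius[OF R] hol_f]) (use R Im_moebius_pos in auto)
  then have hol: "g holomorphic_on upper_half_plane"
    unfolding g_def using f' hol_f by (intro holomorphic_intros) (auto simp: haupt_def o_def)
  have fR: "f (moebius R \<sigma>) = f (moebius C \<tau>)"
    if "C \<in> SL2Z" "A \<in> SL2Z" "Im \<tau> > 0" "\<sigma> = moebius A \<tau>" "R ** A ** adj2 C \<in> Gamma0 N" for A C \<tau> \<sigma>
  proof -
    have "moebius (R ** A) \<tau> = moebius (R ** A ** adj2 C) (moebius C \<tau>)"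
      using that R SL2Z_mult adj2_in_SL2Z Im_moebius_pos moebius_adj2 by (simp add: moebius_mult)
    then show ?thesis using that R haupt_inv[OF f that(5), of "moebius C \<tau>"] Im_moebius_pos
      by (simp add: moebius_mult)
  qed
  have inv: "g (moebius A \<tau>) = g \<tau>" if A: "A \<in> Gamma0 M" "Im \<tau> > 0" for A \<tau>
  proof -
    obtain a b c d where A': "A = mat2 a b c d" "a * d - b * c = 1" "int M dvd c" using A(1) by (rule Gamma0_cases)
    have "even c" using A'(3) NM(2) by (metis even_of_nat dvd_trans)
    moreover have "a * d = 1 + b * c" using A'(2) by simp
    ultimately have "odd (a * d)" by simp
    then have od: "odd a" "odd d" by simp_all
    obtain m where m: "int M = 2 * m" using NM(2) by (metis evenE even_of_nat)
    obtain e where e: "c = int M * e" using A'(3) by (elim dvdE)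
    have N: "int N = 2 * int M" using NM by simp
    have A_SL: "A \<in> SL2Z" using A(1) Gamma0_subset by blast
    have Im: "Im (moebius R \<tau>) > 0" using R A Im_moebius_pos by blast
    have one: "mat2 1 0 0 1 \<in> SL2Z" by (simp add: mat2_in_SL2Z)
    have "f (moebius A \<tau>) + f (moebius R (moebius A \<tau>)) = f \<tau> + f (moebius R \<tau>)"
    \<comment> \<open>The parity of \<open>c / M\<close> decides whether \<open>A\<close> fixes or
      exchanges the two cosets; \<open>a\<close> and \<open>d\<close> are odd because
      \<open>M\<close> is even.\<close>
    proof (cases "even e")
      case True
      then have "int N dvd c" unfolding e N by (auto elim!: evenE)
      then have "f (moebius A \<tau>) = f \<tau>" using A'(1,2) A(2) by (intro haupt_inv[OF f]) (simp_all add: mat2_in_Gamma0)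
      moreover have "f (moebius R (moebius A \<tau>)) = f (moebius R \<tau>)"
      proof (rule fR[OF R A_SL A(2) refl])
        have "R ** A ** adj2 R \<in> SL2Z" by (intro SL2Z_mult adj2_in_SL2Z R A_SL)
        moreover have "(R ** A ** adj2 R) $ 2 $ 1 = int M * (a - d) + c - int M * int M * b"
          unfolding R_def A' adj2_mat2 mat2_mult by (simp add: algebra_simps)
        moreover have "int N dvd int M * (a - d) + c - int M * int M * b"
        proof -
          have "even (a - d)" using od by simp
          then have "int N dvd int M * (a - d)" unfolding N by (auto elim!: evenE)
          moreover have "int N dvd int M * int M * b" unfolding N by (subst (2) m) simp
          ultimately show ?thesis using \<open>int N dvd c\<close> by (intro dvd_diff dvd_add)
        qed
        ultimately show "R ** A ** adj2 R \<in> Gamma0 N" by (simp add: Gamma0_def)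
      qed
      ultimately show ?thesis by simp
    next
      case False
      have "mat2 (a - int M * b) b (c - int M * d) d \<in> Gamma0 N"
      proof -
        have "even (e - d)" using False od by simp
        then have "int N dvd int M * (e - d)" unfolding N by (auto elim!: evenE)
        then show ?thesis unfolding mat2_in_Gamma0 using A'(2) e by (auto simp: algebra_simps)
      qed
      from haupt_inv[OF f this Im]
      have "f (moebius (mat2 (a - int M * b) b (c - int M * d) d ** R) \<tau>) = f (moebius R \<tau>)"
        using \<open>mat2 _ _ _ _ \<in> Gamma0 N\<close> Gamma0_subset R A(2) by (subst moebius_mult) auto
      moreover have "mat2 (a - int M * b) b (c - int M * d) d ** R = A"
        unfolding R_def A' mat2_mult by (simp add: algebra_simps)
      ultimately have "f (moebius A \<tau>) = f (moebius R \<tau>)" by simp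
      moreover have "f (moebius R (moebius A \<tau>)) = f (moebius (mat2 1 0 0 1) \<tau>)"
      proof (rule fR[OF one A_SL A(2) refl])
        have "R ** A ** adj2 (mat2 1 0 0 1) \<in> SL2Z" by (intro SL2Z_mult adj2_in_SL2Z R A_SL one)
        moreover have "(R ** A ** adj2 (mat2 1 0 0 1)) $ 2 $ 1 = int M * (a + e)"
          unfolding R_def A' adj2_mat2 mat2_mult e by (simp add: algebra_simps)
        moreover have "even (a + e)" using od False by simp
        then have "int N dvd int M * (a + e)" unfolding N by (auto elim!: evenE)
        ultimately show "R ** A ** adj2 (mat2 1 0 0 1) \<in> Gamma0 N" by (simp add: Gamma0_def)
      qed
      ultimately show ?thesis by (simp add: moebius_one)
    qed
    then show ?thesis using haupt_inv[OF f' A] by (simp add: g_def)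
  qed
  have bdd: "bdd_ii (\<lambda>\<tau>. g (moebius A \<tau>))" if A: "A \<in> SL2Z" "A \<notin> Gamma0 M" for A
  proof -
    have NM_sub: "Gamma0 N \<subseteq> Gamma0 M" using NM by (auto simp: Gamma0_def)
    have "R ** A \<notin> Gamma0 N"
    proof
      assume "R ** A \<in> Gamma0 N"
      then have "R ** A \<in> Gamma0 M" using NM_sub by blast
      moreover have "(R ** A) $ 2 $ 1 = int M * A $ 1 $ 1 + A $ 2 $ 1"
        by (simp add: R_def matrix_matrix_mult_def sum_2)
      ultimately have "int M dvd int M * A $ 1 $ 1 + A $ 2 $ 1" by (simp add: Gamma0_def)
      then have "int M dvd A $ 2 $ 1" by (simp add: dvd_add_right_iff)
      then show False using A by (simp add: Gamma0_def)
    qed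
    then obtain l1 where "((\<lambda>\<tau>. f (moebius (R ** A) \<tau>)) \<longlongrightarrow> l1) at_ii"
      using haupt_tendsto_cusp[OF f SL2Z_mult[OF R A(1)]] by blast
    moreover have "eventually (\<lambda>\<tau>. f (moebius (R ** A) \<tau>) = f (moebius R (moebius A \<tau>))) at_ii"
      using eventually_at_ii_Im_gt[of 0] by eventually_elim (simp add: moebius_mult R A)
    ultimately have l1: "((\<lambda>\<tau>. f (moebius R (moebius A \<tau>))) \<longlongrightarrow> l1) at_ii" by (rule Lim_transform_eventually)
    obtain l where l: "((\<lambda>\<tau>. f (moebius A \<tau>)) \<longlongrightarrow> l) at_ii" using haupt_tendsto_cusp[OF f A(1)] A(2) NM_sub by blast
    obtain l' where l': "((\<lambda>\<tau>. f' (moebius A \<tau>)) \<longlongrightarrow> l') at_ii" using haupt_tendsto_cusp[OF f' A] .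
    have "((\<lambda>\<tau>. g (moebius A \<tau>)) \<longlongrightarrow> l + l1 - l' - \<beta>) at_ii"
      unfolding g_def by (intro tendsto_intros l l' l1)
    then show ?thesis by (rule bdd_ii_tendsto)
  qed
  have "((\<lambda>\<tau>. (f \<tau> - 1 / qexp \<tau>) + f (moebius R \<tau>) - (f' \<tau> - 1 / qexp \<tau>) - \<beta>) \<longlongrightarrow> 0 + \<beta> - 0 - \<beta>) at_ii"
    using \<beta> unfolding R_def[symmetric] by (intro tendsto_intros haupt_pole[OF f] haupt_pole[OF f'])
  then have lim: "(g \<longlongrightarrow> 0) at_ii" by (simp add: g_def[abs_def] algebra_simps)
  have "g \<tau> = 0" by (rule Gamma0_liouville[OF M hol inv bdd lim \<tau>])
  then show ?thesis by (simp add: g_def R_def algebra_simps)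
qed

text \<open>These are the square and trace relations in the limit at 0. Both terms of the trace tend
  to \<alpha>, since the coset matrix maps \<open>- 1 / \<tau>\<close> to
  \<open>- 1 / (\<tau> - M)\<close>. Once \<beta> is known, \<alpha>' determines \<alpha> and the
  coefficient of q.\<close>

lemma haupt_two_step:
  assumes f: "haupt N f F" and f': "haupt M f' F'" and NM: "N = 2 * M" "even M"
    and \<alpha>: "((\<lambda>\<tau>. f' (- 1 / \<tau>)) \<longlongrightarrow> \<alpha>') at_ii"
  obtains \<alpha> where "((\<lambda>\<tau>. f (- 1 / \<tau>)) \<longlongrightarrow> \<alpha>) at_ii" "\<alpha>\<^sup>2 = \<alpha>' + 2 * fps_nth F 2"
    "\<And>\<beta>. ((\<lambda>\<tau>. f (moebius (mat2 1 0 (int M) 1) \<tau>)) \<longlongrightarrow> \<beta>) at_ii \<Longrightarrow> 2 * \<alpha> = \<alpha>' + \<beta>"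
proof -
  have M: "M > 0" using f' by (simp add: haupt_def)
  have "int N \<noteq> 1" using NM(1) by presburger
  then have "Smat \<in> SL2Z" "Smat \<notin> Gamma0 N" by (simp_all add: Smat_def mat2_in_Gamma0 mat2_in_SL2Z)
  with f obtain \<alpha> where "((\<lambda>\<tau>. f (moebius Smat \<tau>)) \<longlongrightarrow> \<alpha>) at_ii" by (rule haupt_tendsto_cusp)
  then have l: "((\<lambda>\<tau>. f (- 1 / \<tau>)) \<longlongrightarrow> \<alpha>) at_ii" by (simp add: moebius_Smat)
  have "((\<lambda>\<tau>. (f (- 1 / \<tau>))\<^sup>2) \<longlongrightarrow> \<alpha>\<^sup>2) at_ii" by (intro tendsto_intros l)
  moreover have "((\<lambda>\<tau>. f' (- 1 / (\<tau> / of_nat 2)) + 2 * fps_nth F 2) \<longlongrightarrow> \<alpha>' + 2 * fps_nth F 2) at_ii"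
    by (intro tendsto_intros filterlim_compose[OF \<alpha> filterlim_at_ii_div]) simp
  moreover have "eventually (\<lambda>\<tau>. f' (- 1 / (\<tau> / of_nat 2)) + 2 * fps_nth F 2 = (f (- 1 / \<tau>))\<^sup>2) at_ii"
    using eventually_at_ii_Im_gt[of 0]
  proof eventually_elim
    case (elim \<tau>)
    then show ?case using haupt_square(1)[OF f f' NM Im_S[OF elim]] by simp
  qed
  ultimately have 1: "\<alpha>\<^sup>2 = \<alpha>' + 2 * fps_nth F 2"
    by (intro tendsto_unique[OF at_ii_neq_bot _ Lim_transform_eventually])
  have 2: "2 * \<alpha> = \<alpha>' + \<beta>" if \<beta>: "((\<lambda>\<tau>. f (moebius (mat2 1 0 (int M) 1) \<tau>)) \<longlongrightarrow> \<beta>) at_ii" for \<beta>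
  proof -
    have "((\<lambda>\<tau>. f (- 1 / \<tau>) + f (- 1 / (\<tau> + of_int (- int M)))) \<longlongrightarrow> \<alpha> + \<alpha>) at_ii"
      by (intro tendsto_intros l filterlim_compose[OF l filterlim_at_ii_add])
    moreover have "((\<lambda>\<tau>. f' (- 1 / \<tau>) + \<beta>) \<longlongrightarrow> \<alpha>' + \<beta>) at_ii" by (intro tendsto_intros \<alpha>)
    moreover have "eventually (\<lambda>\<tau>. f' (- 1 / \<tau>) + \<beta> = f (- 1 / \<tau>) + f (- 1 / (\<tau> + of_int (- int M)))) at_ii"
      using eventually_at_ii_Im_gt[of 0]
    proof eventually_elim
      case (elim \<tau>)
      have nz: "\<tau> \<noteq> 0" "\<tau> - of_nat M \<noteq> 0" using elim by (auto simp: complex_eq_iff)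
      have "of_int (int M) * (- 1 / \<tau>) + of_int 1 = (\<tau> - of_nat M) / \<tau>" using nz by (simp add: field_simps)
      then have "moebius (mat2 1 0 (int M) 1) (- 1 / \<tau>) = - 1 / (\<tau> + of_int (- int M))"
        unfolding moebius_mat2 using nz by simp
      then show ?case using haupt_trace[OF f f' NM \<beta> Im_S[OF elim]] by simp
    qed
    ultimately have "\<alpha> + \<alpha> = \<alpha>' + \<beta>"
      by (intro tendsto_unique[OF at_ii_neq_bot _ Lim_transform_eventually])
    then show ?thesis by simp
  qed
  show ?thesis using that[OF l 1 2] by blast
qed

text \<open>At level 4 translation by 1/2 exchanges the classes of the cusps 1/2 and 0 and changes
  the sign of \<open>f\<close>, so \<beta> = - \<alpha>.\<close>

lemma haupt_two_step_4:
  assumes f: "haupt 4 f F" and f': "haupt 2 f' F'" and \<alpha>: "((\<lambda>\<tau>. f' (- 1 / \<tau>)) \<longlongrightarrow> \<alpha>') at_ii"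
  obtains \<alpha> where "((\<lambda>\<tau>. f (- 1 / \<tau>)) \<longlongrightarrow> \<alpha>) at_ii" "\<alpha>\<^sup>2 = \<alpha>' + 2 * fps_nth F 2" "3 * \<alpha> = \<alpha>'"
proof -
  obtain \<alpha> where a: "((\<lambda>\<tau>. f (- 1 / \<tau>)) \<longlongrightarrow> \<alpha>) at_ii" "\<alpha>\<^sup>2 = \<alpha>' + 2 * fps_nth F 2"
    "\<And>\<beta>. ((\<lambda>\<tau>. f (moebius (mat2 1 0 (int 2) 1) \<tau>)) \<longlongrightarrow> \<beta>) at_ii \<Longrightarrow> 2 * \<alpha> = \<alpha>' + \<beta>"
    using haupt_two_step[OF f f' _ _ \<alpha>] by auto
  have "filterlim (\<lambda>\<tau>. 4 * \<tau> + 2) at_ii at_ii" using filterlim_at_ii_affine[of 4 2] by simp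
  from tendsto_minus[OF filterlim_compose[OF a(1) this]]
  have "((\<lambda>\<tau>. - f (- 1 / (4 * \<tau> + 2))) \<longlongrightarrow> - \<alpha>) at_ii" .
  moreover have "eventually (\<lambda>\<tau>. - f (- 1 / (4 * \<tau> + 2)) = f (moebius (mat2 1 0 (int 2) 1) \<tau>)) at_ii"
    using eventually_at_ii_Im_gt[of 0]
  proof eventually_elim
    case (elim \<tau>)
    define R where "R = mat2 1 0 (int 2) 1"
    have "Im (moebius R \<tau>) > 0" using elim by (intro Im_moebius_pos) (auto simp: R_def mat2_in_SL2Z)
    then have 1: "f (moebius R \<tau> + 1 / 2) = - f (moebius R \<tau>)" by (intro haupt_half_translate[OF f]) auto
    define s where "s = 2 * \<tau> + 1"
    have s: "s \<noteq> 0" "\<tau> = (s - 1) / 2" "4 * \<tau> + 2 = 2 * s" using elim by (auto simp: s_def complex_eq_iff)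
    have "moebius R \<tau> = \<tau> / s" by (simp add: R_def moebius_mat2 s_def)
    moreover have "\<tau> / s + 1 / 2 = - 1 / (2 * s) + 1" unfolding s(2) using s(1) by (simp add: field_simps)
    ultimately have 2: "moebius R \<tau> + 1 / 2 = - 1 / (4 * \<tau> + 2) + of_int 1" unfolding s(3) by simp
    have "Im (- 1 / (4 * \<tau> + 2)) > 0" using elim by (intro Im_S) simp
    then have "f (- 1 / (4 * \<tau> + 2) + of_int 1) = f (- 1 / (4 * \<tau> + 2))" by (rule haupt_translate[OF f])
    then have "f (- 1 / (4 * \<tau> + 2)) = - f (moebius R \<tau>)" unfolding 2[symmetric] 1 ..
    then show ?case by (simp add: R_def)
  qed
  ultimately have "((\<lambda>\<tau>. f (moebius (mat2 1 0 (int 2) 1) \<tau>)) \<longlongrightarrow> - \<alpha>) at_ii" by (rule Lim_transform_eventually)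
  from a(3)[OF this] have "3 * \<alpha> = \<alpha>'" by (simp add: algebra_simps)
  then show ?thesis using that a by blast
qed

text \<open>At levels divisible by 8, translation by 1/2 fixes the class of the cusp
  \<open>1 / M\<close>, so the sign change forces \<beta> = 0.\<close>

lemma haupt_two_step_8:
  assumes f: "haupt N f F" and f': "haupt M f' F'" and \<alpha>: "((\<lambda>\<tau>. f' (- 1 / \<tau>)) \<longlongrightarrow> \<alpha>') at_ii"
    and NM: "N = 8 * k" "M = 4 * k"
  obtains \<alpha> where "((\<lambda>\<tau>. f (- 1 / \<tau>)) \<longlongrightarrow> \<alpha>) at_ii" "\<alpha>\<^sup>2 = \<alpha>' + 2 * fps_nth F 2" "2 * \<alpha> = \<alpha>'"
proof -
  obtain \<alpha> where a: "((\<lambda>\<tau>. f (- 1 / \<tau>)) \<longlongrightarrow> \<alpha>) at_ii" "\<alpha>\<^sup>2 = \<alpha>' + 2 * fps_nth F 2"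
    "\<And>\<beta>. ((\<lambda>\<tau>. f (moebius (mat2 1 0 (int M) 1) \<tau>)) \<longlongrightarrow> \<beta>) at_ii \<Longrightarrow> 2 * \<alpha> = \<alpha>' + \<beta>"
    using haupt_two_step[OF f f' _ _ \<alpha>] NM by auto
  define R where "R = mat2 1 0 (int M) 1"
  have k: "k > 0" using f NM by (simp add: haupt_def)
  have R: "R \<in> SL2Z" "R \<notin> Gamma0 N" using NM k by (auto simp: R_def mat2_in_SL2Z mat2_in_Gamma0 zdvd_not_zless)
  with f obtain \<beta> where \<beta>: "((\<lambda>\<tau>. f (moebius R \<tau>)) \<longlongrightarrow> \<beta>) at_ii" by (rule haupt_tendsto_cusp)
  have "((\<lambda>\<tau>. - f (moebius R (\<tau> + 1 / 2))) \<longlongrightarrow> - \<beta>) at_ii"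
    by (intro tendsto_minus filterlim_compose[OF \<beta> filterlim_at_ii_add])
  moreover have "eventually (\<lambda>\<tau>. - f (moebius R (\<tau> + 1 / 2)) = f (moebius R \<tau>)) at_ii"
    using eventually_at_ii_Im_gt[of 0]
  proof eventually_elim
    case (elim \<tau>)
    define K where "K = int k"
    have "Im (moebius R \<tau>) > 0" using elim R(1) by (intro Im_moebius_pos)
    then have 1: "f (moebius R \<tau> + 1 / 2) = - f (moebius R \<tau>)" using NM by (intro haupt_half_translate[OF f]) auto
    \<comment> \<open>The commutator of translation by 1/2 with \<open>R\<close>; it is integral
      because 4 divides \<open>M\<close>.\<close>
    define B where "B = mat2 (1 + 2 * K + 4 * K\<^sup>2) (- K) (8 * K\<^sup>2) (1 - 2 * K)"
    have "int N dvd 8 * K\<^sup>2" unfolding NM K_def by (simp add: power2_eq_square)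
    then have B: "B \<in> Gamma0 N" unfolding B_def mat2_in_Gamma0 by (simp add: power2_eq_square algebra_simps)
    have Im2: "Im (moebius R (\<tau> + 1 / 2)) > 0" using elim R(1) by (intro Im_moebius_pos) auto
    define z where "z = of_int (4 * K) * \<tau> + (1 :: complex)"
    have z: "z \<noteq> 0" unfolding z_def using denom_nonzero[of \<tau> "4 * K" 1] elim by simp
    define w where "w = z + 2 * of_int K"
    have w: "w \<noteq> 0" unfolding w_def z_def using denom_nonzero[of \<tau> "4 * K" "1 + 2 * K"] elim k by (simp add: K_def add.assoc)
    have R1: "moebius R \<tau> = \<tau> / z" by (simp add: R_def moebius_mat2 z_def NM K_def)
    have R2: "moebius R (\<tau> + 1 / 2) = (\<tau> + 1 / 2) / w"
      by (simp add: R_def moebius_mat2 z_def w_def NM K_def algebra_simps)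
    have num: "of_int (1 + 2 * K + 4 * K\<^sup>2) * ((\<tau> + 1 / 2) / w) + of_int (- K) = (\<tau> + z / 2) / w"
      using w by (simp add: field_simps) (simp add: w_def z_def power2_eq_square algebra_simps)
    have den: "of_int (8 * K\<^sup>2) * ((\<tau> + 1 / 2) / w) + of_int (1 - 2 * K) = z / w"
      using w by (simp add: field_simps) (simp add: w_def z_def power2_eq_square algebra_simps)
    have 2: "moebius B (moebius R (\<tau> + 1 / 2)) = moebius R \<tau> + 1 / 2"
      unfolding R1 R2 unfolding B_def moebius_mat2 num den using w z by (simp add: field_simps)
    have "f (moebius R (\<tau> + 1 / 2)) = - f (moebius R \<tau>)" using haupt_inv[OF f B Im2] unfolding 2 1 ..
    then show ?case by simp
  qed
  ultimately have "((\<lambda>\<tau>. f (moebius R \<tau>)) \<longlongrightarrow> - \<beta>) at_ii" by (rule Lim_transform_eventually)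
  with \<beta> have "\<beta> = - \<beta>" by (rule tendsto_unique[OF at_ii_neq_bot])
  then have "\<beta> = 0" by simp
  with a(3)[OF \<beta>[unfolded R_def]] that a(1,2) show ?thesis by simp
qed

lemma haupt_4_values:
  assumes "haupt 4 f F" "haupt 2 f' F'"
  shows "fps_nth F 2 = 20" "fps_nth F 4 = - 62" "fps_nth F 6 = 216" "((\<lambda>\<tau>. f (- 1 / \<tau>)) \<longlongrightarrow> 8) at_ii"
proof -
  obtain Y where "((\<lambda>\<tau>. f' (- 1 / \<tau>)) \<longlongrightarrow> 24 / (of_nat 2 - 1)) at_ii"
    using haupt_prime_log_deriv[OF two_is_prime_nat assms(2)] by metis
  then have l: "((\<lambda>\<tau>. f' (- 1 / \<tau>)) \<longlongrightarrow> 24) at_ii" by simp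
  obtain \<alpha> where a: "((\<lambda>\<tau>. f (- 1 / \<tau>)) \<longlongrightarrow> \<alpha>) at_ii" "\<alpha>\<^sup>2 = 24 + 2 * fps_nth F 2" "3 * \<alpha> = 24"
    using haupt_two_step_4[OF assms l] .
  have \<alpha>: "\<alpha> = 8" using a(3) by simp
  show 2: "fps_nth F 2 = 20" using a(2) unfolding \<alpha> by simp
  have "fps_nth F 0 = 1" using assms(1) by (simp add: haupt_def)
  note sq = square_coeffs[OF haupt_square(2)[OF assms] this haupt_odd_coeff[OF assms(1)]]
  have "2 * (fps_nth F 4 + 62) = 0" using sq(1) 2 haupt_2_values(1)[OF assms(2)] by (simp add: algebra_simps)
  then have "fps_nth F 4 + 62 = 0" unfolding mult_eq_0_iff by simp
  then show 4: "fps_nth F 4 = - 62" unfolding eq_neg_iff_add_eq_0 .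
  show "fps_nth F 6 = 216" using sq(2) 2 4 haupt_2_values(2)[OF assms(2)] by simp
  show "((\<lambda>\<tau>. f (- 1 / \<tau>)) \<longlongrightarrow> 8) at_ii" using a(1) unfolding \<alpha> .
qed

text \<open>The value at 0 is halved, hence the form \<open>2 * \<alpha>\<close> of the hypothesis.
  The 0 in the last equation is the coefficient of \<open>q\<^sup>2\<close> in \<open>f'\<close>, an
  even power.\<close>

lemma haupt_8_step:
  assumes f: "haupt (8 * k) f F" and f': "haupt (4 * k) f' F'" and l: "((\<lambda>\<tau>. f' (- 1 / \<tau>)) \<longlongrightarrow> 2 * \<alpha>) at_ii"
  shows "((\<lambda>\<tau>. f (- 1 / \<tau>)) \<longlongrightarrow> \<alpha>) at_ii" "2 * fps_nth F 2 = \<alpha>\<^sup>2 - 2 * \<alpha>"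
    "2 * fps_nth F 4 + (fps_nth F 2)\<^sup>2 = fps_nth F' 2"
    "2 * fps_nth F 6 + 2 * fps_nth F 2 * fps_nth F 4 = 0"
proof -
  obtain \<alpha>' where a: "((\<lambda>\<tau>. f (- 1 / \<tau>)) \<longlongrightarrow> \<alpha>') at_ii" "\<alpha>'\<^sup>2 = 2 * \<alpha> + 2 * fps_nth F 2" "2 * \<alpha>' = 2 * \<alpha>"
    using haupt_two_step_8[OF f f' l refl refl] .
  then have \<alpha>: "\<alpha>' = \<alpha>" by simp
  show "((\<lambda>\<tau>. f (- 1 / \<tau>)) \<longlongrightarrow> \<alpha>) at_ii" "2 * fps_nth F 2 = \<alpha>\<^sup>2 - 2 * \<alpha>" using a unfolding \<alpha> by simp_all
  have F0: "fps_nth F 0 = 1" using f by (simp add: haupt_def)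
  have "F ^ 2 = (F' oo fps_X ^ 2) + fps_const (2 * fps_nth F 2) * fps_X ^ 2"
    by (rule haupt_square(2)[OF f f']) auto
  from square_coeffs[OF this F0 haupt_odd_coeff[OF f]]
  show "2 * fps_nth F 4 + (fps_nth F 2)\<^sup>2 = fps_nth F' 2"
    "2 * fps_nth F 6 + 2 * fps_nth F 2 * fps_nth F 4 = 0"
    using haupt_odd_coeff[OF f', of 3] by simp_all
qed

lemma haupt_8_values:
  assumes "haupt 8 f F" "haupt 4 f' F'" "haupt 2 f'' F''"
  shows "fps_nth F 2 = 4" "fps_nth F 4 = 2" "fps_nth F 6 = - 8" "((\<lambda>\<tau>. f (- 1 / \<tau>)) \<longlongrightarrow> 4) at_ii"
proof -
  note v = haupt_4_values[OF assms(2,3)]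
  have l: "((\<lambda>\<tau>. f' (- 1 / \<tau>)) \<longlongrightarrow> 2 * 4) at_ii" using v(4) by simp
  have h: "haupt (8 * 1) f F" "haupt (4 * 1) f' F'" using assms by simp_all
  note s = haupt_8_step[OF h l]
  show 2: "fps_nth F 2 = 4" using s(2) by simp
  show 4: "fps_nth F 4 = 2" using s(3) v(1) 2 by simp
  have "2 * (fps_nth F 6 + 8) = 0" using s(4) 2 4 by (simp add: algebra_simps)
  then have "fps_nth F 6 + 8 = 0" unfolding mult_eq_0_iff by simp
  then show "fps_nth F 6 = - 8" unfolding eq_neg_iff_add_eq_0 .
  show "((\<lambda>\<tau>. f (- 1 / \<tau>)) \<longlongrightarrow> 4) at_ii" using s(1) .
qed

lemma haupt_16_values:
  assumes "haupt 16 f F" "haupt 8 f1 F1" "haupt 4 f2 F2" "haupt 2 f3 F3"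
  shows "fps_nth F 2 = 0" "fps_nth F 4 = 2" "fps_nth F 6 = 0" "((\<lambda>\<tau>. f (- 1 / \<tau>)) \<longlongrightarrow> 2) at_ii"
proof -
  note v = haupt_8_values[OF assms(2,3,4)]
  have l: "((\<lambda>\<tau>. f1 (- 1 / \<tau>)) \<longlongrightarrow> 2 * 2) at_ii" using v(4) by simp
  have h: "haupt (8 * 2) f F" "haupt (4 * 2) f1 F1" using assms by simp_all
  note s = haupt_8_step[OF h l]
  show 2: "fps_nth F 2 = 0" using s(2) by simp
  show 4: "fps_nth F 4 = 2" using s(3) v(1) 2 by simp
  show "fps_nth F 6 = 0" using s(4) 2 4 by simp
  show "((\<lambda>\<tau>. f (- 1 / \<tau>)) \<longlongrightarrow> 2) at_ii" using s(1) .
qed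

section \<open>Vanishing coefficients at levels divisible by a square\<close>

text \<open>Reduction modulo \<open>h\<close> turns stability under all unit squares into a finite
  check.\<close>

lemma squares_closed:
  assumes S: "\<And>s r. s \<in> S \<Longrightarrow> 1 \<le> r \<Longrightarrow> r < h \<Longrightarrow> (s * r * r) mod h \<in> S" and h: "h > 1"
    and s: "s \<in> S" and d: "coprime d (int h)"
  shows "nat ((int s * d * d) mod int h) \<in> S"
proof -
  define r where "r = nat (d mod int h)"
  have r: "int r = d mod int h" using h by (simp add: r_def)
  have "r < h" using h unfolding r_def by (simp add: nat_less_iff)
  moreover have "r \<noteq> 0"
  proof
    assume "r = 0"
    then have "int h dvd d" using r by (simp add: dvd_eq_mod_eq_0)
    then have "is_unit (int h)" using d coprime_common_divisor[of d "int h" "int h"] by simp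
    then show False using h by simp
  qed
  ultimately have "(s * r * r) mod h \<in> S" using S s by simp
  moreover have "[int s * int r * int r = int s * d * d] (mod int h)"
    unfolding r by (intro cong_mult cong_refl) (simp_all add: cong_def)
  then have "int ((s * r * r) mod h) = (int s * d * d) mod int h"
    by (simp add: cong_def of_nat_mod)
  ultimately show ?thesis by (metis nat_int)
qed

section \<open>Exponential sums over quadratic residues\<close>

lemma qexp_of_real: "qexp (of_real t) = cis (2 * pi * t)"
proof -
  have "2 * of_real pi * \<i> * of_real t = \<i> * of_real (2 * pi * t)" by simp
  then show ?thesis unfolding qexp_def cis_conv_exp by (rule arg_cong)
qed

lemma qexp_rational:
  "qexp (of_nat k / of_nat h) = cis (2 * pi * (real k / real h))"
  "qexp (- of_nat k / of_nat h) = cis (- (2 * pi * (real k / real h)))"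
proof -
  have "of_nat k / of_nat h = complex_of_real (real k / real h)"
    "- of_nat k / of_nat h = complex_of_real (- (real k / real h))" by simp_all
  then show "qexp (of_nat k / of_nat h) = cis (2 * pi * (real k / real h))"
    "qexp (- of_nat k / of_nat h) = cis (- (2 * pi * (real k / real h)))"
    by (simp_all only: qexp_of_real mult_minus_right)
qed

lemma cos_rational_mod:
  assumes "h > 0"
  shows "cos (2 * pi * (real k / real h)) = cos (2 * pi * (real (k mod h) / real h))"
proof -
  have "real k = real h * real (k div h) + real (k mod h)" by (metis mult_div_mod_eq of_nat_add of_nat_mult)
  then have "2 * pi * (real k / real h) = 2 * pi * (real (k mod h) / real h) + 2 * of_int (int (k div h)) * pi"
    using assms by (simp add: field_simps)
  then show ?thesis by (simp add: cos_add)
qed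

lemma cos_rational_reflect:
  assumes "h > 0" "k \<le> h"
  shows "cos (2 * pi * (real (h - k) / real h)) = cos (2 * pi * (real k / real h))"
proof -
  have "2 * pi * (real (h - k) / real h) = 2 * pi - 2 * pi * (real k / real h)"
    using assms by (simp add: of_nat_diff field_simps)
  then show ?thesis by simp
qed

text \<open>The only unit square modulo 3 is 1, so surviving exponents are - 1 modulo 3. Here they
  are 1 and 3.\<close>

lemma haupt_9_vanish:
  assumes f: "haupt N f F" "9 dvd N"
  shows "fps_nth F 2 = 0" "fps_nth F 4 = 0"
proof -
  have cl: "(s * r * r) mod 3 \<in> {1}" if "s \<in> {1 :: nat}" "1 \<le> r" "r < 3" for s r
  proof -
    have "r = 1 \<or> r = 2" using that(2,3) by linarith
    then show ?thesis using that(1) by auto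
  qed
  have pos: "sin (2 * pi * (1 / 3)) > 0" by (intro sin_gt_zero) auto
  have v: "fps_nth F (Suc n) = 0"
    if "sin (2 * pi * (real n / 3)) \<noteq> - sin (2 * pi * (1 / 3))" for n
  proof (rule haupt_translations_coeff[OF f(1) _ _ _ squares_closed[OF cl]])
    show "(\<Sum>s\<in>{1}. qexp (of_nat (s * n) / of_nat 3)) \<noteq> (\<Sum>s\<in>{1}. qexp (- of_nat s / of_nat 3))"
    proof
      assume "(\<Sum>s\<in>{1}. qexp (of_nat (s * n) / of_nat 3)) = (\<Sum>s\<in>{1}. qexp (- of_nat s / of_nat 3))"
      then have "Im (\<Sum>s\<in>{1}. qexp (of_nat (s * n) / of_nat 3)) = Im (\<Sum>s\<in>{1}. qexp (- of_nat s / of_nat 3))" by simp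
      then show False using that unfolding Im_sum qexp_rational by simp
    qed
  qed (use f in auto)
  show "fps_nth F 2 = 0" using v[of 1] pos by (simp add: numeral_2_eq_2)
  show "fps_nth F 4 = 0" using v[of 3] pos by simp
qed

text \<open>Odd squares are 1 modulo 4, so surviving exponents are - 1 modulo 4. Here the exponent
  is 1.\<close>

lemma haupt_16_vanish:
  assumes f: "haupt N f F" "16 dvd N"
  shows "fps_nth F 2 = 0"
proof -
  have cl: "nat ((int s * d * d) mod int 4) \<in> {1}" if "s \<in> {1 :: nat}" "coprime d (int 4)" for s d
  proof -
    have "coprime d (2 * 2)" using that(2) by simp
    then have "odd d" by (metis coprime_mult_right_iff coprime_right_2_iff_odd)
    then obtain k where "d = 2 * k + 1" by (elim oddE)
    then have "d * d = 4 * (k * k + k) + 1" by (simp add: algebra_simps)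
    moreover have "(4 * x + 1) mod 4 = 1" for x :: int by presburger
    ultimately have "(d * d) mod 4 = 1" by (simp only:)
    then show ?thesis using that(1) by simp
  qed
  have pos: "sin (2 * pi * (1 / 4)) > 0" by (intro sin_gt_zero) auto
  have "fps_nth F (Suc 1) = 0"
  proof (rule haupt_translations_coeff[OF f(1) _ _ _ cl])
    show "(\<Sum>s\<in>{1}. qexp (of_nat (s * 1) / of_nat 4)) \<noteq> (\<Sum>s\<in>{1}. qexp (- of_nat s / of_nat 4))"
    proof
      assume "(\<Sum>s\<in>{1}. qexp (of_nat (s * 1) / of_nat 4)) = (\<Sum>s\<in>{1}. qexp (- of_nat s / of_nat 4))"
      then have "Im (\<Sum>s\<in>{1}. qexp (of_nat (s * 1) / of_nat 4)) = Im (\<Sum>s\<in>{1}. qexp (- of_nat s / of_nat 4))" by simp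
      then show False using pos unfolding Im_sum qexp_rational by simp
    qed
  qed (use f in auto)
  then show ?thesis by (simp add: numeral_2_eq_2)
qed

text \<open>1 and 4 are the unit squares modulo 5. As - 1 is one of them, the sums are real; the
  exponents 2 and 3 are nonresidues and give the other Gauss period.\<close>

lemma haupt_25_vanish:
  assumes f: "haupt N f F" "25 dvd N"
  shows "fps_nth F 3 = 0" "fps_nth F 4 = 0"
proof -
  have cl: "(s * r * r) mod 5 \<in> {1, 4}" if "s \<in> {1, 4 :: nat}" "1 \<le> r" "r < 5" for s r
  proof -
    have "r = 1 \<or> r = 2 \<or> r = 3 \<or> r = 4" using that(2,3) by presburger
    then show ?thesis using that(1) by (elim disjE) auto
  qed
  define e where "e k = cos (2 * pi * (real k / real 5))" for k
  have red: "e k = e (k mod 5)" "j \<le> 5 \<Longrightarrow> e (5 - j) = e j" for k j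
    unfolding e_def by (rule cos_rational_mod, simp) (rule cos_rational_reflect, simp_all)
  have "e 2 < e 1" unfolding e_def by (intro cos_monotone_0_pi) auto
  moreover have "e 3 = e 2" "e 4 = e 1" using red(2)[of 2] red(2)[of 1] by simp_all
  moreover have "e 8 = e 3" "e 12 = e 2" using red(1)[of 8] red(1)[of 12] by simp_all
  ultimately have ne: "e 2 + e 8 \<noteq> e 1 + e 4" "e 3 + e 12 \<noteq> e 1 + e 4" by simp_all
  have v: "fps_nth F (Suc n) = 0" if "e n + e (4 * n) \<noteq> e 1 + e 4" for n
  proof (rule haupt_translations_coeff[OF f(1) _ _ _ squares_closed[OF cl]])
    show "(\<Sum>s\<in>{1, 4}. qexp (of_nat (s * n) / of_nat 5)) \<noteq> (\<Sum>s\<in>{1, 4}. qexp (- of_nat s / of_nat 5))"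
    proof
      assume "(\<Sum>s\<in>{1, 4}. qexp (of_nat (s * n) / of_nat 5)) = (\<Sum>s\<in>{1, 4}. qexp (- of_nat s / of_nat 5))"
      then have "Re (\<Sum>s\<in>{1, 4}. qexp (of_nat (s * n) / of_nat 5)) = Re (\<Sum>s\<in>{1, 4}. qexp (- of_nat s / of_nat 5))" by simp
      then show False using that unfolding Re_sum qexp_rational by (simp add: e_def)
    qed
  qed (use f in auto)
  show "fps_nth F 3 = 0" using v[of 2] ne by (simp add: numeral_3_eq_3 numeral_2_eq_2)
  show "fps_nth F 4 = 0" using v[of 3] ne by simp
qed

text \<open>1, 2, 4 are the unit squares modulo 7 and - 1 is not a square. For exponent 1 the two
  sums are conjugate, told apart by their imaginary parts.\<close>

lemma haupt_49_vanish:
  assumes f: "haupt N f F" "49 dvd N"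
  shows "fps_nth F 2 = 0"
proof -
  have cl: "(s * r * r) mod 7 \<in> {1, 2, 4}" if "s \<in> {1, 2, 4 :: nat}" "1 \<le> r" "r < 7" for s r
  proof -
    have "r = 1 \<or> r = 2 \<or> r = 3 \<or> r = 4 \<or> r = 5 \<or> r = 6" using that(2,3) by presburger
    then show ?thesis using that(1) by (elim disjE) auto
  qed
  define e where "e k = sin (2 * pi * (real k / real 7))" for k
  have "e 4 = - sin (pi / 7)"
  proof -
    have "2 * pi * (real 4 / real 7) = pi + pi / 7" by simp
    then show ?thesis unfolding e_def by (simp only: sin_periodic_pi2)
  qed
  moreover have "e 1 > sin (pi / 7)" unfolding e_def using pi_gt_zero by (intro sin_monotone_2pi) (simp_all add: field_simps)
  moreover have "e 2 > 0" unfolding e_def by (intro sin_gt_zero) auto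
  ultimately have pos: "e 1 + e 2 + e 4 > 0" by simp
  have "fps_nth F (Suc 1) = 0"
  proof (rule haupt_translations_coeff[OF f(1) _ _ _ squares_closed[OF cl]])
    show "(\<Sum>s\<in>{1, 2, 4}. qexp (of_nat (s * 1) / of_nat 7)) \<noteq> (\<Sum>s\<in>{1, 2, 4}. qexp (- of_nat s / of_nat 7))"
    proof
      assume "(\<Sum>s\<in>{1, 2, 4}. qexp (of_nat (s * 1) / of_nat 7)) = (\<Sum>s\<in>{1, 2, 4}. qexp (- of_nat s / of_nat 7))"
      then have "Im (\<Sum>s\<in>{1, 2, 4}. qexp (of_nat (s * 1) / of_nat 7)) = Im (\<Sum>s\<in>{1, 2, 4}. qexp (- of_nat s / of_nat 7))" by simp
      then show False using pos unfolding Im_sum qexp_rational by (simp add: e_def)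
    qed
  qed (use f in auto)
  then show ?thesis by (simp add: numeral_2_eq_2)
qed

text \<open>The exponents 2 and 5 are nonresidues modulo 13; the two Gauss periods are separated by
  their signs.\<close>

lemma haupt_169_vanish:
  assumes f: "haupt N f F" "169 dvd N"
  shows "fps_nth F 3 = 0" "fps_nth F 6 = 0"
proof -
  define S where "S = {1, 3, 4, 9, 10, 12 :: nat}"
  have cl: "(s * r * r) mod 13 \<in> S" if "s \<in> S" "1 \<le> r" "r < 13" for s r
  proof -
    have "r = 1 \<or> r = 2 \<or> r = 3 \<or> r = 4 \<or> r = 5 \<or> r = 6 \<or> r = 7 \<or> r = 8 \<or> r = 9 \<or> r = 10 \<or> r = 11 \<or> r = 12" using that(2,3) by presburger
    then show ?thesis using that(1) unfolding S_def by (elim disjE) auto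
  qed
  define e where "e k = cos (2 * pi * (real k / real 13))" for k
  have red: "e k = e (k mod 13)" "j \<le> 13 \<Longrightarrow> e (13 - j) = e j" for k j
    unfolding e_def by (rule cos_rational_mod, simp) (rule cos_rational_reflect, simp_all)
  have half: "e 4 = - cos (5 * pi / 13)" "e 5 = - cos (3 * pi / 13)"
  proof -
    have "2 * pi * (real 4 / real 13) = pi - 5 * pi / 13" "2 * pi * (real 5 / real 13) = pi - 3 * pi / 13" by simp_all
    then show "e 4 = - cos (5 * pi / 13)" "e 5 = - cos (3 * pi / 13)" unfolding e_def by (simp_all only: cos_pi_minus)
  qed
  have "cos (5 * pi / 13) < e 1" unfolding e_def by (intro cos_monotone_0_pi) auto
  moreover have "e 3 > 0" unfolding e_def by (intro cos_gt_zero) auto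
  ultimately have pos: "e 1 + e 3 + e 4 > 0" using half by simp
  have "e 2 < cos (3 * pi / 13)" unfolding e_def by (intro cos_monotone_0_pi) auto
  moreover have "e 6 < e 5" unfolding e_def by (intro cos_monotone_0_pi) auto
  moreover have "e 5 < 0" using half cos_gt_zero[of "3 * pi / 13"] by simp
  ultimately have neg: "e 2 + e 5 + e 6 < 0" using half by simp
  have refl: "e 7 = e 6" "e 8 = e 5" "e 9 = e 4" "e 10 = e 3" "e 11 = e 2" "e 12 = e 1"
    using red(2)[of 6] red(2)[of 5] red(2)[of 4] red(2)[of 3] red(2)[of 2] red(2)[of 1] by simp_all
  have big: "e 15 = e 2" "e 18 = e 5" "e 20 = e 7" "e 24 = e 11" "e 45 = e 6" "e 50 = e 11" "e 60 = e 8"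
    using red(1)[of 15] red(1)[of 18] red(1)[of 20] red(1)[of 24] red(1)[of 45] red(1)[of 50] red(1)[of 60] by simp_all
  have v: "fps_nth F (Suc n) = 0" if "(\<Sum>s\<in>S. e (s * n)) \<noteq> (\<Sum>s\<in>S. e s)" for n
  proof (rule haupt_translations_coeff[OF f(1) _ _ _ squares_closed[OF cl]])
    show "(\<Sum>s\<in>S. qexp (of_nat (s * n) / of_nat 13)) \<noteq> (\<Sum>s\<in>S. qexp (- of_nat s / of_nat 13))"
    proof
      assume "(\<Sum>s\<in>S. qexp (of_nat (s * n) / of_nat 13)) = (\<Sum>s\<in>S. qexp (- of_nat s / of_nat 13))"
      then have "Re (\<Sum>s\<in>S. qexp (of_nat (s * n) / of_nat 13)) = Re (\<Sum>s\<in>S. qexp (- of_nat s / of_nat 13))" by simp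
      then show False using that unfolding Re_sum qexp_rational e_def by simp
    qed
  qed (use f in \<open>auto simp: S_def\<close>)
  have "(\<Sum>s\<in>S. e s) = 2 * (e 1 + e 3 + e 4)" by (simp add: S_def refl)
  moreover have "(\<Sum>s\<in>S. e (s * 2)) = 2 * (e 2 + e 5 + e 6)" by (simp add: S_def refl big)
  moreover have "(\<Sum>s\<in>S. e (s * 5)) = 2 * (e 2 + e 5 + e 6)" by (simp add: S_def refl big)
  ultimately have "(\<Sum>s\<in>S. e (s * 2)) \<noteq> (\<Sum>s\<in>S. e s)" "(\<Sum>s\<in>S. e (s * 5)) \<noteq> (\<Sum>s\<in>S. e s)"
    using pos neg by simp_all
  then show "fps_nth F 3 = 0" "fps_nth F 6 = 0" using v[of 2] v[of 5] by simp_all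
qed

text \<open>The value 2 at the cusp 0 for level 16 would give 1 for level 32, and with it the
  coefficient - 1/2 of q, which has to vanish.\<close>

lemma haupt_32_False:
  assumes "haupt 32 f0 F0" "haupt 16 f F" "haupt 8 f1 F1" "haupt 4 f2 F2" "haupt 2 f3 F3"
  shows False
proof -
  have l: "((\<lambda>\<tau>. f (- 1 / \<tau>)) \<longlongrightarrow> 2 * 1) at_ii" using haupt_16_values(4)[OF assms(2-)] by simp
  have h: "haupt (8 * 4) f0 F0" "haupt (4 * 4) f F" using assms by simp_all
  have "2 * fps_nth F0 2 = 1\<^sup>2 - 2 * 1" by (rule haupt_8_step(2)[OF h l])
  then show False using haupt_16_vanish[OF assms(1)] by simp
qed

section \<open>Traces and Sylow subgroups\<close>

context graded_group_module
begin

lemma act_add: "g \<in> carrier G \<Longrightarrow> act g (x + y) = act g x + act g y"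
  using act_linear by (metis Vector_Spaces.linear_iff)

lemma act_scale: "g \<in> carrier G \<Longrightarrow> act g (smul c x) = smul c (act g x)"
  using act_linear by (metis Vector_Spaces.linear_iff)

lemma act_sum: "g \<in> carrier G \<Longrightarrow> act g (\<Sum>x\<in>A. f x) = (\<Sum>x\<in>A. act g (f x))"
proof (induction A rule: infinite_finite_induct)
  case empty
  have "act g (0 + 0) = act g 0 + act g 0" using empty by (rule act_add)
  then show ?case by simp
next
  case (infinite A)
  have "act g (0 + 0) = act g 0 + act g 0" using infinite(2) by (rule act_add)
  with infinite show ?case by simp
qed (simp add: act_add)

text \<open>The averaging operator over \<open>H\<close> is idempotent, so its trace is the dimension of its image.\<close>

theorem sum_trace_subgroup:
  assumes H: "subgroup H G" and fin: "finite H" and n: "n \<ge> -1" and fd: "finite_dim_subspace smul (V n)"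
  obtains m where "(\<Sum>h\<in>H. trace_on smul (V n) (act h)) = of_nat (card H * m)"
proof -
  have HG: "h \<in> H \<Longrightarrow> h \<in> carrier G" for h using H by (rule subgroup.mem_carrier)
  have card: "card H > 0" using fin subgroup.one_closed[OF H] by (auto simp: card_gt_0_iff)
  define c :: complex where "c = 1 / of_nat (card H)"
  have c: "of_nat (card H) * c = 1" using card by (simp add: c_def)
  define \<pi> where "\<pi> v = smul c (\<Sum>h\<in>H. act h v)" for v
  define W where "W = {v \<in> V n. \<forall>h\<in>H. act h v = v}"
  have sub: "subspace (V n)" using n by (rule grading_subspace)
  have actV: "act h v \<in> V n" if "h \<in> H" "v \<in> V n" for h v
    using grading_invariant[OF n HG[OF that(1)]] that(2) by blast
  have \<pi>_fix: "\<pi> v = v" if "v \<in> W" for v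
  proof -
    have "\<pi> v = smul c (\<Sum>h\<in>H. v)" using that unfolding \<pi>_def W_def by simp
    also have "(\<Sum>h\<in>H. v) = smul (of_nat (card H)) v" by (simp add: sum_constant_scale)
    finally show ?thesis using c by (simp add: mult.commute)
  qed
  have \<pi>_W: "\<pi> v \<in> W" if "v \<in> V n" for v
  proof -
    have "act k (\<pi> v) = \<pi> v" if k: "k \<in> H" for k
    proof -
      have "act k (\<pi> v) = smul c (\<Sum>h\<in>H. act (k \<otimes>\<^bsub>G\<^esub> h) v)"
        unfolding \<pi>_def using k HG by (simp add: act_scale act_sum act_mult)
      also have "(\<Sum>h\<in>H. act (k \<otimes>\<^bsub>G\<^esub> h) v) = (\<Sum>h\<in>H. act h v)"
      proof (rule sum.reindex_bij_betw)
        have mc: "\<And>x y. x \<in> H \<Longrightarrow> y \<in> H \<Longrightarrow> x \<otimes>\<^bsub>G\<^esub> y \<in> H" using subgroup.m_closed[OF H] .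
        have ic: "inv\<^bsub>G\<^esub> k \<in> H" using subgroup.m_inv_closed[OF H k] .
        show "bij_betw (\<lambda>h. k \<otimes>\<^bsub>G\<^esub> h) H H"
          by (rule bij_betwI[of _ _ _ "\<lambda>h. inv\<^bsub>G\<^esub> k \<otimes>\<^bsub>G\<^esub> h"])
            (use mc ic k HG in \<open>auto simp flip: grp.m_assoc\<close>)
      qed
      finally show ?thesis by (simp add: \<pi>_def)
    qed
    moreover have "\<pi> v \<in> V n"
      unfolding \<pi>_def using actV that by (intro subspace_scale subspace_sum sub) auto
    ultimately show ?thesis by (simp add: W_def)
  qed
  \<comment> \<open>A basis of the invariants, extended to one of \<open>V n\<close>: the averaging
    operator has diagonal entries 1 on \<open>B\<close> and 0 elsewhere.\<close>
  obtain B where B: "B \<subseteq> W" "independent B" "W \<subseteq> span B"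
    using maximal_independent_subset[of W] by blast
  have "B \<subseteq> V n" using B(1) by (auto simp: W_def)
  then obtain C where C: "B \<subseteq> C" "C \<subseteq> V n" "independent C" "V n \<subseteq> span C"
    using maximal_independent_subset_extend[of B "V n"] B(2) by blast
  have spanC: "span C = V n" using C span_minimal[OF C(2) sub] by blast
  obtain T where T: "finite T" "span T = V n" using fd unfolding finite_dim_subspace_def by blast
  have finC: "finite C" using independent_span_bound[OF T(1) C(3)] C(2) T(2) by blast
  have rep: "(\<Sum>h\<in>H. representation C (act h x) x) = of_nat (card H) * (if x \<in> B then 1 else 0)" if x: "x \<in> C" for x
  proof -
    have xV: "x \<in> V n" using x C by blast
    have "representation C (\<pi> x) x = c * (\<Sum>h\<in>H. representation C (act h x) x)"
    proof -
      have "act h x \<in> span C" if "h \<in> H" for h using actV[OF that xV] spanC by blast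
      then show ?thesis unfolding \<pi>_def
        by (subst representation_scale[OF C(3)], intro span_sum) (simp_all add: representation_sum[OF C(3)])
    qed
    moreover have "representation C (\<pi> x) x = (if x \<in> B then 1 else 0)"
    proof (cases "x \<in> B")
      case True
      then have "\<pi> x = x" using B by (intro \<pi>_fix) blast
      then show ?thesis using True representation_basis[OF C(3) x] by simp
    next
      case False
      have "\<pi> x \<in> span B" using \<pi>_W[OF xV] B(3) by blast
      then have "representation C (\<pi> x) = representation B (\<pi> x)" by (rule representation_extend[OF C(3) _ C(1)])
      then show ?thesis using False representation_ne_zero by auto
    qed
    ultimately have "of_nat (card H) * (c * (\<Sum>h\<in>H. representation C (act h x) x)) = of_nat (card H) * (if x \<in> B then 1 else 0)" by simp
    then show ?thesis using c by (simp add: mult.assoc[symmetric])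
  qed
  have "(\<Sum>h\<in>H. trace_on smul (V n) (act h)) = (\<Sum>h\<in>H. \<Sum>x\<in>C. representation C (act h x) x)"
    using HG grading_invariant[OF n] by (intro sum.cong refl trace_on_eq act_linear finC C(3) spanC) auto
  also have "\<dots> = (\<Sum>x\<in>C. of_nat (card H) * (if x \<in> B then 1 else 0))"
    by (subst sum.swap) (simp add: rep)
  also have "\<dots> = of_nat (card H) * of_nat (card B)"
    using finC C(1) by (simp add: sum_distrib_left[symmetric] sum.If_cases Int_absorb1)
  finally show ?thesis by (intro that[of "card B"]) simp
qed

end

text \<open>What remains of the module: one Hauptmodul series per element and divisibility of sums
  over subgroups. Index \<open>k\<close> belongs to degree \<open>k - 1\<close>.\<close>

locale hauptmodul_series = group G for G (structure) +
  fixes F :: "'a \<Rightarrow> complex fps"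
  assumes finite_carrier: "finite (carrier G)"
    and haupt_series: "g \<in> carrier G \<Longrightarrow> \<exists>f. haupt (ord g) f (F g)"
    and sum_series: "subgroup H G \<Longrightarrow> \<exists>m::nat. (\<Sum>h\<in>H. fps_nth (F h) k) = of_nat (card H * m)"
begin

lemma one_values:
  "fps_nth (F \<one>) 0 = 1" "fps_nth (F \<one>) 2 = 196884" "fps_nth (F \<one>) 3 = 21493760"
  "fps_nth (F \<one>) 4 = 864299970" "fps_nth (F \<one>) 6 = 333202640600"
proof -
  obtain f where f: "haupt 1 f (F \<one>)" using haupt_series[OF one_closed] by (auto simp: ord_id)
  show "fps_nth (F \<one>) 0 = 1" using f by (simp add: haupt_def)
  show "fps_nth (F \<one>) 2 = 196884" "fps_nth (F \<one>) 3 = 21493760"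
    "fps_nth (F \<one>) 4 = 864299970" "fps_nth (F \<one>) 6 = 333202640600"
    using level_one_values[OF f] by simp_all
qed

lemma ord_dvd_card:
  assumes H: "subgroup H G" and h: "h \<in> H"
  shows "ord h dvd card H"
proof -
  interpret K: group "G\<lparr>carrier := H\<rparr>" using H by (rule subgroup_imp_group)
  have "h [^]\<^bsub>G\<lparr>carrier := H\<rparr>\<^esub> Coset.order (G\<lparr>carrier := H\<rparr>) = \<one>\<^bsub>G\<lparr>carrier := H\<rparr>\<^esub>"
    by (rule K.pow_order_eq_1) (use h in simp)
  then have "h [^] card H = \<one>"
    by (simp add: Coset.order_def nat_pow_consistent[symmetric])
  then show ?thesis using pow_eq_id[OF subgroup.mem_carrier[OF H h]] by simp
qed

lemma ord_prime_power:
  assumes H: "subgroup H G" "card H = p ^ a" and p: "prime p" and h: "h \<in> H" "h \<noteq> \<one>"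
  obtains j where "ord h = p ^ Suc j"
proof -
  have hG: "h \<in> carrier G" using H(1) h(1) by (rule subgroup.mem_carrier)
  have "ord h dvd p ^ a" using ord_dvd_card[OF H(1) h(1)] H(2) by simp
  then obtain i where i: "ord h = p ^ i" using divides_primepow_nat[OF p] by blast
  have "i \<noteq> 0" using i ord_eq_1[OF hG] h(2) by auto
  then obtain j where "i = Suc j" by (cases i) auto
  then show ?thesis using i by (intro that[of j]) simp
qed

text \<open>Powers of an element supply the Hauptmoduln of lower level on which the values at levels
  4, 8 and 16 rest.\<close>

lemma haupt_pow:
  assumes "g \<in> carrier G" "ord g = d * e" "d > 0"
  shows "\<exists>f. haupt e f (F (g [^] d))"
proof -
  have "ord (g [^] d) = e" using assms by (subst ord_pow) auto
  then show ?thesis using haupt_series[of "g [^] d"] assms(1) by simp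
qed

text \<open>The list \<open>xs\<close> encodes an integral functional on coefficient sequences that kills all nontrivial
  elements of \<open>p\<close>-power order, so that only \<open>J\<close> contributes to its sum over a Sylow subgroup.\<close>

lemma multiplicity_order_le:
  fixes xs :: "(nat \<times> int) list"
  assumes p: "prime p"
    and zero: "\<And>h j. h \<in> carrier G \<Longrightarrow> ord h = p ^ Suc j \<Longrightarrow> (\<Sum>(k, c)\<leftarrow>xs. of_int c * fps_nth (F h) k) = 0"
    and one: "(\<Sum>(k, c)\<leftarrow>xs. of_int c * fps_nth (F \<one>) k) = of_int z"
    and z: "\<not> int (p ^ Suc b) dvd z"
  shows "multiplicity p (Coset.order G) \<le> b"
proof -
  define a where "a = multiplicity p (Coset.order G)"
  obtain m where "Coset.order G = p ^ a * m" unfolding a_def using multiplicity_dvd by (metis dvdE)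
  then obtain H where H: "subgroup H G" "card H = p ^ a"
    using sylow_thm[OF p is_group _ finite_carrier] by blast
  have fin: "finite H" using H(1) finite_carrier by (metis subgroup.subset finite_subset)
  have average: "\<exists>M. (\<Sum>h\<in>H. \<Sum>(k, c)\<leftarrow>ys. of_int c * fps_nth (F h) k) = (of_int (int (card H) * M) :: complex)"
    for ys :: "(nat \<times> int) list"
  proof (induction ys)
    case Nil
    show ?case by (auto intro: exI[of _ 0])
  next
    case (Cons y ys)
    obtain k c where y: "y = (k, c)" by (cases y)
    obtain M where M: "(\<Sum>h\<in>H. \<Sum>(k, c)\<leftarrow>ys. of_int c * fps_nth (F h) k) = (of_int (int (card H) * M) :: complex)"
      using Cons by blast
    obtain m :: nat where m: "(\<Sum>h\<in>H. fps_nth (F h) k) = of_nat (card H * m)" using sum_series[OF H(1)] by blast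
    have "(\<Sum>h\<in>H. \<Sum>(k, c)\<leftarrow>y # ys. of_int c * fps_nth (F h) k)
        = of_int c * (\<Sum>h\<in>H. fps_nth (F h) k) + of_int (int (card H) * M)"
      by (simp add: y sum.distrib M sum_distrib_left)
    also have "\<dots> = of_int (int (card H) * (c * int m + M))" unfolding m by (simp add: algebra_simps)
    finally show ?case by blast
  qed
  obtain M where M: "(\<Sum>h\<in>H. \<Sum>(k, c)\<leftarrow>xs. of_int c * fps_nth (F h) k) = (of_int (int (card H) * M) :: complex)"
    using average by blast
  have "(\<Sum>h\<in>H - {\<one>}. \<Sum>(k, c)\<leftarrow>xs. of_int c * fps_nth (F h) k) = 0"
  proof (rule sum.neutral, rule ballI)
    fix h assume h: "h \<in> H - {\<one>}"
    then obtain j where "ord h = p ^ Suc j" using ord_prime_power[OF H p] by blast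
    then show "(\<Sum>(k, c)\<leftarrow>xs. of_int c * fps_nth (F h) k) = 0" using h H(1) by (intro zero subgroup.mem_carrier) auto
  qed
  then have "(\<Sum>h\<in>H. \<Sum>(k, c)\<leftarrow>xs. of_int c * fps_nth (F h) k) = of_int z"
    using one fin subgroup.one_closed[OF H(1)] by (subst sum.remove[of _ \<one>]) auto
  with M have "z = int (card H) * M" by (metis of_int_eq_iff)
  then have pz: "int (p ^ a) dvd z" unfolding H(2) by simp
  show ?thesis
  proof (rule ccontr)
    assume "\<not> ?thesis"
    then have "Suc b \<le> a" by (simp add: a_def)
    then have "int (p ^ Suc b) dvd int (p ^ a)" by (metis le_imp_power_dvd int_dvd_int_iff)
    with pz z show False using dvd_trans by blast
  qed
qed

text \<open>All nontrivial elements of a subgroup of order \<open>p\<close> share one coefficient of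
  q. Its denominator \<open>p - 1\<close> is cleared before reading the sum modulo
  \<open>p\<close>.\<close>

lemma prime_dvd_order:
  assumes p: "prime p" "p dvd Coset.order G"
  shows "p \<in> {2, 3, 5, 7, 13}"
proof (cases "p = 2")
  case False
  then have p2: "p > 2" using prime_ge_2_nat[OF p(1)] by simp
  obtain m where "Coset.order G = p ^ 1 * m" using p(2) by auto
  then obtain H where H: "subgroup H G" "card H = p ^ 1" using sylow_thm[OF p(1) is_group _ finite_carrier] by blast
  have fin: "finite H" using H(1) finite_carrier by (metis subgroup.subset finite_subset)
  have hG: "h \<in> carrier G" if "h \<in> H" for h using H(1) that by (rule subgroup.mem_carrier)
  define v :: complex where "v = 12 * (24 / (of_nat p - 1) - 3) / (of_nat p - 1)"
  have val: "fps_nth (F h) 2 = v" if h: "h \<in> H - {\<one>}" for h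
  proof -
    obtain j where j: "ord h = p ^ Suc j" using ord_prime_power[OF H p(1)] h by blast
    obtain f where f: "haupt (p ^ Suc j) f (F h)" using haupt_series[OF hG, of h] h unfolding j by blast
    have "ord h dvd card H" using ord_dvd_card[OF H(1)] h by simp
    then have "ord h \<le> card H" using H(2) p2 by (intro dvd_imp_le) auto
    then have "p ^ Suc j \<le> p ^ 1" using H(2) j by simp
    then have "j = 0" using p2 by (subst (asm) power_increasing_iff) auto
    then have "haupt p f (F h)" using f by simp
    then show ?thesis unfolding v_def by (rule haupt_prime_coeff_2[OF p(1) p2])
  qed
  obtain m :: nat where m: "(\<Sum>h\<in>H. fps_nth (F h) 2) = of_nat (card H * m)" using sum_series[OF H(1)] by blast
  have "(\<Sum>h\<in>H. fps_nth (F h) 2) = 196884 + (\<Sum>h\<in>H - {\<one>}. v)"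
    using fin subgroup.one_closed[OF H(1)] val one_values(2) by (subst sum.remove[of _ \<one>]) auto
  also have "(\<Sum>h\<in>H - {\<one>}. v) = of_nat (p - 1) * v"
    using fin subgroup.one_closed[OF H(1)] H(2) by simp
  also have "of_nat (p - 1) = (of_nat p - 1 :: complex)" using p2 by simp
  also have "(of_nat p - 1) * v = 12 * (24 / (of_nat p - 1) - 3)"
    using p2 unfolding v_def by (simp add: of_nat_eq_1_iff)
  finally have e: "of_nat p * of_nat m = 196884 + 12 * (24 / (of_nat p - 1) - 3 :: complex)" using m H(2) by simp
  define P where "P = (of_nat p - 1 :: complex)"
  have P: "P \<noteq> 0" using p2 by (simp add: P_def)
  have "of_nat p * of_nat m * P = 196884 * P + 12 * (24 - 3 * P)"
    using P unfolding e P_def[symmetric] by (simp add: field_simps)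
  \<comment> \<open>Here \<open>196848 = 196884 - 12 * 3\<close> and
    \<open>196560 = 196848 - 12 * 24\<close>.\<close>
  then have "of_nat p * of_nat m * (of_nat p - 1 :: complex) = 196848 * of_nat p - 196560"
    unfolding P_def by (simp add: algebra_simps)
  then have "(of_int (int p * int m * (int p - 1)) :: complex) = of_int (196848 * int p - 196560)" by simp
  then have "int p * int m * (int p - 1) = 196848 * int p - 196560" unfolding of_int_eq_iff .
  then have "196560 = int p * (196848 - int m * (int p - 1))" by (simp add: algebra_simps)
  then have "int p dvd int 196560" by (metis dvd_triv_left of_nat_numeral)
  then have "p dvd 196560" by (simp only: int_dvd_int_iff)
  then have "p dvd 2 ^ 4 * 3 ^ 3 * 5 * 7 * 13" by simp
  then have "p dvd 2 \<or> p dvd 3 \<or> p dvd 5 \<or> p dvd 7 \<or> p dvd 13"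
    using p(1) unfolding prime_dvd_mult_iff[OF p(1)] using prime_dvd_power[OF p(1)] by blast
  moreover have "prime (3::nat)" "prime (5::nat)" "prime (7::nat)" "prime (13::nat)" by simp_all
  ultimately show ?thesis using p(1) False primes_dvd_imp_eq two_is_prime_nat by blast
qed simp

text \<open>The entries at even indices cancel at levels 4, 8, 16. Index 3 vanishes there, so it is
  free to cancel level 2, where the rest is \<open>112 * 2048\<close>. The value at level one is
  \<open>2 ^ 25 * 10105\<close>.\<close>

lemma multiplicity_2: "multiplicity 2 (Coset.order G) \<le> 25"
proof (rule multiplicity_order_le[where z = 339067535360 and xs = "[(6, 1), (4, 4), (2, 2), (0, - 8), (3, 112)]"])
  fix h j assume h: "h \<in> carrier G" "ord h = 2 ^ Suc j"
  obtain f where f: "haupt (2 ^ Suc j) f (F h)" using haupt_series[OF h(1)] h(2) by auto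
  have pw: "\<exists>f. haupt (2 ^ i) f (F (h [^] (2 ^ (Suc j - i) :: nat)))" if "i \<le> Suc j" for i
    using that h by (intro haupt_pow) (auto simp flip: power_add)
  have F0: "fps_nth (F h) 0 = 1" using f by (simp add: haupt_def)
  have F3: "fps_nth (F h) 3 = 0" if "j > 0"
  proof (rule haupt_odd_coeff[OF f])
    show "4 dvd (2::nat) ^ Suc j" using that le_imp_power_dvd[of 2 "Suc j" "2::nat"] by simp
  qed simp
  \<comment> \<open>If the order were 32 or more, powers of \<open>h\<close> would have the orders
    2, 4, 8, 16 and 32.\<close>
  have "j < 4"
  proof (rule ccontr)
    assume "\<not> j < 4"
    then have "i \<le> 5 \<Longrightarrow> i \<le> Suc j" for i by simp
    note p = pw[OF this]
    show False using p[of 1] p[of 2] p[of 3] p[of 4] p[of 5] haupt_32_False by auto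
  qed
  then consider "j = 0" | "j = 1" | "j = 2" | "j = 3" by linarith
  then show "(\<Sum>(k, c)\<leftarrow>[(6, 1), (4, 4), (2, 2), (0, - 8), (3, 112)]. of_int c * fps_nth (F h) k) = 0"
  proof cases
    case 1
    then have "haupt 2 f (F h)" using f by simp
    then show ?thesis using haupt_2_values F0 by simp
  next
    case 2
    then have "haupt 4 f (F h)" using f by simp
    moreover obtain f1 where "haupt 2 f1 (F (h [^] (2::nat)))" using pw[of 1] 2 by auto
    ultimately show ?thesis using haupt_4_values(1-3) F0 F3 2 by simp
  next
    case 3
    then have "haupt 8 f (F h)" using f by simp
    moreover obtain f1 where "haupt 2 f1 (F (h [^] (4::nat)))" using pw[of 1] 3 by auto
    moreover obtain f2 where "haupt 4 f2 (F (h [^] (2::nat)))" using pw[of 2] 3 by auto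
    ultimately show ?thesis using haupt_8_values(1-3) F0 F3 3 by simp
  next
    case 4
    then have "haupt 16 f (F h)" using f by simp
    moreover obtain f1 where "haupt 2 f1 (F (h [^] (8::nat)))" using pw[of 1] 4 by auto
    moreover obtain f2 where "haupt 4 f2 (F (h [^] (4::nat)))" using pw[of 2] 4 by auto
    moreover obtain f3 where "haupt 8 f3 (F (h [^] (2::nat)))" using pw[of 3] 4 by auto
    ultimately show ?thesis using haupt_16_values(1-3) F0 F3 4 by simp
  qed
qed (simp_all add: one_values)

lemma multiplicity_odd_aux:
  fixes xs :: "(nat \<times> int) list"
  assumes p: "prime p"
    and prime: "\<And>f K. haupt p f K \<Longrightarrow> (\<Sum>(k, c)\<leftarrow>xs. of_int c * fps_nth K k) = 0"
    and square: "\<And>f K N. haupt N f K \<Longrightarrow> p\<^sup>2 dvd N \<Longrightarrow> (\<Sum>(k, c)\<leftarrow>xs. of_int c * fps_nth K k) = 0"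
    and one: "(\<Sum>(k, c)\<leftarrow>xs. of_int c * fps_nth (F \<one>) k) = of_int z"
    and z: "\<not> int (p ^ Suc b) dvd z"
  shows "multiplicity p (Coset.order G) \<le> b"
proof (rule multiplicity_order_le[OF p _ one z])
  fix h j assume h: "h \<in> carrier G" "ord h = p ^ Suc j"
  obtain f where f: "haupt (p ^ Suc j) f (F h)" using haupt_series[OF h(1)] h(2) by auto
  show "(\<Sum>(k, c)\<leftarrow>xs. of_int c * fps_nth (F h) k) = 0"
  proof (cases "j = 0")
    case True
    then show ?thesis using prime f by simp
  next
    case False
    then have "p\<^sup>2 dvd p ^ Suc j" by (intro le_imp_power_dvd) simp
    then show ?thesis using square f by blast
  qed
qed

text \<open>\<open>9 * 54 = 2 * 243\<close> at level 3, and
  \<open>z = 3 ^ 12 * 3256\<close>.\<close>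

lemma multiplicity_3: "multiplicity 3 (Coset.order G) \<le> 12"
  by (rule multiplicity_odd_aux[where z = 1730371896 and xs = "[(2, 9), (4, 2)]"])
    (simp_all add: one_values haupt_3_values haupt_9_vanish)

text \<open>\<open>3 * 10 = 30\<close> at level 5, and \<open>z = 5 ^ 6 * 59442\<close>.\<close>

lemma multiplicity_5: "multiplicity 5 (Coset.order G) \<le> 6"
  by (rule multiplicity_odd_aux[where z = 928781250 and xs = "[(3, 3), (4, 1)]"])
    (simp_all add: one_values haupt_5_values haupt_25_vanish)

text \<open>2 and - 2 cancel at level 13, and \<open>z = 13 ^ 2 * 1971740440\<close>.\<close>

lemma multiplicity_13: "multiplicity 13 (Coset.order G) \<le> 2"
  by (rule multiplicity_odd_aux[where z = 333224134360 and xs = "[(3, 1), (6, 1)]"])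
    (simp_all add: one_values haupt_13_values haupt_169_vanish)

text \<open>In a cyclic group of order 49 the coefficient sum would be \<open>196884 + 2 * n \<equiv> 2 * (n + 1)\<close> modulo 49,
  where \<open>n \<le> 47\<close> counts the elements of order 7.\<close>

lemma ord_ne_49:
  assumes g: "g \<in> carrier G"
  shows "ord g \<noteq> 49"
proof
  assume o: "ord g = 49"
  define H where "H = generate G {g}"
  have H: "subgroup H G" unfolding H_def using g by (intro generate_is_subgroup) simp
  have card: "card H = 7 ^ 2" unfolding H_def using generate_pow_card[OF g] o by simp
  have fin: "finite H" using card by (simp add: card_ge_0_finite)
  have gH: "g \<in> H" unfolding H_def by (rule generate.incl) simp
  define S where "S = {h \<in> H. ord h = 7}"
  have val: "fps_nth (F h) 2 = (if ord h = 7 then 2 else 0)" if h: "h \<in> H - {\<one>}" for h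
  proof -
    have hG: "h \<in> carrier G" using H h by (intro subgroup.mem_carrier) auto
    obtain j where j: "ord h = 7 ^ Suc j" using ord_prime_power[OF H card] h by auto
    obtain f where f: "haupt (ord h) f (F h)" using haupt_series[OF hG] by auto
    show ?thesis
    proof (cases "j = 0")
      case True
      then have "ord h = 7" using j by simp
      then show ?thesis using f haupt_7_values by simp
    next
      case False
      then have "(7::nat) ^ 2 dvd 7 ^ Suc j" by (intro le_imp_power_dvd) simp
      then have d: "49 dvd ord h" using j by simp
      then have "ord h \<noteq> 7" by auto
      then show ?thesis using haupt_49_vanish[OF f d] by simp
    qed
  qed
  obtain m :: nat where m: "(\<Sum>h\<in>H. fps_nth (F h) 2) = of_nat (card H * m)" using sum_series[OF H] by blast
  have "(\<Sum>h\<in>H. fps_nth (F h) 2) = 196884 + (\<Sum>h\<in>H - {\<one>}. if ord h = 7 then 2 else 0)"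
    using fin subgroup.one_closed[OF H] val one_values(2) by (subst sum.remove[of _ \<one>]) auto
  also have "(\<Sum>h\<in>H - {\<one>}. if ord h = 7 then 2 else 0 :: complex) = (\<Sum>h\<in>S. 2)"
    by (rule sum.mono_neutral_cong_right) (use fin in \<open>auto simp: S_def ord_id\<close>)
  finally have "(of_nat (196884 + 2 * card S) :: complex) = of_nat (49 * m)" using m card by simp
  then have e: "196884 + 2 * card S = 49 * m" unfolding of_nat_eq_iff .
  \<comment> \<open>Leaving out \<open>g\<close> is decisive: the congruence asks for 48 modulo 49,
    the number of all nontrivial elements.\<close>
  have "S \<subseteq> H - {\<one>, g}" using o by (auto simp: S_def ord_id)
  then have "card S \<le> card (H - {\<one>, g})" using fin by (intro card_mono) auto
  also have "\<dots> = 47"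
  proof -
    have "g \<noteq> \<one>" using o by (auto simp: ord_id)
    then show ?thesis using gH subgroup.one_closed[OF H] fin card by (subst card_Diff_subset) auto
  qed
  finally show False using e by presburger
qed

text \<open>The functional cancels at level 7 but would be - 2 at level 49, so elements of order 49
  are excluded first. At level one \<open>196882 = 7 ^ 4 * 82\<close>.\<close>

lemma multiplicity_7: "multiplicity 7 (Coset.order G) \<le> 4"
proof (rule multiplicity_order_le[where z = 196882 and xs = "[(2, 1), (0, - 2)]"])
  fix h j assume h: "h \<in> carrier G" "ord h = 7 ^ Suc j"
  have "j = 0"
  proof (rule ccontr)
    assume "j \<noteq> 0"
    then have "7 ^ Suc j = 7 ^ (j - 1) * (49::nat)" by (cases j) auto
    then have "ord (h [^] (7 ^ (j - 1) :: nat)) = 49" using h by (subst ord_pow) auto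
    then show False using ord_ne_49 h(1) by blast
  qed
  then obtain f where f: "haupt 7 f (F h)" using haupt_series[OF h(1)] h(2) by auto
  then have "fps_nth (F h) 0 = 1" by (simp add: haupt_def)
  then show "(\<Sum>(k, c)\<leftarrow>[(2, 1), (0, - 2)]. of_int c * fps_nth (F h) k) = 0" using haupt_7_values[OF f] by simp
qed (simp_all add: one_values)

theorem order_restrictions:
  "prime p \<Longrightarrow> p dvd Coset.order G \<Longrightarrow> (p - 1) dvd 24"
  "prime p \<Longrightarrow> odd p \<Longrightarrow> real (multiplicity p (Coset.order G)) \<le> 24 / (real p - 1)"
  "multiplicity 2 (Coset.order G) \<le> 25"
proof -
  show "(p - 1) dvd 24" if p: "prime p" and d: "p dvd Coset.order G"
    using prime_dvd_order[OF p d] by auto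
  show "real (multiplicity p (Coset.order G)) \<le> 24 / (real p - 1)" if p: "prime p" and o: "odd p"
  proof (cases "p dvd Coset.order G")
    case True
    from prime_dvd_order[OF p True] o show ?thesis
      using multiplicity_3 multiplicity_5 multiplicity_7 multiplicity_13 by auto
  next
    case False
    then have "multiplicity p (Coset.order G) = 0" by (rule not_dvd_imp_multiplicity_0)
    then show ?thesis using prime_ge_1_nat[OF p] by simp
  qed
  show "multiplicity 2 (Coset.order G) \<le> 25" by (rule multiplicity_2)
qed

end

theorem theorem1p2:
  fixes G :: "('g, 'r) monoid_scheme"
    and smul :: "complex \<Rightarrow> 'v::ab_group_add \<Rightarrow> 'v"
    and act :: "'g \<Rightarrow> 'v \<Rightarrow> 'v"
    and V :: "int \<Rightarrow> 'v set"
  assumes "group G" and "finite (carrier G)"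
    and "graded_group_module G smul act V"
    and "\<And>n. n \<ge> -1 \<Longrightarrow> finite_dim_subspace smul (V n)"
    and "\<And>g. g \<in> carrier G \<Longrightarrow> has_genus (modular_curve (group.ord G g)) 0"
    and "\<And>g. g \<in> carrier G \<Longrightarrow>
           \<exists>T. normalized_hauptmodul (group.ord G g) T \<and>
               has_q_expansion 1 (-1) (\<lambda>n. trace_on smul (V n) (act g)) T"
  shows "(\<forall>p::nat. prime p \<longrightarrow> p dvd Coset.order G \<longrightarrow> (p - 1) dvd 24) \<and>
         (\<forall>p::nat. prime p \<longrightarrow> odd p \<longrightarrow>
            real (multiplicity p (Coset.order G)) \<le> 24 / (real p - 1)) \<and>
         multiplicity 2 (Coset.order G) \<le> 25"
proof -
  interpret graded_group_module G smul act V by (rule assms(3))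
  define F where "F g = Abs_fps (\<lambda>k. trace_on smul (V (int k - 1)) (act g))" for g
  interpret hauptmodul_series G F
  proof
    show "finite (carrier G)" by (rule assms(2))
    show "\<exists>f. haupt (grp.ord g) f (F g)" if g: "g \<in> carrier G" for g
    proof -
      obtain T where T: "normalized_hauptmodul (grp.ord g) T"
        "has_q_expansion 1 (-1) (\<lambda>n. trace_on smul (V n) (act g)) T"
        using assms(6)[OF g] by blast
      have ord: "grp.ord g > 0" using grp.ord_ge_1[OF assms(2) g] by simp
      show ?thesis unfolding F_def by (rule exI[of _ T]) (rule haupt_intro[OF T ord])
    qed
    show "\<exists>m::nat. (\<Sum>h\<in>H. fps_nth (F h) k) = of_nat (card H * m)" if H: "subgroup H G" for H k
    proof -
      have fin: "finite H" using H assms(2) by (metis subgroup.subset finite_subset)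
      have k: "int k - 1 \<ge> - 1" by simp
      obtain m where "(\<Sum>h\<in>H. trace_on smul (V (int k - 1)) (act h)) = of_nat (card H * m)"
        using sum_trace_subgroup[OF H fin k assms(4)[OF k]] .
      then show ?thesis unfolding F_def by auto
    qed
  qed
  show ?thesis using order_restrictions by blast
qed

end
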